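(* Let $\mathcal L=\{\mathcal L_\theta\mid\theta\in\mathcal S\}$ and $\tilde{\mathcal L}=\{\tilde{\mathcal L}_{\tilde\theta}\mid\tilde\theta\in\tilde{\mathcal S}\}$ be similar classes of differential equations. Then their group classifications with respect to the corresponding equivalence groups are equivalent.
   Context: A class of (systems of) differential equations $\mathcal L=\{\mathcal L_\theta\mid\theta\in\mathcal S\}$ of order $r$ in independent variables $x=(x_1,\dots,x_n)$ and dependent variables $u=(u^1,\dots,u^m)$ is parameterized by a tuple $\theta=\theta(x,u_{(r)})$ of arbitrary elements running through the solution set $\mathcal S$ of an auxiliary system of differential equations and inequalities; $u_{(r)}$ is the tuple of derivatives of $u$ up to order $r$. Point transformations are local diffeomorphisms. Let $\pi_p$, $p=0,\dots,r$, be the projection from the space of $(x,u_{(r)},\theta)$ onto the space of $(x,u_{(p)})$, and $\pi:=\pi_0$. The class $\mathcal L$ is similar to $\tilde{\mathcal L}$ if they have the same number of independent variables, of dependent variables and of equations in systems and the same order of systems, and there exists a point transformation $\Psi\colon(x,u_{(r)},\theta)\mapsto(\tilde x,\tilde u_{(r)},\tilde\theta)$ (a similarity transformation) that is projectable on the space of $(x,u_{(p)})$ for any $0\le p\le r$, whereas $(\pi_p)_*\Psi$ is the $p$th order prolongation of $\pi_*\Psi$, $\Psi_*\mathcal S=\tilde{\mathcal S}$ and $\Psi_*\mathcal L_\theta=\tilde{\mathcal L}_{\Psi_*\theta}$ for any $\theta\in\mathcal S$. The (usual) equivalence group $G^\sim_{\mathcal L}$ consists of the point transformations $\mathscr T$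 in the space of $(x,u_{(r)},\theta)$ that are projectable to the spaces of $(x,u)$ and of $(x,u_{(r)})$, are consistent with the contact structure of the jet space and map $\mathcal L_\theta$ to a system $\mathcal L_{\mathscr T_*\theta}$ of the class for each $\theta\in\mathcal S$. $\mathfrak g_\theta$ is the maximal Lie invariance algebra of $\mathcal L_\theta$. A family of subalgebras $\mathfrak g^{\rm unf}_\theta\subseteq\mathfrak g_\theta$, $\theta\in\mathcal S$, is $G^\sim_{\mathcal L}$-uniform if $(\pi_*\mathscr T)_*\mathfrak g^{\rm unf}_\theta=\mathfrak g^{\rm unf}_{\mathscr T_*\theta}$ for all $\theta\in\mathcal S$ and $\mathscr T\in G^\sim_{\mathcal L}$; for instance, all $\mathfrak g^{\rm unf}_\theta$ may be taken equal to the kernel algebra $\mathfrak g^\cap_{\mathcal L}=\bigcap_{\theta\in\mathcal S}\mathfrak g_\theta$. The group classification of $\mathcal L$ with respect to $G^\sim_{\mathcal L}$ and such a family consists in listing a complete set of $G^\sim_{\mathcal L}$-inequivalent $\theta\in\mathcal S$ with $\mathfrak g_\theta\supsetneq\mathfrak g^{\rm unf}_\theta$. Equivalence of the group classifications of $\mathcal L$ and $\tilde{\mathcal L}$ means that, via a similarity transformation $\Psi$, $\theta_1,\theta_2\in\mathcal S$ are $G^\sim_{\mathcal L}$-equivalent iff $\Psi_*\theta_1,\Psi_*\theta_2$ are $G^\sim_{\tilde{\mathcal L}}$-equivalent; the kernel algebra of $\mathcal L$ is mapped by $\pi_*\Psi$ onto the kernel algebra of $\tilde{\mathcal L}$; and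 any $G^\sim_{\mathcal L}$-uniform family $\{\mathfrak g^{\rm unf}_\theta\}$ is mapped to the $G^\sim_{\tilde{\mathcal L}}$-uniform family $\mathfrak g^{\rm unf}_{\Psi_*\theta}:=(\pi_*\Psi)_*\mathfrak g^{\rm unf}_\theta$, so that $\Psi$ maps a classification list for $\mathcal L$ with respect to $\{\mathfrak g^{\rm unf}_\theta\}$ to a classification list for $\tilde{\mathcal L}$ with respect to the image family. *)

theory Defs
  imports "HOL-Analysis.Analysis"
begin

section \<open>Smooth maps and local diffeomorphisms\<close>

text \<open>Meant for open \<open>S\<close> only.\<close>

primrec Ck_on :: "nat \<Rightarrow> 'a::euclidean_space set \<Rightarrow> ('a \<Rightarrow> 'b::euclidean_space) \<Rightarrow> bool" where
  "Ck_on 0 S f \<longleftrightarrow> continuous_on S f"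
| "Ck_on (Suc k) S f \<longleftrightarrow>
     (\<forall>x\<in>S. f differentiable (at x)) \<and> (\<forall>v. Ck_on k S (\<lambda>x. frechet_derivative f (at x) v))"

definition smooth_on :: "'a::euclidean_space set \<Rightarrow> ('a \<Rightarrow> 'b::euclidean_space) \<Rightarrow> bool" where
  "smooth_on S f \<longleftrightarrow> (\<forall>k. Ck_on k S f)"

text \<open>
  Everything is local: transformations and arbitrary elements are partial functions with open
  domains. For injective \<open>f\<close>, \<open>pinv f\<close> is the inverse, defined on the range of \<open>f\<close>.
\<close>

definition pinv :: "('a \<rightharpoonup> 'b) \<Rightarrow> ('b \<rightharpoonup> 'a)" where
  "pinv f = (\<lambda>y. if y \<in> ran f then Some (SOME x. f x = Some y) else None)"

definition local_diffeo :: "('a::euclidean_space \<rightharpoonup> 'b::euclidean_space) \<Rightarrow> bool" where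
  "local_diffeo f \<longleftrightarrow>
     open (dom f) \<and> open (ran f) \<and> inj_on f (dom f) \<and>
     smooth_on (dom f) (\<lambda>x. the (f x)) \<and> smooth_on (ran f) (\<lambda>y. the (pinv f y))"

text \<open>
  Projectability of \<open>T\<close> along a projection \<open>p\<close>, and the push-forward \<open>p\<^sub>*T\<close> it then has.
\<close>

definition projectable :: "('a \<Rightarrow> 'b) \<Rightarrow> ('a \<rightharpoonup> 'a) \<Rightarrow> bool" where
  "projectable p T \<longleftrightarrow>
     (\<forall>w\<in>dom T. \<forall>w'\<in>dom T. p w = p w' \<longrightarrow> p (the (T w)) = p (the (T w')))"

definition proj_map :: "('a \<Rightarrow> 'b) \<Rightarrow> ('a \<rightharpoonup> 'a) \<Rightarrow> ('b \<rightharpoonup> 'b)" where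
  "proj_map p T =
     (\<lambda>y. if y \<in> p ` dom T then Some (p (the (T (SOME w. w \<in> dom T \<and> p w = y)))) else None)"


section \<open>Jet spaces\<close>

text \<open>
  Multi-indices of length at most \<open>r\<close>. The order \<open>r \<ge> 1\<close>, arbitrary but fixed, is the cardinality
  of the type \<open>'r\<close>, just as the numbers of variables are those of \<open>'n\<close> and \<open>'m\<close>.
\<close>

typedef ('n::finite, 'r::finite) midx = "{\<alpha> :: 'n \<Rightarrow> nat. (\<Sum>i\<in>UNIV. \<alpha> i) \<le> CARD('r)}"
  morphisms midx_fun Abs_midx
  by (rule exI[of _ "\<lambda>_. 0"]) simp

instance midx :: (finite, finite) finite
proof
  let ?B = "{f :: 'a \<Rightarrow> nat. \<forall>x. (x \<in> UNIV \<longrightarrow> f x \<in> {..CARD('b)}) \<and> (x \<notin> UNIV \<longrightarrow> f x = 0)}"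
  have "finite ?B"
    by (rule finite_set_of_finite_funs) auto
  moreover have "range (midx_fun :: ('a, 'b) midx \<Rightarrow> _) \<subseteq> ?B"
  proof clarify
    fix \<alpha> :: "('a, 'b) midx" and x :: 'a
    have "midx_fun \<alpha> x \<le> (\<Sum>i\<in>UNIV. midx_fun \<alpha> i)"
      by (rule member_le_sum) auto
    also have "\<dots> \<le> CARD('b)"
      using midx_fun[of \<alpha>] by simp
    finally show "(x \<in> UNIV \<longrightarrow> midx_fun \<alpha> x \<in> {..CARD('b)}) \<and> (x \<notin> UNIV \<longrightarrow> midx_fun \<alpha> x = 0)"
      by simp
  qed
  ultimately have "finite (range (midx_fun :: ('a, 'b) midx \<Rightarrow> _))"
    by (rule finite_subset[rotated])
  then show "finite (UNIV :: ('a, 'b) midx set)"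
    by (rule finite_imageD) (simp add: inj_def midx_fun_inject)
qed

definition midx_ord :: "('n::finite, 'r::finite) midx \<Rightarrow> nat" where
  "midx_ord \<alpha> = (\<Sum>i\<in>UNIV. midx_fun \<alpha> i)"

definition midx_zero :: "('n::finite, 'r::finite) midx" where
  "midx_zero = Abs_midx (\<lambda>_. 0)"

text \<open>\<open>\<alpha> + \<delta>\<^sub>i\<close>; used only if \<open>midx_ord \<alpha> < r\<close>.\<close>

definition midx_incr :: "('n::finite, 'r::finite) midx \<Rightarrow> 'n \<Rightarrow> ('n, 'r) midx" where
  "midx_incr \<alpha> i = Abs_midx ((midx_fun \<alpha>)(i := Suc (midx_fun \<alpha> i)))"

text \<open>
  The space of \<open>(x, u\<^sub>(\<^sub>r\<^sub>))\<close>: coordinate \<open>Inl i\<close> is \<open>x\<^sub>i\<close>, and \<open>Inr (\<alpha>, a)\<close> is the derivative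
  \<open>u\<^sup>a\<^sub>\<alpha>\<close>, where \<open>\<alpha> = 0\<close> gives \<open>u\<^sup>a\<close> itself.
\<close>

type_synonym ('n, 'm, 'r) jet = "real ^ ('n + ('n, 'r) midx \<times> 'm)"

text \<open>The space of \<open>(x, u)\<close>.\<close>

type_synonym ('n, 'm) base = "(real ^ 'n) \<times> (real ^ 'm)"

definition to_base :: "('n::finite, 'm::finite, 'r::finite) jet \<Rightarrow> ('n, 'm) base" where
  "to_base z = (\<chi> i. z $ Inl i, \<chi> a. z $ Inr (midx_zero, a))"

text \<open>
  For \<open>p \<le> r\<close>, the space of \<open>(x, u\<^sub>(\<^sub>p\<^sub>))\<close> is identified with the subspace of the space of
  \<open>(x, u\<^sub>(\<^sub>r\<^sub>))\<close> on which the coordinates of order greater than \<open>p\<close> vanish; \<open>trunc p\<close> projects onto it.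
\<close>

definition trunc :: "nat \<Rightarrow> ('n::finite, 'm::finite, 'r::finite) jet \<Rightarrow> ('n, 'm, 'r) jet" where
  "trunc p z = (\<chi> c. case c of Inl i \<Rightarrow> z $ Inl i
                      | Inr (\<alpha>, a) \<Rightarrow> if midx_ord \<alpha> \<le> p then z $ Inr (\<alpha>, a) else 0)"

text \<open>
  The Cartan distribution of the \<open>p\<close>th order jet space at its point \<open>z\<close>, i.e. the common kernel of
  the contact forms \<open>du\<^sup>a\<^sub>\<alpha> - \<Sum>\<^sub>i u\<^sup>a\<^sub>\<alpha>\<^sub>+\<^sub>i dx\<^sub>i\<close> with \<open>|\<alpha>| < p\<close>.
\<close>

definition cartan :: "nat \<Rightarrow> ('n::finite, 'm::finite, 'r::finite) jet \<Rightarrow> ('n, 'm, 'r) jet set" where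
  "cartan p z = {v \<in> range (trunc p).
     \<forall>\<alpha> a. midx_ord \<alpha> < p \<longrightarrow> v $ Inr (\<alpha>, a) = (\<Sum>i\<in>UNIV. z $ Inr (midx_incr \<alpha> i, a) * v $ Inl i)}"

text \<open>
  Consistency with the contact structure of the \<open>p\<close>th order jet space. Differentiating the
  composition with \<open>trunc p\<close> gives the differential along the subspace \<open>range (trunc p)\<close>;
  for \<open>p = r\<close>, \<open>trunc p\<close> is the identity.
\<close>

definition contact_map ::
  "nat \<Rightarrow> (('n::finite, 'm::finite, 'r::finite) jet \<rightharpoonup> ('n, 'm, 'r) jet) \<Rightarrow> bool" where
  "contact_map p F \<longleftrightarrow>
     (\<forall>z\<in>dom F. frechet_derivative (\<lambda>w. the (F (trunc p w))) (at z) ` cartan p z = cartan p (the (F z)))"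

text \<open>
  \<open>F\<close> is the prolongation of \<open>\<phi>\<close> to the \<open>p\<close>th order jet space: the lift of \<open>\<phi>\<close> that respects the
  contact structure. In coordinates this is the chain rule
  \<open>D\<^sub>i U\<^sup>a\<^sub>\<alpha> = \<Sum>\<^sub>j U\<^sup>a\<^sub>\<alpha>\<^sub>+\<^sub>j D\<^sub>i X\<^sub>j\<close>, \<open>|\<alpha>| < p\<close>, for the components \<open>X\<^sub>j\<close>, \<open>U\<^sup>a\<^sub>\<alpha>\<close> of \<open>F\<close>.
\<close>

definition prolongs ::
  "nat \<Rightarrow> (('n::finite, 'm::finite) base \<rightharpoonup> ('n, 'm) base) \<Rightarrow>
   (('n, 'm, 'r::finite) jet \<rightharpoonup> ('n, 'm, 'r) jet) \<Rightarrow> bool" where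
  "prolongs p \<phi> F \<longleftrightarrow>
     (\<forall>z\<in>dom F. \<phi> (to_base z) = Some (to_base (the (F z)))) \<and> contact_map p F"


section \<open>Vector fields on the space of \<open>(x, u)\<close> and their prolongations\<close>

text \<open>
  A vector field on an open set \<open>M\<close> is extended by zero outside of \<open>M\<close>, so that equality of functions
  is equality of vector fields on \<open>M\<close>.
\<close>

definition vector_fields :: "'a::euclidean_space set \<Rightarrow> ('a \<Rightarrow> 'a) set" where
  "vector_fields M = {Q. smooth_on M Q \<and> (\<forall>x. x \<notin> M \<longrightarrow> Q x = 0)}"

definition lie_bracket :: "'a::euclidean_space set \<Rightarrow> ('a \<Rightarrow> 'a) \<Rightarrow> ('a \<Rightarrow> 'a) \<Rightarrow> ('a \<Rightarrow> 'a)" where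
  "lie_bracket M Q R =
     (\<lambda>x. if x \<in> M then frechet_derivative R (at x) (Q x) - frechet_derivative Q (at x) (R x) else 0)"

definition lie_subalgebra :: "'a::euclidean_space set \<Rightarrow> ('a \<Rightarrow> 'a) set \<Rightarrow> ('a \<Rightarrow> 'a) set \<Rightarrow> bool" where
  "lie_subalgebra M h g \<longleftrightarrow>
     h \<subseteq> g \<and> (\<lambda>_. 0) \<in> h \<and>
     (\<forall>c. \<forall>Q\<in>h. (\<lambda>x. c *\<^sub>R Q x) \<in> h) \<and>
     (\<forall>Q\<in>h. \<forall>R\<in>h. (\<lambda>x. Q x + R x) \<in> h \<and> lie_bracket M Q R \<in> h)"

definition push_field ::
  "('a::euclidean_space \<rightharpoonup> 'a) \<Rightarrow> ('a \<Rightarrow> 'a) \<Rightarrow> ('a \<Rightarrow> 'a)" where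
  "push_field \<phi> Q =
     (\<lambda>y. case pinv \<phi> y of None \<Rightarrow> 0
          | Some x \<Rightarrow> frechet_derivative (\<lambda>x. the (\<phi> x)) (at x) (Q x))"

text \<open>
  \<open>total_deriv i F\<close> is the total derivative \<open>D\<^sub>i F\<close> of a function \<open>F\<close> that only depends on
  coordinates of order less than \<open>r\<close>.
\<close>

definition total_vec :: "'n::finite \<Rightarrow> ('n, 'm::finite, 'r::finite) jet \<Rightarrow> ('n, 'm, 'r) jet" where
  "total_vec i z = (\<chi> c. case c of Inl j \<Rightarrow> if j = i then 1 else 0
                          | Inr (\<alpha>, a) \<Rightarrow> if midx_ord \<alpha> < CARD('r) then z $ Inr (midx_incr \<alpha> i, a) else 0)"

definition total_deriv ::
  "'n::finite \<Rightarrow> (('n, 'm::finite, 'r::finite) jet \<Rightarrow> real) \<Rightarrow> ('n, 'm, 'r) jet \<Rightarrow> real" where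
  "total_deriv i F z = frechet_derivative F (at z) (total_vec i z)"

text \<open>
  \<open>X\<close> is the \<open>r\<close>th prolongation of \<open>Q\<close> over the open set \<open>D\<close>. With
  \<open>X = \<Sum>\<^sub>j \<xi>\<^sub>j \<partial>/\<partial>x\<^sub>j + \<Sum> \<eta>\<^sup>a\<^sub>\<alpha> \<partial>/\<partial>u\<^sup>a\<^sub>\<alpha>\<close>, the second condition is the prolongation formula
  \<open>\<eta>\<^sup>a\<^sub>\<alpha>\<^sub>+\<^sub>i = D\<^sub>i \<eta>\<^sup>a\<^sub>\<alpha> - \<Sum>\<^sub>j u\<^sup>a\<^sub>\<alpha>\<^sub>+\<^sub>j D\<^sub>i \<xi>\<^sub>j\<close>. By recursion, \<open>\<eta>\<^sup>a\<^sub>\<alpha>\<close> only depends on coordinates of order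
  at most \<open>|\<alpha>|\<close>.
\<close>

definition prolongs_field ::
  "('n::finite, 'm::finite, 'r::finite) jet set \<Rightarrow> (('n, 'm) base \<Rightarrow> ('n, 'm) base) \<Rightarrow>
   (('n, 'm, 'r) jet \<Rightarrow> ('n, 'm, 'r) jet) \<Rightarrow> bool" where
  "prolongs_field D Q X \<longleftrightarrow>
     smooth_on D X \<and>
     (\<forall>z\<in>D. to_base (X z) = Q (to_base z)) \<and>
     (\<forall>z\<in>D. \<forall>i \<alpha> a. midx_ord \<alpha> < CARD('r) \<longrightarrow>
        X z $ Inr (midx_incr \<alpha> i, a) =
          total_deriv i (\<lambda>w. X w $ Inr (\<alpha>, a)) z
          - (\<Sum>j\<in>UNIV. z $ Inr (midx_incr \<alpha> j, a) * total_deriv i (\<lambda>w. X w $ Inl j) z))"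

text \<open>
  The local flow of \<open>X\<close> on \<open>D\<close> maps \<open>V\<close> into \<open>V\<close>: an integral curve that meets \<open>V\<close> stays in \<open>V\<close>.
\<close>

definition flow_invariant ::
  "'a::euclidean_space set \<Rightarrow> ('a \<Rightarrow> 'a) \<Rightarrow> 'a set \<Rightarrow> bool" where
  "flow_invariant D X V \<longleftrightarrow>
     (\<forall>(c :: real \<Rightarrow> 'a) a b.
        (\<forall>t\<in>{a<..<b}. c t \<in> D \<and> (c has_vector_derivative X (c t)) (at t)) \<and>
        (\<exists>t\<in>{a<..<b}. c t \<in> V) \<longrightarrow> (\<forall>t\<in>{a<..<b}. c t \<in> V))"


section \<open>Classes of differential equations\<close>

text \<open>
  The jet of a local vector function \<open>\<theta>\<close> of \<open>z\<close>: the tuple of \<open>z\<close> and of the derivatives of \<open>\<theta>\<close> up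
  to order \<open>q\<close>. For smooth \<open>\<theta>\<close> the order of differentiations is irrelevant.
\<close>

primrec iter_partial :: "'c::finite list \<Rightarrow> (real ^ 'c \<Rightarrow> real) \<Rightarrow> (real ^ 'c \<Rightarrow> real)" where
  "iter_partial [] f = f"
| "iter_partial (c # cs) f = (\<lambda>z. frechet_derivative (iter_partial cs f) (at z) (axis c 1))"

definition partial_midx ::
  "('c::finite, 'q::finite) midx \<Rightarrow> (real ^ 'c \<Rightarrow> real) \<Rightarrow> (real ^ 'c \<Rightarrow> real)" where
  "partial_midx \<beta> f = iter_partial (SOME cs. \<forall>c. count_list cs c = midx_fun \<beta> c) f"

definition jet_of ::
  "(real ^ 'c \<rightharpoonup> real ^ 'k) \<Rightarrow> real ^ 'c \<Rightarrow> ('c::finite, 'k::finite, 'q::finite) jet" where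
  "jet_of \<theta> z = (\<chi> c. case c of Inl i \<Rightarrow> z $ i
                      | Inr (\<beta>, s) \<Rightarrow> partial_midx \<beta> (\<lambda>w. the (\<theta> w) $ s) z)"

type_synonym ('n, 'm, 'r, 'k) arb = "('n, 'm, 'r) jet \<rightharpoonup> real ^ 'k"

text \<open>The space of \<open>(x, u\<^sub>(\<^sub>r\<^sub>), \<theta>)\<close>.\<close>

type_synonym ('n, 'm, 'r, 'k) ext = "('n, 'm, 'r) jet \<times> (real ^ 'k)"

text \<open>
  A class of systems \<open>L(x, u\<^sub>(\<^sub>r\<^sub>), \<theta>(x, u\<^sub>(\<^sub>r\<^sub>))) = 0\<close> of \<open>CARD('l)\<close> equations, \<open>L = de_lhs\<close>, with
  \<open>CARD('k)\<close> arbitrary elements. The auxiliary system, of order at most \<open>CARD('q)\<close> in the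
  independent variables \<open>(x, u\<^sub>(\<^sub>r\<^sub>))\<close> and the unknown functions \<open>\<theta>\<close>, consists of equations
  \<open>A = 0\<close> and inequalities \<open>A \<noteq> 0\<close> and \<open>A > 0\<close>.
\<close>

record ('n, 'm, 'r, 'k, 'l, 'q) de_class =
  de_dom :: "('n::finite, 'm::finite, 'r::finite, 'k::finite) ext set"
  de_lhs :: "('n, 'm, 'r, 'k) ext \<Rightarrow> real ^ ('l::finite)"
  aux_dom :: "('n + ('n, 'r) midx \<times> 'm, 'k, 'q::finite) jet set"
  aux_eqs :: "(('n + ('n, 'r) midx \<times> 'm, 'k, 'q) jet \<Rightarrow> real) set"
  aux_neqs :: "(('n + ('n, 'r) midx \<times> 'm, 'k, 'q) jet \<Rightarrow> real) set"
  aux_pos :: "(('n + ('n, 'r) midx \<times> 'm, 'k, 'q) jet \<Rightarrow> real) set"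

definition well_formed_class ::
  "('n::finite, 'm::finite, 'r::finite, 'k::finite, 'l::finite, 'q::finite) de_class \<Rightarrow> bool" where
  "well_formed_class C \<longleftrightarrow>
     open (de_dom C) \<and> smooth_on (de_dom C) (de_lhs C) \<and>
     open (aux_dom C) \<and>
     finite (aux_eqs C) \<and> finite (aux_neqs C) \<and> finite (aux_pos C) \<and>
     (\<forall>A \<in> aux_eqs C \<union> aux_neqs C \<union> aux_pos C. smooth_on (aux_dom C) A)"

text \<open>The set \<open>\<S>\<close>, consisting of all local solutions of the auxiliary system.\<close>

definition arbs ::
  "('n::finite, 'm::finite, 'r::finite, 'k::finite, 'l::finite, 'q::finite) de_class \<Rightarrow>
   ('n, 'm, 'r, 'k) arb set" where
  "arbs C = {\<theta>. open (dom \<theta>) \<and> dom \<theta> \<noteq> {} \<and> smooth_on (dom \<theta>) (\<lambda>z. the (\<theta> z)) \<and>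
     Map.graph \<theta> \<subseteq> de_dom C \<and>
     (\<forall>z\<in>dom \<theta>. jet_of \<theta> z \<in> aux_dom C \<and>
        (\<forall>A\<in>aux_eqs C. A (jet_of \<theta> z) = 0) \<and>
        (\<forall>A\<in>aux_neqs C. A (jet_of \<theta> z) \<noteq> 0) \<and>
        (\<forall>A\<in>aux_pos C. A (jet_of \<theta> z) > 0))}"

text \<open>The system \<open>\<L>\<^sub>\<theta>\<close>, identified with the subset of the jet space that it defines.\<close>

definition de_system ::
  "('n::finite, 'm::finite, 'r::finite, 'k::finite, 'l::finite, 'q::finite) de_class \<Rightarrow>
   ('n, 'm, 'r, 'k) arb \<Rightarrow> ('n, 'm, 'r) jet set" where
  "de_system C \<theta> = {z \<in> dom \<theta>. de_lhs C (z, the (\<theta> z)) = 0}"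

text \<open>
  The projections \<open>\<pi>\<close> and \<open>\<pi>\<^sub>p\<close> of the space of \<open>(x, u\<^sub>(\<^sub>r\<^sub>), \<theta>)\<close>. Since \<open>trunc r\<close> is the identity,
  \<open>\<pi>\<^sub>r\<close> is also \<open>fst\<close>.
\<close>

definition pi0 :: "('n::finite, 'm::finite, 'r::finite, 'k::finite) ext \<Rightarrow> ('n, 'm) base" where
  "pi0 w = to_base (fst w)"

definition pip ::
  "nat \<Rightarrow> ('n::finite, 'm::finite, 'r::finite, 'k::finite) ext \<Rightarrow> ('n, 'm, 'r) jet" where
  "pip p w = trunc p (fst w)"

text \<open>
  \<open>push_arb T \<theta>\<close> is \<open>T\<^sub>*\<theta>\<close>, the function whose graph is the image of the graph of \<open>\<theta>\<close>. It is used
  only if \<open>T\<close> is defined on the whole graph of \<open>\<theta>\<close>.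
\<close>

definition push_arb :: "('z \<times> 't \<rightharpoonup> 'z \<times> 't) \<Rightarrow> ('z \<rightharpoonup> 't) \<Rightarrow> ('z \<rightharpoonup> 't)" where
  "push_arb T \<theta> =
     (\<lambda>z. if \<exists>t. Some (z, t) \<in> T ` Map.graph \<theta> then Some (SOME t. Some (z, t) \<in> T ` Map.graph \<theta>) else None)"

definition push_system ::
  "(('n::finite, 'm::finite, 'r::finite, 'k::finite) ext \<rightharpoonup> ('n, 'm, 'r, 'k) ext) \<Rightarrow>
   ('n, 'm, 'r) jet set \<Rightarrow> ('n, 'm, 'r) jet set" where
  "push_system T V = (\<lambda>z. the (proj_map fst T z)) ` V"

definition point_transformation ::
  "(('n::finite, 'm::finite, 'r::finite, 'k::finite) ext \<rightharpoonup> ('n, 'm, 'r, 'k) ext) \<Rightarrow> bool" where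
  "point_transformation T \<longleftrightarrow>
     local_diffeo T \<and>
     projectable pi0 T \<and> local_diffeo (proj_map pi0 T) \<and>
     projectable fst T \<and> local_diffeo (proj_map fst T)"

definition similarity_transformation ::
  "(('n::finite, 'm::finite, 'r::finite, 'k::finite) ext \<rightharpoonup> ('n, 'm, 'r, 'k) ext) \<Rightarrow>
   ('n, 'm, 'r, 'k, 'l::finite, 'q::finite) de_class \<Rightarrow>
   ('n, 'm, 'r, 'k, 'l, 's::finite) de_class \<Rightarrow> bool" where
  "similarity_transformation \<Psi> C C' \<longleftrightarrow>
     point_transformation \<Psi> \<and>
     (\<forall>p\<le>CARD('r). projectable (pip p) \<Psi> \<and> prolongs p (proj_map pi0 \<Psi>) (proj_map (pip p) \<Psi>)) \<and>
     (\<forall>\<theta>\<in>arbs C. Map.graph \<theta> \<subseteq> dom \<Psi>) \<and>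
     push_arb \<Psi> ` arbs C = arbs C' \<and>
     (\<forall>\<theta>\<in>arbs C. push_system \<Psi> (de_system C \<theta>) = de_system C' (push_arb \<Psi> \<theta>))"

text \<open>
  The equality of the numbers of variables and equations and of the orders is expressed by the types.
\<close>

definition similar_classes ::
  "('n::finite, 'm::finite, 'r::finite, 'k::finite, 'l::finite, 'q::finite) de_class \<Rightarrow>
   ('n, 'm, 'r, 'k, 'l, 's::finite) de_class \<Rightarrow> bool" where
  "similar_classes C C' \<longleftrightarrow> (\<exists>\<Psi>. similarity_transformation \<Psi> C C')"


section \<open>The equivalence group and group classification\<close>

text \<open>
  The arbitrary elements that a local transformation \<open>T\<close> has to act on are those defined over
  (a part of) the domain of its projection to the space of \<open>(x, u\<^sub>(\<^sub>r\<^sub>))\<close>.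
\<close>

definition acts_on :: "('z \<times> 't \<rightharpoonup> 'z \<times> 't) \<Rightarrow> ('z \<rightharpoonup> 't) \<Rightarrow> bool" where
  "acts_on T \<theta> \<longleftrightarrow> dom \<theta> \<subseteq> fst ` dom T"

definition maps_class_into_itself ::
  "('n::finite, 'm::finite, 'r::finite, 'k::finite, 'l::finite, 'q::finite) de_class \<Rightarrow>
   (('n, 'm, 'r, 'k) ext \<rightharpoonup> ('n, 'm, 'r, 'k) ext) \<Rightarrow> bool" where
  "maps_class_into_itself C T \<longleftrightarrow>
     (\<forall>\<theta>\<in>arbs C. acts_on T \<theta> \<longrightarrow>
        Map.graph \<theta> \<subseteq> dom T \<and> push_arb T \<theta> \<in> arbs C \<and>
        push_system T (de_system C \<theta>) = de_system C (push_arb T \<theta>))"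

text \<open>
  The condition on the inverse makes this a pseudogroup: \<open>T\<^sub>*\<S>\<close> could otherwise be a proper subset
  of \<open>\<S>\<close>.
\<close>

definition equiv_group ::
  "('n::finite, 'm::finite, 'r::finite, 'k::finite, 'l::finite, 'q::finite) de_class \<Rightarrow>
   (('n, 'm, 'r, 'k) ext \<rightharpoonup> ('n, 'm, 'r, 'k) ext) set" where
  "equiv_group C = {T.
     point_transformation T \<and>
     contact_map CARD('r) (proj_map fst T) \<and>
     maps_class_into_itself C T \<and> maps_class_into_itself C (pinv T)}"

definition equivalent_arbs ::
  "('n::finite, 'm::finite, 'r::finite, 'k::finite, 'l::finite, 'q::finite) de_class \<Rightarrow>
   ('n, 'm, 'r, 'k) arb \<Rightarrow> ('n, 'm, 'r, 'k) arb \<Rightarrow> bool" where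
  "equivalent_arbs C \<theta>\<^sub>1 \<theta>\<^sub>2 \<longleftrightarrow> (\<exists>T\<in>equiv_group C. acts_on T \<theta>\<^sub>1 \<and> push_arb T \<theta>\<^sub>1 = \<theta>\<^sub>2)"

text \<open>
  The maximal Lie invariance algebra \<open>\<g>\<^sub>\<theta>\<close>: the vector fields on the underlying domain in the space of
  \<open>(x, u)\<close> that generate local one-parameter groups of point symmetries of \<open>\<L>\<^sub>\<theta>\<close>.
\<close>

definition lie_invariance_algebra ::
  "('n::finite, 'm::finite, 'r::finite, 'k::finite, 'l::finite, 'q::finite) de_class \<Rightarrow>
   ('n, 'm, 'r, 'k) arb \<Rightarrow> (('n, 'm) base \<Rightarrow> ('n, 'm) base) set" where
  "lie_invariance_algebra C \<theta> =
     {Q \<in> vector_fields (to_base ` dom \<theta>).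
        \<exists>X. prolongs_field (dom \<theta>) Q X \<and> flow_invariant (dom \<theta>) X (de_system C \<theta>)}"

text \<open>
  The kernel algebra over an open subset \<open>D\<close> of the jet space: since vector fields can be
  intersected only on a common domain, all \<open>\<theta>\<close> are taken with the domain \<open>D\<close>.
\<close>

definition kernel_algebra ::
  "('n::finite, 'm::finite, 'r::finite, 'k::finite, 'l::finite, 'q::finite) de_class \<Rightarrow>
   ('n, 'm, 'r) jet set \<Rightarrow> (('n, 'm) base \<Rightarrow> ('n, 'm) base) set" where
  "kernel_algebra C D = (\<Inter>\<theta>\<in>{\<theta> \<in> arbs C. dom \<theta> = D}. lie_invariance_algebra C \<theta>)"

definition uniform_family ::
  "('n::finite, 'm::finite, 'r::finite, 'k::finite, 'l::finite, 'q::finite) de_class \<Rightarrow>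
   (('n, 'm, 'r, 'k) arb \<Rightarrow> (('n, 'm) base \<Rightarrow> ('n, 'm) base) set) \<Rightarrow> bool" where
  "uniform_family C g \<longleftrightarrow>
     (\<forall>\<theta>\<in>arbs C. lie_subalgebra (to_base ` dom \<theta>) (g \<theta>) (lie_invariance_algebra C \<theta>)) \<and>
     (\<forall>\<theta>\<in>arbs C. \<forall>T\<in>equiv_group C. acts_on T \<theta> \<longrightarrow>
        push_field (proj_map pi0 T) ` g \<theta> = g (push_arb T \<theta>))"

text \<open>
  A solution of the group classification problem with respect to the family \<open>g\<close>: a complete set of
  inequivalent \<open>\<theta>\<close> with \<open>\<g>\<^sub>\<theta>\<close> properly containing \<open>g \<theta>\<close>.
\<close>

definition classification_list ::
  "('n::finite, 'm::finite, 'r::finite, 'k::finite, 'l::finite, 'q::finite) de_class \<Rightarrow>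
   (('n, 'm, 'r, 'k) arb \<Rightarrow> (('n, 'm) base \<Rightarrow> ('n, 'm) base) set) \<Rightarrow>
   ('n, 'm, 'r, 'k) arb set \<Rightarrow> bool" where
  "classification_list C g \<Lambda> \<longleftrightarrow>
     \<Lambda> \<subseteq> {\<theta> \<in> arbs C. g \<theta> \<subset> lie_invariance_algebra C \<theta>} \<and>
     (\<forall>\<theta>\<in>arbs C. g \<theta> \<subset> lie_invariance_algebra C \<theta> \<longrightarrow> (\<exists>\<theta>'\<in>\<Lambda>. equivalent_arbs C \<theta> \<theta>')) \<and>
     (\<forall>\<theta>\<^sub>1\<in>\<Lambda>. \<forall>\<theta>\<^sub>2\<in>\<Lambda>. equivalent_arbs C \<theta>\<^sub>1 \<theta>\<^sub>2 \<longrightarrow> \<theta>\<^sub>1 = \<theta>\<^sub>2)"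

definition equivalent_group_classifications ::
  "('n::finite, 'm::finite, 'r::finite, 'k::finite, 'l::finite, 'q::finite) de_class \<Rightarrow>
   ('n, 'm, 'r, 'k, 'l, 's::finite) de_class \<Rightarrow> bool" where
  "equivalent_group_classifications C C' \<longleftrightarrow>
     (\<exists>\<Psi>. similarity_transformation \<Psi> C C' \<and>
        (\<forall>\<theta>\<^sub>1\<in>arbs C. \<forall>\<theta>\<^sub>2\<in>arbs C.
           equivalent_arbs C \<theta>\<^sub>1 \<theta>\<^sub>2 \<longleftrightarrow> equivalent_arbs C' (push_arb \<Psi> \<theta>\<^sub>1) (push_arb \<Psi> \<theta>\<^sub>2)) \<and>
        (\<forall>D\<in>dom ` arbs C.
           push_field (proj_map pi0 \<Psi>) ` kernel_algebra C D = kernel_algebra C' (push_system \<Psi> D)) \<and>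
        (\<forall>g. uniform_family C g \<longrightarrow>
           (\<exists>g'. (\<forall>\<theta>\<in>arbs C. g' (push_arb \<Psi> \<theta>) = push_field (proj_map pi0 \<Psi>) ` g \<theta>) \<and>
                 uniform_family C' g' \<and>
                 (\<forall>\<Lambda>. classification_list C g \<Lambda> \<longrightarrow> classification_list C' g' (push_arb \<Psi> ` \<Lambda>)))))"

end

theory Submission
  imports Defs
begin

text \<open>
  A similarity transformation \<open>\<Psi>\<close> is invertible, and conjugation \<open>T \<mapsto> \<Psi> \<circ> T \<circ> \<Psi>\<^sup>-\<^sup>1\<close> is a bijection
  between the equivalence pseudogroups; this carries equivalence of arbitrary elements, and hence
  uniformity of families, from one class to the other. Of the conditions on the projections of \<open>\<Psi>\<close>
  only those of order \<open>0\<close> and \<open>r\<close> are needed, and these are inherited by \<open>\<Psi>\<^sup>-\<^sup>1\<close>, so that every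
  inclusion is needed in one direction only. For the Lie invariance algebras, the prolongation
  formula is equivalent to an infinitesimal symmetry of the contact structure, a condition that is
  visibly preserved by contact diffeomorphisms because second derivatives commute.
\<close>

subsection \<open>Smooth maps\<close>

text \<open>Two obstacles shape the proof. Every map is partial, so the projection of a composition
  may be a proper restriction of the composition of the projections, and conjugation by \<Psi> may
  shrink domains. Maps are therefore compared along the graphs of arbitrary elements: there all of
  them are defined, because they carry elements of a class to elements of a class. The other
  obstacle is that the prolongation formula is not written invariantly: it differentiates along
  \<open>total_vec\<close>, whose components of order r are set to 0, a normalization that a change
  of coordinates destroys. Replacing \<open>total_vec\<close> by arbitrary vectors of the Cartan
  distribution is harmless, because the components of order below r of a prolonged field do not
  depend on the coordinates of order r. Invariance of the resulting condition is checked without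
  flows: a point z and a tangent vector v move along straight lines with velocities
  \<open>X z\<close> and \<open>fderiv X z v\<close>, and symmetry of second derivatives makes the
  push-forward of fields compatible with this lift to tangent vectors.\<close>

abbreviation fderiv :: "('a::real_normed_vector \<Rightarrow> 'b::real_normed_vector) \<Rightarrow> 'a \<Rightarrow> 'a \<Rightarrow> 'b" where
  "fderiv f x \<equiv> frechet_derivative f (at x)"

lemma fderiv_eq: "(f has_derivative f') (at x) \<Longrightarrow> fderiv f x = f'"
  by (metis frechet_derivative_at)

lemma has_fderiv: "f differentiable (at x) \<Longrightarrow> (f has_derivative fderiv f x) (at x)"
  by (simp add: frechet_derivative_works)

lemma fderiv_cong_open:
  assumes "open S" "x \<in> S" "\<And>y. y \<in> S \<Longrightarrow> f y = g y"
  shows "fderiv f x = fderiv g x"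
proof -
  have "(f has_derivative D) (at x) \<longleftrightarrow> (g has_derivative D) (at x)" for D
    using assms has_derivative_transform_within_open[OF _ assms(1,2), of f D UNIV g]
      has_derivative_transform_within_open[OF _ assms(1,2), of g D UNIV f] by auto
  \<comment> \<open>\<open>frechet_derivative\<close> is a choice from the set of all derivatives at
    the point, so equal sets give equal choices, at points of differentiability and
    elsewhere.\<close>
  then show ?thesis unfolding frechet_derivative_def by simp
qed

lemma differentiable_cong_open:
  assumes "open S" "x \<in> S" "\<And>y. y \<in> S \<Longrightarrow> f y = g y" "f differentiable (at x)"
  shows "g differentiable (at x)"
  using assms unfolding differentiable_def
  by (metis has_derivative_transform_within_open)

text \<open>Partial maps enter smoothness through \<open>the\<close>, whose values off the domain
  are arbitrary; smoothness on an open set must not see them.\<close>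

lemma Ck_on_cong:
  assumes "open S" "\<And>y. y \<in> S \<Longrightarrow> f y = g y"
  shows "Ck_on k S f \<longleftrightarrow> Ck_on k S g"
  using assms(2)
proof (induction k arbitrary: f g)
  case 0
  then show ?case by (auto cong: continuous_on_cong)
next
  case (Suc k)
  have "f differentiable (at x) \<longleftrightarrow> g differentiable (at x)" if "x \<in> S" for x
    using differentiable_cong_open[OF assms(1) that] Suc.prems by metis
  moreover have "Ck_on k S (\<lambda>x. fderiv f x v) \<longleftrightarrow> Ck_on k S (\<lambda>x. fderiv g x v)" for v
    using fderiv_cong_open[OF assms(1), of _ f g] Suc.prems by (intro Suc.IH) metis
  ultimately show ?case by auto
qed

lemma Ck_on_subset: "Ck_on k S f \<Longrightarrow> T \<subseteq> S \<Longrightarrow> Ck_on k T f"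
  by (induction k arbitrary: f) (auto intro: continuous_on_subset)

lemma Ck_on_imp_continuous:
  assumes "Ck_on k S f"
  shows "continuous_on S f"
proof (cases k)
  case (Suc j)
  then have "\<forall>x\<in>S. continuous (at x) f"
    using assms differentiable_imp_continuous_within[of f _ UNIV] by auto
  then show ?thesis by (simp add: continuous_at_imp_continuous_on)
qed (use assms in simp)

lemma Ck_on_Suc_imp: "Ck_on (Suc k) S f \<Longrightarrow> Ck_on k S f"
proof (induction k arbitrary: f)
  case 0
  then show ?case using Ck_on_imp_continuous[OF 0] by simp
next
  case (Suc k)
  then show ?case by (metis Ck_on.simps(2))
qed

lemma Ck_on_const: "Ck_on k S (\<lambda>_. c)"
  by (induction k arbitrary: c) auto

lemma Ck_on_add:
  assumes "open S"
  shows "Ck_on k S f \<Longrightarrow> Ck_on k S g \<Longrightarrow> Ck_on k S (\<lambda>x. f x + g x)"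
proof (induction k arbitrary: f g)
  case 0
  then show ?case by (auto intro: continuous_intros)
next
  case (Suc k)
  have "fderiv (\<lambda>x. f x + g x) x = (\<lambda>v. fderiv f x v + fderiv g x v)" if "x \<in> S" for x
    using Suc.prems that by (intro fderiv_eq derivative_intros has_fderiv) auto
  then have "Ck_on k S (\<lambda>x. fderiv (\<lambda>x. f x + g x) x v)
      \<longleftrightarrow> Ck_on k S (\<lambda>x. fderiv f x v + fderiv g x v)" for v
    by (intro Ck_on_cong[OF assms]) auto
  then show ?case using Suc by auto
qed

lemma Ck_on_bilinear:
  assumes "open S" "bounded_bilinear b"
  shows "Ck_on k S f \<Longrightarrow> Ck_on k S g \<Longrightarrow> Ck_on k S (\<lambda>x. b (f x) (g x))"
proof (induction k arbitrary: f g)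
  case 0
  then show ?case
    by (auto intro: bounded_bilinear.continuous_on[OF assms(2)])
next
  case (Suc k)
  have *: "((\<lambda>x. b (f x) (g x)) has_derivative (\<lambda>v. b (f x) (fderiv g x v) + b (fderiv f x v) (g x))) (at x)"
    if "x \<in> S" for x
    using Suc.prems that by (intro bounded_bilinear.FDERIV[OF assms(2)] has_fderiv) auto
  have "Ck_on k S (\<lambda>x. fderiv (\<lambda>x. b (f x) (g x)) x v)
      \<longleftrightarrow> Ck_on k S (\<lambda>x. b (f x) (fderiv g x v) + b (fderiv f x v) (g x))" for v
    using fderiv_eq[OF *] by (intro Ck_on_cong[OF assms(1)]) auto
  moreover have "Ck_on k S (\<lambda>x. b (f x) (fderiv g x v) + b (fderiv f x v) (g x))" for v
    \<comment> \<open>In the product rule each factor also occurs undifferentiated, with one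
      derivative to spare; \<open>Ck_on_Suc_imp\<close> lowers it to the order of the induction
      hypothesis.\<close>
    using Suc by (intro Ck_on_add[OF assms(1)] Suc.IH Ck_on_Suc_imp[of k S f] Ck_on_Suc_imp[of k S g]) auto
  ultimately show ?case using * by (auto simp: differentiable_def)
qed

lemmas Ck_on_scaleR = Ck_on_bilinear[OF _ bounded_bilinear_scaleR]
lemmas Ck_on_inner = Ck_on_bilinear[OF _ bounded_bilinear_inner]

lemma Ck_on_sum:
  assumes "open S" "finite I" "\<And>i. i \<in> I \<Longrightarrow> Ck_on k S (f i)"
  shows "Ck_on k S (\<lambda>x. \<Sum>i\<in>I. f i x)"
  using assms(2,3) by (induction I) (auto intro: Ck_on_const Ck_on_add[OF assms(1)])

text \<open>\<open>Ck_on\<close> only speaks of derivatives in fixed directions. This expansion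
  reduces a direction that varies with the point, as in the chain rule, to fixed ones.\<close>

lemma linear_euclidean_sum:
  fixes v :: "'a::euclidean_space"
  assumes "linear L"
  shows "L v = (\<Sum>b\<in>Basis. (v \<bullet> b) *\<^sub>R L b)"
proof -
  have "L v = L (\<Sum>b\<in>Basis. (v \<bullet> b) *\<^sub>R b)" by (simp add: euclidean_representation)
  also have "\<dots> = (\<Sum>b\<in>Basis. (v \<bullet> b) *\<^sub>R L b)"
    using assms by (simp add: linear_sum linear_cmul)
  finally show ?thesis .
qed

lemma Ck_on_compose:
  assumes "open S" "open T" "f ` S \<subseteq> T"
  shows "Ck_on k S f \<Longrightarrow> Ck_on k T g \<Longrightarrow> Ck_on k S (\<lambda>x. g (f x))"
proof (induction k arbitrary: g)
  case 0
  then show ?case using assms(3) by (auto intro: continuous_on_compose2)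
next
  case (Suc k)
  have *: "((\<lambda>x. g (f x)) has_derivative (\<lambda>v. fderiv g (f x) (fderiv f x v))) (at x)" if "x \<in> S" for x
    using that Suc.prems assms(3)
    by (intro has_derivative_compose[of f _ x UNIV g] has_fderiv) auto
  have "Ck_on k S (\<lambda>x. fderiv (\<lambda>x. g (f x)) x v)
      \<longleftrightarrow> Ck_on k S (\<lambda>x. \<Sum>b\<in>Basis. (fderiv f x v \<bullet> b) *\<^sub>R fderiv g (f x) b)" for v
  proof (rule Ck_on_cong[OF assms(1)])
    fix x assume "x \<in> S"
    then have "linear (fderiv g (f x))"
      using Suc.prems assms(3) by (intro linear_frechet_derivative) auto
    then show "fderiv (\<lambda>x. g (f x)) x v = (\<Sum>b\<in>Basis. (fderiv f x v \<bullet> b) *\<^sub>R fderiv g (f x) b)"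
      using fderiv_eq[OF *[OF \<open>x \<in> S\<close>]] linear_euclidean_sum by metis
  qed
  moreover have "Ck_on k S (\<lambda>x. \<Sum>b\<in>Basis. (fderiv f x v \<bullet> b) *\<^sub>R fderiv g (f x) b)" for v
  proof (intro Ck_on_sum Ck_on_scaleR Ck_on_inner Ck_on_const Suc.IH)
    show "Ck_on k S f" using Suc.prems Ck_on_Suc_imp by blast
  qed (use assms Suc.prems in auto)
  ultimately show ?case using * by (auto simp: differentiable_def)
qed

lemma smooth_on_cong:
  "open S \<Longrightarrow> (\<And>y. y \<in> S \<Longrightarrow> f y = g y) \<Longrightarrow> smooth_on S f \<longleftrightarrow> smooth_on S g"
  unfolding smooth_on_def using Ck_on_cong by metis

lemma smooth_on_subset: "smooth_on S f \<Longrightarrow> T \<subseteq> S \<Longrightarrow> smooth_on T f"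
  unfolding smooth_on_def using Ck_on_subset by blast

lemma smooth_on_compose:
  "open S \<Longrightarrow> open T \<Longrightarrow> f ` S \<subseteq> T \<Longrightarrow> smooth_on S f \<Longrightarrow> smooth_on T g \<Longrightarrow> smooth_on S (\<lambda>x. g (f x))"
  by (simp add: smooth_on_def Ck_on_compose)

lemma smooth_on_differentiable: "smooth_on S f \<Longrightarrow> x \<in> S \<Longrightarrow> f differentiable (at x)"
  unfolding smooth_on_def by (metis Ck_on.simps(2))

lemma smooth_on_continuous: "smooth_on S f \<Longrightarrow> continuous_on S f"
  unfolding smooth_on_def using Ck_on_imp_continuous by blast

lemma smooth_on_fderiv: "smooth_on S f \<Longrightarrow> smooth_on S (\<lambda>x. fderiv f x v)"
  unfolding smooth_on_def by (metis Ck_on.simps(2))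

lemma smooth_on_fderiv_field:
  assumes "open S" "smooth_on S f" "smooth_on S Q"
  shows "smooth_on S (\<lambda>x. fderiv f x (Q x))"
proof -
  have "fderiv f x (Q x) = (\<Sum>b\<in>Basis. (Q x \<bullet> b) *\<^sub>R fderiv f x b)" if "x \<in> S" for x
    using smooth_on_differentiable[OF assms(2) that] linear_euclidean_sum linear_frechet_derivative
    by blast
  moreover have "smooth_on S (\<lambda>x. \<Sum>b\<in>Basis. (Q x \<bullet> b) *\<^sub>R fderiv f x b)"
    using assms smooth_on_fderiv[OF assms(2)] unfolding smooth_on_def
    by (auto intro!: Ck_on_sum Ck_on_scaleR Ck_on_inner Ck_on_const)
  ultimately show ?thesis using smooth_on_cong[OF assms(1)] by (metis (no_types, lifting))
qed

text \<open>
  Both mixed second derivatives are limits of the same symmetric second difference quotient.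
\<close>

lemma second_difference:
  fixes f :: "'a::euclidean_space \<Rightarrow> real"
  assumes S: "open S" "x \<in> S" and f: "\<And>y. y \<in> S \<Longrightarrow> f differentiable (at y)"
    and f2: "(\<lambda>y. fderiv f y u) differentiable (at x)" and e: "e > 0"
  obtains d where "d > 0"
    "\<And>h. 0 < h \<Longrightarrow> h < d \<Longrightarrow>
       \<bar>f (x + h *\<^sub>R u + h *\<^sub>R v) - f (x + h *\<^sub>R u) - f (x + h *\<^sub>R v) + f x
        - h * h * fderiv (\<lambda>y. fderiv f y u) x v\<bar> \<le> e * (h * h)"
proof -
  define g where "g = (\<lambda>y. fderiv f y u)"
  \<comment> \<open>After scaling by \<open>h\<close>, all corners of the parallelogram lie within
    \<open>h * N\<close> of \<open>x\<close>; the summand 1 keeps \<open>N\<close> positive even for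
    \<open>u = v = 0\<close>.\<close>
  define N where "N = norm u + norm v + 1"
  have N: "N > 0" "norm u < N" "norm v < N" "norm u + norm v < N" by (auto simp: N_def add_nonneg_pos)
  have g: "(g has_derivative fderiv g x) (at x)" using f2 has_fderiv unfolding g_def by blast
  then have lin: "linear (fderiv g x)" using has_derivative_linear by blast
  obtain r where r: "r > 0" "ball x r \<subseteq> S" using S openE by blast
  \<comment> \<open>The remainder is estimated at two points at distance at most
    \<open>h * N\<close> from \<open>x\<close>; the factor 2 leaves \<open>e * h\<close> for their
    sum.\<close>
  have "e / (2*N) > 0" using e N by simp
  then obtain d where d: "d > 0"
    "\<And>y. norm (y - x) < d \<Longrightarrow> norm (g y - g x - fderiv g x (y - x)) \<le> e / (2*N) * norm (y - x)"
    using g unfolding has_derivative_at_alt by meson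
  define d' where "d' = min r d / N"
  show ?thesis
  proof
    show "d' > 0" using r d N by (auto simp: d'_def)
    fix h :: real assume h: "0 < h" "h < d'"
    have hN: "h * N < r" "h * N < d" using h N by (auto simp: d'_def field_simps)
    have norms: "norm (s *\<^sub>R u + c *\<^sub>R v) \<le> h * N" if "0 \<le> s" "s \<le> h" "0 \<le> c" "c \<le> h" for s c
    proof -
      have "norm (s *\<^sub>R u + c *\<^sub>R v) \<le> norm (s *\<^sub>R u) + norm (c *\<^sub>R v)" by (rule norm_triangle_ineq)
      also have "\<dots> \<le> h * norm u + h * norm v"
        using that by (auto intro!: add_mono mult_right_mono)
      also have "\<dots> \<le> h * N" using h by (simp add: N_def algebra_simps)
      finally show ?thesis .
    qed
    have inS: "x + s *\<^sub>R u + c *\<^sub>R v \<in> S" if "0 \<le> s" "s \<le> h" "0 \<le> c" "c \<le> h" for s c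
    proof -
      have "dist (x + (s *\<^sub>R u + c *\<^sub>R v)) x < r"
        using norms[OF that] hN by (simp add: dist_norm)
      then show ?thesis using r(2) by (auto simp: add.assoc dist_commute)
    qed
    \<comment> \<open>The increment of this function of one real variable over \<open>[0, h]\<close>
      is the second difference, so the mean value theorem applies. Writing
      \<open>0 *\<^sub>R v\<close> makes both summands instances of \<open>fd\<close>.\<close>
    define p where "p = (\<lambda>s. f (x + s *\<^sub>R u + h *\<^sub>R v) - f (x + s *\<^sub>R u + 0 *\<^sub>R v))"
    have fd: "((\<lambda>s. f (x + s *\<^sub>R u + c *\<^sub>R v)) has_real_derivative g (x + s *\<^sub>R u + c *\<^sub>R v)) (at s)"
      if "0 \<le> s" "s \<le> h" "0 \<le> c" "c \<le> h" for s c
    proof -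
      let ?z = "x + s *\<^sub>R u + c *\<^sub>R v"
      have 1: "((\<lambda>s. x + s *\<^sub>R u + c *\<^sub>R v) has_derivative (\<lambda>t. t *\<^sub>R u)) (at s)"
        by (auto intro!: derivative_eq_intros)
      have 2: "(f has_derivative fderiv f ?z) (at ?z)"
        using inS[OF that] f has_fderiv by blast
      have "((\<lambda>s. f (x + s *\<^sub>R u + c *\<^sub>R v)) has_derivative (\<lambda>t. fderiv f ?z (t *\<^sub>R u))) (at s)"
        using has_derivative_compose[OF 1 2] .
      moreover have "(\<lambda>t. fderiv f ?z (t *\<^sub>R u)) = (*) (g ?z)"
        using linear_cmul[OF has_derivative_linear[OF 2]] by (auto simp: g_def mult.commute)
      ultimately show ?thesis by (simp add: has_field_derivative_def)
    qed
    have "\<exists>s. 0 < s \<and> s < h \<and> p h - p 0 =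
        (h - 0) * (g (x + s *\<^sub>R u + h *\<^sub>R v) - g (x + s *\<^sub>R u + 0 *\<^sub>R v))"
      unfolding p_def using h by (intro MVT2 DERIV_diff fd) auto
    then obtain s where s: "0 < s" "s < h"
      "p h - p 0 = h * (g (x + s *\<^sub>R u + h *\<^sub>R v) - g (x + s *\<^sub>R u + 0 *\<^sub>R v))" by auto
    have est: "\<bar>g (x + s *\<^sub>R u + c *\<^sub>R v) - g x - fderiv g x (s *\<^sub>R u + c *\<^sub>R v)\<bar> \<le> e / 2 * h"
      if "0 \<le> c" "c \<le> h" for c
    proof -
      have n: "norm (s *\<^sub>R u + c *\<^sub>R v) \<le> h * N" using norms s that by simp
      then have "norm (g (x + (s *\<^sub>R u + c *\<^sub>R v)) - g x - fderiv g x (s *\<^sub>R u + c *\<^sub>R v))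
          \<le> e / (2*N) * norm (s *\<^sub>R u + c *\<^sub>R v)"
        using d(2)[of "x + (s *\<^sub>R u + c *\<^sub>R v)"] hN by simp
      also have "\<dots> \<le> e / (2*N) * (h * N)" using n e N by (intro mult_left_mono) auto
      also have "\<dots> = e / 2 * h" using N by simp
      finally show ?thesis by (simp add: add.assoc)
    qed
    \<comment> \<open>Both estimates are taken at the same unknown \<open>s\<close>, so its
      contribution cancels and exactly \<open>h * fderiv g x v\<close> survives.\<close>
    have "fderiv g x (s *\<^sub>R u + h *\<^sub>R v) = fderiv g x (s *\<^sub>R u + 0 *\<^sub>R v) + h * fderiv g x v"
      using lin by (simp add: linear_add linear_cmul)
    then have "\<bar>g (x + s *\<^sub>R u + h *\<^sub>R v) - g (x + s *\<^sub>R u + 0 *\<^sub>R v) - h * fderiv g x v\<bar> \<le> e * h"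
      using est[OF less_imp_le[OF h(1)] order_refl] est[OF order_refl less_imp_le[OF h(1)]]
      unfolding abs_le_iff by linarith
    then have "h * \<bar>g (x + s *\<^sub>R u + h *\<^sub>R v) - g (x + s *\<^sub>R u + 0 *\<^sub>R v) - h * fderiv g x v\<bar> \<le> h * (e * h)"
      using h by (intro mult_left_mono) auto
    also have "h * \<bar>g (x + s *\<^sub>R u + h *\<^sub>R v) - g (x + s *\<^sub>R u + 0 *\<^sub>R v) - h * fderiv g x v\<bar>
       = \<bar>h * (g (x + s *\<^sub>R u + h *\<^sub>R v) - g (x + s *\<^sub>R u + 0 *\<^sub>R v) - h * fderiv g x v)\<bar>"
      using h by (simp add: abs_mult)
    also have "h * (g (x + s *\<^sub>R u + h *\<^sub>R v) - g (x + s *\<^sub>R u + 0 *\<^sub>R v) - h * fderiv g x v)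
       = p h - p 0 - h * h * fderiv g x v"
      using s(3) by (simp add: algebra_simps)
    finally show "\<bar>f (x + h *\<^sub>R u + h *\<^sub>R v) - f (x + h *\<^sub>R u) - f (x + h *\<^sub>R v) + f x
        - h * h * fderiv (\<lambda>y. fderiv f y u) x v\<bar> \<le> e * (h * h)"
      by (simp add: p_def g_def algebra_simps)
  qed
qed

lemma second_fderiv_symmetric_real:
  fixes f :: "'a::euclidean_space \<Rightarrow> real"
  assumes "open S" "smooth_on S f" "x \<in> S"
  shows "fderiv (\<lambda>y. fderiv f y u) x v = fderiv (\<lambda>y. fderiv f y v) x u"
proof (rule ccontr)
  let ?A = "fderiv (\<lambda>y. fderiv f y u) x v" and ?B = "fderiv (\<lambda>y. fderiv f y v) x u"
  assume "?A \<noteq> ?B"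
  \<comment> \<open>The two estimates bound the distance of \<open>?A\<close> and \<open>?B\<close>
    by \<open>2 * e\<close>, whereas it equals \<open>3 * e\<close>.\<close>
  define e where "e = \<bar>?A - ?B\<bar> / 3"
  have e: "e > 0" using \<open>?A \<noteq> ?B\<close> by (simp add: e_def)
  have f: "\<And>y. y \<in> S \<Longrightarrow> f differentiable (at y)" using smooth_on_differentiable assms by blast
  have f2: "(\<lambda>y. fderiv f y w) differentiable (at x)" for w
    using smooth_on_differentiable smooth_on_fderiv assms by blast
  obtain d1 where d1: "d1 > 0" "\<And>h. 0 < h \<Longrightarrow> h < d1 \<Longrightarrow>
       \<bar>f (x + h *\<^sub>R u + h *\<^sub>R v) - f (x + h *\<^sub>R u) - f (x + h *\<^sub>R v) + f x - h * h * ?A\<bar> \<le> e * (h * h)"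
    using second_difference[OF assms(1,3) f f2 e] by metis
  obtain d2 where d2: "d2 > 0" "\<And>h. 0 < h \<Longrightarrow> h < d2 \<Longrightarrow>
       \<bar>f (x + h *\<^sub>R v + h *\<^sub>R u) - f (x + h *\<^sub>R v) - f (x + h *\<^sub>R u) + f x - h * h * ?B\<bar> \<le> e * (h * h)"
    using second_difference[OF assms(1,3) f f2 e] by metis
  define h where "h = min d1 d2 / 2"
  have h: "0 < h" "h < d1" "h < d2" using d1 d2 by (auto simp: h_def)
  have "f (x + h *\<^sub>R v + h *\<^sub>R u) = f (x + h *\<^sub>R u + h *\<^sub>R v)" by (simp add: algebra_simps)
  then have "\<bar>h * h * ?A - h * h * ?B\<bar> \<le> 2 * (e * (h * h))"
    using d1(2)[OF h(1,2)] d2(2)[OF h(1,3)] by linarith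
  moreover have "\<bar>h * h * ?A - h * h * ?B\<bar> = (h * h) * (3 * e)"
    by (simp add: e_def abs_mult flip: right_diff_distrib)
  ultimately show False using h e by simp
qed

lemma fderiv_inner:
  "f differentiable (at x) \<Longrightarrow> fderiv (\<lambda>y. f y \<bullet> b) x = (\<lambda>v. fderiv f x v \<bullet> b)"
  by (intro fderiv_eq has_derivative_inner_left has_fderiv)

lemma second_fderiv_symmetric:
  assumes "open S" "smooth_on S f" "x \<in> S"
  shows "fderiv (\<lambda>y. fderiv f y u) x v = fderiv (\<lambda>y. fderiv f y v) x u"
proof (rule euclidean_eqI)
  fix b :: 'b assume "b \<in> Basis"
  let ?g = "\<lambda>y. f y \<bullet> b"
  have g: "smooth_on S ?g"
    using assms unfolding smooth_on_def by (auto intro!: Ck_on_inner Ck_on_const)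
  have "fderiv (\<lambda>y. fderiv ?g y u) x v = fderiv (\<lambda>y. fderiv f y u) x v \<bullet> b" for u v
  proof -
    have "fderiv (\<lambda>y. fderiv ?g y u) x = fderiv (\<lambda>y. fderiv f y u \<bullet> b) x"
      using smooth_on_differentiable[OF assms(2)]
      by (intro fderiv_cong_open[OF assms(1,3)]) (simp add: fderiv_inner)
    also have "\<dots> = (\<lambda>v. fderiv (\<lambda>y. fderiv f y u) x v \<bullet> b)"
      by (intro fderiv_inner smooth_on_differentiable[OF smooth_on_fderiv[OF assms(2)]] assms)
    finally show ?thesis by simp
  qed
  then show "fderiv (\<lambda>y. fderiv f y u) x v \<bullet> b = fderiv (\<lambda>y. fderiv f y v) x u \<bullet> b"
    using second_fderiv_symmetric_real[OF assms(1) g assms(3)] by metis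
qed

text \<open>The product rule yields a second derivative with \<open>Q x\<close> frozen and
  \<open>v\<close> as the direction of differentiation. Symmetry exchanges the two, which gives the
  form that differentiation along a curve with velocity \<open>Q x\<close> produces for a fixed
  \<open>v\<close>.\<close>

lemma fderiv_fderiv_field:
  assumes "open S" "smooth_on S f" "x \<in> S" "Q differentiable (at x)"
  shows "((\<lambda>y. fderiv f y (Q y)) has_derivative
     (\<lambda>v. fderiv (\<lambda>y. fderiv f y v) x (Q x) + fderiv f x (fderiv Q x v))) (at x)"
proof -
  have lin: "linear (fderiv f y)" if "y \<in> S" for y
    using smooth_on_differentiable[OF assms(2) that] linear_frechet_derivative by blast
  have "((\<lambda>y. \<Sum>b\<in>Basis. (Q y \<bullet> b) *\<^sub>R fderiv f y b) has_derivative
     (\<lambda>v. \<Sum>b\<in>Basis. (Q x \<bullet> b) *\<^sub>R fderiv (\<lambda>y. fderiv f y b) x v + (fderiv Q x v \<bullet> b) *\<^sub>R fderiv f x b)) (at x)"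
    by (intro has_derivative_sum has_derivative_scaleR has_derivative_inner_left has_fderiv assms
         smooth_on_differentiable[OF smooth_on_fderiv[OF assms(2)]])
  moreover have "(\<Sum>b\<in>Basis. (Q x \<bullet> b) *\<^sub>R fderiv (\<lambda>y. fderiv f y b) x v + (fderiv Q x v \<bullet> b) *\<^sub>R fderiv f x b)
    = fderiv (\<lambda>y. fderiv f y v) x (Q x) + fderiv f x (fderiv Q x v)" for v
  proof -
    have "fderiv (\<lambda>y. fderiv f y b) x v = fderiv (\<lambda>y. fderiv f y v) x b" for b
      using second_fderiv_symmetric[OF assms(1-3)] .
    moreover have "linear (fderiv (\<lambda>y. fderiv f y v) x)"
      by (intro linear_frechet_derivative smooth_on_differentiable[OF smooth_on_fderiv[OF assms(2)]] assms)
    ultimately show ?thesis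
      using linear_euclidean_sum[of "fderiv (\<lambda>y. fderiv f y v) x" "Q x"]
        linear_euclidean_sum[OF lin[OF assms(3)], of "fderiv Q x v"] by (simp add: sum.distrib)
  qed
  ultimately have "((\<lambda>y. \<Sum>b\<in>Basis. (Q y \<bullet> b) *\<^sub>R fderiv f y b) has_derivative
     (\<lambda>v. fderiv (\<lambda>y. fderiv f y v) x (Q x) + fderiv f x (fderiv Q x v))) (at x)" by simp
  then show ?thesis
    by (rule has_derivative_transform_within_open[OF _ assms(1,3)])
       (metis lin linear_euclidean_sum)
qed

subsection \<open>Partial diffeomorphisms and their projections\<close>

lemma inj_onD_Some: "inj_on f (dom f) \<Longrightarrow> f x = Some y \<Longrightarrow> f x' = Some y \<Longrightarrow> x = x'"
  by (auto simp: inj_on_def dom_def)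

lemma inj_onI_Some: "(\<And>x x' y. f x = Some y \<Longrightarrow> f x' = Some y \<Longrightarrow> x = x') \<Longrightarrow> inj_on f (dom f)"
  by (auto simp: inj_on_def dom_def)

text \<open>Injectivity leaves a single candidate for the choice in \<open>pinv\<close>. Through
  this equivalence, claims about inverses become claims about the map itself.\<close>

lemma pinv_eq_Some:
  assumes "inj_on f (dom f)"
  shows "pinv f y = Some x \<longleftrightarrow> f x = Some y"
proof
  assume "pinv f y = Some x"
  then have "y \<in> ran f" "x = (SOME x. f x = Some y)" by (auto simp: pinv_def split: if_splits)
  then show "f x = Some y" by (metis (mono_tags, lifting) mem_Collect_eq ran_def someI_ex)
next
  assume "f x = Some y"
  then have "y \<in> ran f" "(SOME x. f x = Some y) = x"
    using inj_onD_Some[OF assms] by (auto simp: ran_def)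
  then show "pinv f y = Some x" by (simp add: pinv_def)
qed

lemma dom_pinv: "dom (pinv f) = ran f"
  by (auto simp: pinv_def split: if_splits)

lemma ran_pinv: "inj_on f (dom f) \<Longrightarrow> ran (pinv f) = dom f"
  by (auto simp: ran_def pinv_eq_Some)

lemma inj_pinv: "inj_on f (dom f) \<Longrightarrow> inj_on (pinv f) (dom (pinv f))"
  by (rule inj_onI_Some) (simp add: pinv_eq_Some)

lemma pinv_pinv: "inj_on f (dom f) \<Longrightarrow> pinv (pinv f) = f"
proof
  fix x assume "inj_on f (dom f)"
  then have "pinv (pinv f) x = Some y \<longleftrightarrow> f x = Some y" for y
    by (simp add: pinv_eq_Some inj_pinv)
  then show "pinv (pinv f) x = f x" by (metis option.exhaust)
qed

lemma inj_map_comp: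
  "inj_on f (dom f) \<Longrightarrow> inj_on g (dom g) \<Longrightarrow> inj_on (g \<circ>\<^sub>m f) (dom (g \<circ>\<^sub>m f))"
  by (rule inj_onI_Some) (unfold map_comp_Some_iff, blast dest: inj_onD_Some)

text \<open>Reduces an equation of partial maps to one of graphs, where composition and inversion
  are relational and first-order reasoning suffices.\<close>

lemma map_eqI: "(\<And>x y. f x = Some y \<longleftrightarrow> g x = Some y) \<Longrightarrow> f = g"
  by (rule ext) (metis option.exhaust)

lemma pinv_map_comp:
  assumes "inj_on f (dom f)" "inj_on g (dom g)"
  shows "pinv (g \<circ>\<^sub>m f) = pinv f \<circ>\<^sub>m pinv g"
  by (rule map_eqI)
     (unfold pinv_eq_Some[OF inj_map_comp[OF assms]] map_comp_Some_iff
       pinv_eq_Some[OF assms(1)] pinv_eq_Some[OF assms(2)], blast)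

lemma local_diffeo_inj: "local_diffeo f \<Longrightarrow> inj_on f (dom f)"
  and local_diffeo_open: "local_diffeo f \<Longrightarrow> open (dom f)"
  by (auto simp: local_diffeo_def)

lemma local_diffeo_pinv: "local_diffeo f \<Longrightarrow> local_diffeo (pinv f)"
  using inj_pinv[of f] by (simp add: local_diffeo_def dom_pinv ran_pinv pinv_pinv)

lemma local_diffeo_has_derivative:
  assumes "local_diffeo f" "x \<in> dom f"
  shows "((\<lambda>x. the (f x)) has_derivative fderiv (\<lambda>x. the (f x)) x) (at x)"
  using assms unfolding local_diffeo_def by (auto intro: has_fderiv smooth_on_differentiable)

lemma local_diffeo_linear:
  assumes "local_diffeo f" "x \<in> dom f"
  shows "linear (fderiv (\<lambda>x. the (f x)) x)"
  using local_diffeo_has_derivative[OF assms] has_derivative_linear by blast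

lemma open_preimage_map:
  assumes "open (dom f)" "continuous_on (dom f) (\<lambda>x. the (f x))" "open T"
  shows "open {x. \<exists>y\<in>T. f x = Some y}"
proof -
  have "{x. \<exists>y\<in>T. f x = Some y} = (\<lambda>x. the (f x)) -` T \<inter> dom f" by force
  then show ?thesis using continuous_open_vimage[OF assms(3)] assms
    by (metis continuous_on_open_vimage)
qed

lemma map_le_Some: "f \<subseteq>\<^sub>m g \<Longrightarrow> f x = Some y \<Longrightarrow> g x = Some y"
  by (metis domI map_le_def)

text \<open>The range of \<open>h\<close> is open as the preimage of \<open>dom h\<close> under the
  continuous \<open>pinv f\<close>. Restrictions arise when a composition is projected, see
  \<open>proj_map_comp_le\<close>.\<close>

lemma local_diffeo_restrict:
  assumes f: "local_diffeo f" and h: "h \<subseteq>\<^sub>m f" "open (dom h)"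
  shows "local_diffeo h"
proof -
  note inj = local_diffeo_inj[OF f]
  have injh: "inj_on h (dom h)"
    by (rule inj_onI_Some) (meson h(1) inj inj_onD_Some map_le_Some)
  have eq: "f x = h x" if "x \<in> dom h" for x using h(1) that by (simp add: map_le_def)
  have "ran h = {y. \<exists>x\<in>dom h. pinv f y = Some x}"
    using eq by (auto simp: ran_def pinv_eq_Some[OF inj])
  moreover have "open \<dots>"
    using f h(2) by (intro open_preimage_map smooth_on_continuous) (auto simp: local_diffeo_def dom_pinv)
  ultimately have o: "open (ran h)" by simp
  have sub: "dom h \<subseteq> dom f" "ran h \<subseteq> ran f"
    using map_le_Some[OF h(1)] by (auto simp: ran_def dom_def)
  have "pinv f y = pinv h y" if "y \<in> ran h" for y
  proof -
    obtain x where "h x = Some y" using \<open>y \<in> ran h\<close> by (auto simp: ran_def)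
    then show ?thesis using map_le_Some[OF h(1)] inj injh by (metis pinv_eq_Some)
  qed
  then have "smooth_on (ran h) (\<lambda>y. the (pinv h y))"
    using f smooth_on_subset[OF _ sub(2), of "\<lambda>y. the (pinv f y)"]
      smooth_on_cong[OF o, of "\<lambda>y. the (pinv f y)" "\<lambda>y. the (pinv h y)"]
    by (simp add: local_diffeo_def)
  moreover have "smooth_on (dom h) (\<lambda>y. the (h y))"
    using f smooth_on_subset[OF _ sub(1), of "\<lambda>y. the (f y)"] eq
      smooth_on_cong[OF h(2), of "\<lambda>y. the (f y)" "\<lambda>y. the (h y)"]
    by (simp add: local_diffeo_def)
  ultimately show ?thesis using o h(2) injh by (simp add: local_diffeo_def)
qed

lemma dom_map_comp: "dom (g \<circ>\<^sub>m f) = {x. \<exists>y\<in>dom g. f x = Some y}"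
  by (auto simp: map_comp_Some_iff)

lemma smooth_map_comp:
  assumes "open (dom f)" "open (dom g)"
    "smooth_on (dom f) (\<lambda>x. the (f x))" "smooth_on (dom g) (\<lambda>x. the (g x))"
  shows "open (dom (g \<circ>\<^sub>m f)) \<and> smooth_on (dom (g \<circ>\<^sub>m f)) (\<lambda>x. the ((g \<circ>\<^sub>m f) x))"
proof
  show o: "open (dom (g \<circ>\<^sub>m f))"
    unfolding dom_map_comp using assms by (intro open_preimage_map smooth_on_continuous)
  have "smooth_on (dom (g \<circ>\<^sub>m f)) (\<lambda>x. the (g (the (f x))))"
    by (rule smooth_on_compose[OF o assms(2) _ smooth_on_subset[OF assms(3)] assms(4)])
       (auto simp: dom_map_comp)
  moreover have "the (g (the (f x))) = the ((g \<circ>\<^sub>m f) x)" if "x \<in> dom (g \<circ>\<^sub>m f)" for x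
    using that unfolding dom_map_comp by auto
  ultimately show "smooth_on (dom (g \<circ>\<^sub>m f)) (\<lambda>x. the ((g \<circ>\<^sub>m f) x))"
    using smooth_on_cong[OF o] by (metis (no_types, lifting))
qed

text \<open>The range of a composition is the domain of the composition of the inverses, so
  \<open>smooth_map_comp\<close> applied to the inverses settles the second half.\<close>

lemma local_diffeo_comp:
  assumes "local_diffeo f" "local_diffeo g"
  shows "local_diffeo (g \<circ>\<^sub>m f)"
proof -
  note inj = local_diffeo_inj[OF assms(1)] local_diffeo_inj[OF assms(2)]
  have "ran (g \<circ>\<^sub>m f) = dom (pinv f \<circ>\<^sub>m pinv g)"
    by (metis dom_pinv inj pinv_map_comp)
  then show ?thesis
    using assms smooth_map_comp[of f g] smooth_map_comp[of "pinv g" "pinv f"]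
    by (simp add: local_diffeo_def inj inj_map_comp pinv_map_comp dom_pinv)
qed

lemma fderiv_map_comp:
  assumes "local_diffeo f" "local_diffeo g" "f x = Some y" "y \<in> dom g"
  shows "fderiv (\<lambda>x. the ((g \<circ>\<^sub>m f) x)) x v = fderiv (\<lambda>x. the (g x)) y (fderiv (\<lambda>x. the (f x)) x v)"
proof -
  have "(\<lambda>x. the (f x)) differentiable (at x)" "(\<lambda>x. the (g x)) differentiable (at (the (f x)))"
    using assms local_diffeo_has_derivative by (auto simp: differentiable_def domI)
  then have "fderiv ((\<lambda>x. the (g x)) \<circ> (\<lambda>x. the (f x))) x
      = fderiv (\<lambda>x. the (g x)) (the (f x)) \<circ> fderiv (\<lambda>x. the (f x)) x"
    by (rule frechet_derivative_compose)
  moreover have "fderiv ((\<lambda>x. the (g x)) \<circ> (\<lambda>x. the (f x))) x = fderiv (\<lambda>x. the ((g \<circ>\<^sub>m f) x)) x"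
    using assms
    by (intro fderiv_cong_open[OF local_diffeo_open[OF local_diffeo_comp[OF assms(1,2)]]])
       (auto simp: dom_map_comp)
  ultimately show ?thesis using assms(3) by simp
qed

lemma fderiv_map_le:
  assumes "h \<subseteq>\<^sub>m f" "open (dom h)" "x \<in> dom h"
  shows "fderiv (\<lambda>x. the (h x)) x = fderiv (\<lambda>x. the (f x)) x"
  using assms(1) by (intro fderiv_cong_open[OF assms(2,3)]) (simp add: map_le_def)

lemma fderiv_pinv:
  assumes "local_diffeo f" "f x = Some y"
  shows "fderiv (\<lambda>y. the (pinv f y)) y (fderiv (\<lambda>x. the (f x)) x v) = v"
proof -
  note inj = local_diffeo_inj[OF assms(1)]
  have "y \<in> dom (pinv f)" using assms(2) by (auto simp: dom_pinv ran_def)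
  then have "fderiv (\<lambda>y. the (pinv f y)) y (fderiv (\<lambda>x. the (f x)) x v)
      = fderiv (\<lambda>x. the ((pinv f \<circ>\<^sub>m f) x)) x v"
    using fderiv_map_comp[OF assms(1) local_diffeo_pinv[OF assms(1)] assms(2)] by simp
  also have "fderiv (\<lambda>x. the ((pinv f \<circ>\<^sub>m f) x)) x = fderiv (\<lambda>x. x) x"
  proof (rule fderiv_cong_open[OF local_diffeo_open[OF assms(1)]])
    fix z assume "z \<in> dom f"
    then obtain w where w: "f z = Some w" by auto
    then have "pinv f w = Some z" using pinv_eq_Some[OF inj] by blast
    then show "the ((pinv f \<circ>\<^sub>m f) z) = z" using w by (simp add: map_comp_def)
  qed (use assms in auto)
  finally show ?thesis by simp
qed

section \<open>Projectable partial maps\<close>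

lemma dom_proj_map: "dom (proj_map p T) = p ` dom T"
  unfolding dom_def[of "proj_map p T"] by (simp add: proj_map_def)

text \<open>Projectability makes the value independent of the point over \<open>p w\<close> that the
  definition of \<open>proj_map\<close> chooses.\<close>

lemma proj_map_Some: 
  assumes "projectable p T" "T w = Some w'"
  shows "proj_map p T (p w) = Some (p w')"
proof -
  let ?w = "SOME v. v \<in> dom T \<and> p v = p w"
  have "w \<in> dom T \<and> p w = p w" using assms by auto
  then have "?w \<in> dom T \<and> p ?w = p w" by (rule someI)
  then have "p (the (T ?w)) = p (the (T w))"
    using assms unfolding projectable_def by blast
  moreover have "p w \<in> p ` dom T" using assms by auto
  ultimately show ?thesis using assms by (simp add: proj_map_def)
qed

lemma proj_map_SomeE:
  assumes "projectable p T" "proj_map p T y = Some y'"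
  obtains w w' where "T w = Some w'" "p w = y" "p w' = y'"
proof -
  have "y \<in> p ` dom T" using assms(2) by (metis domI dom_proj_map)
  then obtain w w' where "T w = Some w'" "p w = y" by auto
  with proj_map_Some[OF assms(1)] assms(2) that show ?thesis by fastforce
qed

lemma proj_map_eq_Some:
  assumes "projectable p T"
  shows "proj_map p T y = Some y' \<longleftrightarrow> (\<exists>w w'. T w = Some w' \<and> p w = y \<and> p w' = y')"
proof
  assume "proj_map p T y = Some y'"
  then show "\<exists>w w'. T w = Some w' \<and> p w = y \<and> p w' = y'" by (rule proj_map_SomeE[OF assms]) blast
next
  assume "\<exists>w w'. T w = Some w' \<and> p w = y \<and> p w' = y'"
  then obtain w w' where "T w = Some w'" "p w = y" "p w' = y'" by blast
  then show "proj_map p T y = Some y'" using proj_map_Some[OF assms, of w w'] by simp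
qed

lemma projectable_iff:
  "projectable p T \<longleftrightarrow>
    (\<forall>w w' v v'. T w = Some w' \<longrightarrow> T v = Some v' \<longrightarrow> p w = p v \<longrightarrow> p w' = p v')" (is "_ \<longleftrightarrow> ?R")
proof
  assume *: ?R
  show "projectable p T" unfolding projectable_def
  proof (intro ballI impI)
    fix w v assume "w \<in> dom T" "v \<in> dom T" "p w = p v"
    moreover obtain w' v' where wv: "T w = Some w'" "T v = Some v'"
      using domD[OF \<open>w \<in> dom T\<close>] domD[OF \<open>v \<in> dom T\<close>] by blast
    ultimately have "p w' = p v'" using * by blast
    then show "p (the (T w)) = p (the (T v))" using wv by simp
  qed
next
  assume *: "projectable p T"
  show ?R
  proof (intro allI impI)
    fix w w' v v' assume **: "T w = Some w'" "T v = Some v'" "p w = p v"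
    then have "p (the (T w)) = p (the (T v))"
      using * domI[of T w w'] domI[of T v v'] unfolding projectable_def by blast
    then show "p w' = p v'" using ** by simp
  qed
qed

text \<open>A projectable map may send points over different base points to points over the same
  one, and then its inverse is not projectable. Injectivity of \<open>proj_map p T\<close> excludes
  this.\<close>

lemma projectable_pinv:
  assumes "inj_on T (dom T)" "projectable p T" "inj_on (proj_map p T) (dom (proj_map p T))"
  shows "projectable p (pinv T)"
  unfolding projectable_iff pinv_eq_Some[OF assms(1)]
proof (intro allI impI)
  fix w w' v v' assume "T w' = Some w" "T v' = Some v" "p w = p v"
  then show "p w' = p v'"
    using proj_map_Some[OF assms(2), of w' w] proj_map_Some[OF assms(2), of v' v]
      inj_onD_Some[OF assms(3), of "p w'" "p w" "p v'"] by simp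
qed

lemma proj_map_pinv:
  assumes "inj_on T (dom T)" "projectable p T" "inj_on (proj_map p T) (dom (proj_map p T))"
  shows "proj_map p (pinv T) = pinv (proj_map p T)"
proof (rule map_eqI)
  fix y x
  show "proj_map p (pinv T) y = Some x \<longleftrightarrow> pinv (proj_map p T) y = Some x"
    unfolding pinv_eq_Some[OF assms(3)] proj_map_eq_Some[OF assms(2)]
      proj_map_eq_Some[OF projectable_pinv[OF assms]] pinv_eq_Some[OF assms(1)] by blast
qed

lemma projectable_comp:
  assumes "projectable p S" "projectable p T"
  shows "projectable p (S \<circ>\<^sub>m T)"
  using assms unfolding projectable_iff map_comp_Some_iff by blast

text \<open>Equality fails in general: \<open>T w\<close> may lie over the domain of
  \<open>proj_map p S\<close> without lying in \<open>dom S\<close>.\<close>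

lemma proj_map_comp_le:
  assumes "projectable p S" "projectable p T"
  shows "proj_map p (S \<circ>\<^sub>m T) \<subseteq>\<^sub>m proj_map p S \<circ>\<^sub>m proj_map p T"
  unfolding map_le_def
proof
  fix y assume "y \<in> dom (proj_map p (S \<circ>\<^sub>m T))"
  then obtain w w' w'' where "T w = Some w'" "S w' = Some w''" "y = p w"
    by (auto simp: dom_proj_map map_comp_Some_iff)
  then show "proj_map p (S \<circ>\<^sub>m T) y = (proj_map p S \<circ>\<^sub>m proj_map p T) y"
    using proj_map_Some[OF assms(1)] proj_map_Some[OF assms(2)]
      proj_map_Some[OF projectable_comp[OF assms], of w w''] by (auto simp: map_comp_def)
qed

section \<open>Point transformations and contact transformations\<close>

lemma linear_to_base: "linear to_base"
  by (rule linearI) (simp_all add: to_base_def vec_eq_iff)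

lemma surj_to_base: "surj (to_base :: ('n::finite, 'm::finite, 'r::finite) jet \<Rightarrow> _)"
proof (rule surjI)
  fix b :: "('n, 'm) base"
  show "to_base ((\<chi> c. case c of Inl i \<Rightarrow> fst b $ i | Inr (\<alpha>, a) \<Rightarrow> snd b $ a) :: ('n, 'm, 'r) jet) = b"
    by (simp add: to_base_def prod_eq_iff)
qed

lemma open_to_base: "open D \<Longrightarrow> open (to_base ` D)"
  using open_surjective_linear_image linear_to_base surj_to_base by blast

lemma open_pi0: "open D \<Longrightarrow> open (pi0 ` D)"
  using open_to_base[OF open_image_fst, of D] unfolding pi0_def image_image .

text \<open>The geometric part common to similarity transformations and to elements of
  \<open>equiv_group\<close>. It is closed under inversion and composition, hence under
  conjugation.\<close>

definition contact_transformation ::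
  "(('n::finite, 'm::finite, 'r::finite, 'k::finite) ext \<rightharpoonup> ('n, 'm, 'r, 'k) ext) \<Rightarrow> bool" where
  "contact_transformation T \<longleftrightarrow> point_transformation T \<and> contact_map CARD('r) (proj_map fst T)"

lemma point_transformationD:
  assumes "point_transformation T"
  shows "inj_on T (dom T)" "local_diffeo T" "projectable pi0 T" "local_diffeo (proj_map pi0 T)"
    "projectable fst T" "local_diffeo (proj_map fst T)"
    "inj_on (proj_map fst T) (dom (proj_map fst T))" "inj_on (proj_map pi0 T) (dom (proj_map pi0 T))"
  using assms local_diffeo_inj by (auto simp: point_transformation_def)

lemma point_transformation_pinv:
  assumes "point_transformation T"
  shows "point_transformation (pinv T)"
proof -
  note d = point_transformationD[OF assms]
  show ?thesis
    unfolding point_transformation_def proj_map_pinv[OF d(1,3,8)] proj_map_pinv[OF d(1,5,7)]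
    using local_diffeo_pinv[OF d(2)] local_diffeo_pinv[OF d(4)] local_diffeo_pinv[OF d(6)]
      projectable_pinv[OF d(1,3,8)] projectable_pinv[OF d(1,5,7)] by blast
qed

lemma point_transformation_comp:
  assumes "point_transformation S" "point_transformation T"
  shows "point_transformation (S \<circ>\<^sub>m T)"
proof -
  note S = point_transformationD[OF assms(1)] and T = point_transformationD[OF assms(2)]
  have ST: "local_diffeo (S \<circ>\<^sub>m T)" using S T local_diffeo_comp by blast
  then have o: "open (dom (S \<circ>\<^sub>m T))" by (rule local_diffeo_open)
  \<comment> \<open>The last assumption, openness of the projected domain, is available because
    \<open>pi0\<close> and \<open>fst\<close> are open maps.\<close>
  have ld: "local_diffeo (proj_map p (S \<circ>\<^sub>m T))"
    if "projectable p S" "local_diffeo (proj_map p S)" "projectable p T" "local_diffeo (proj_map p T)"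
      "open (p ` dom (S \<circ>\<^sub>m T))" for p :: "_ \<Rightarrow> 'x::euclidean_space"
    by (rule local_diffeo_restrict[OF local_diffeo_comp[OF that(4,2)] proj_map_comp_le[OF that(1,3)]])
       (unfold dom_proj_map, rule that(5))
  show ?thesis
    unfolding point_transformation_def
    by (intro conjI ST projectable_comp ld S T open_pi0 open_image_fst o)
qed

lemma trunc_card: "trunc CARD('r) (z :: ('n::finite, 'm::finite, 'r::finite) jet) = z"
  using midx_fun by (auto simp: trunc_def vec_eq_iff midx_ord_def split: sum.split)

lemma ball_dom_iff: "(\<forall>z\<in>dom F. P z (the (F z))) \<longleftrightarrow> (\<forall>z z'. F z = Some z' \<longrightarrow> P z z')"
  by (force simp: dom_def)

lemma contact_map_card:
  fixes F :: "('n::finite, 'm::finite, 'r::finite) jet \<rightharpoonup> ('n, 'm, 'r) jet"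
  shows "contact_map CARD('r) F \<longleftrightarrow>
   (\<forall>z z'. F z = Some z' \<longrightarrow> fderiv (\<lambda>w. the (F w)) z ` cartan CARD('r) z = cartan CARD('r) z')"
  unfolding contact_map_def trunc_card by (rule ball_dom_iff)

text \<open>The contact condition is an equality of images and not just an inclusion, so applying
  the differential of the inverse to both sides inverts it.\<close>

lemma contact_transformation_pinv:
  fixes T :: "('n::finite, 'm::finite, 'r::finite, 'k::finite) ext \<rightharpoonup> ('n, 'm, 'r, 'k) ext"
  assumes "contact_transformation T"
  shows "contact_transformation (pinv T)"
proof -
  have pt: "point_transformation T" using assms by (simp add: contact_transformation_def)
  note T = point_transformationD[OF pt]
  have "contact_map CARD('r) (pinv (proj_map fst T))"
    unfolding contact_map_card pinv_eq_Some[OF T(7)]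
  proof safe
    fix z z' v assume *: "proj_map fst T z' = Some z"
    have im: "fderiv (\<lambda>w. the (proj_map fst T w)) z' ` cartan CARD('r) z' = cartan CARD('r) z"
      using assms * by (simp add: contact_transformation_def contact_map_card)
    { assume "v \<in> cartan CARD('r) z"
      then show "fderiv (\<lambda>w. the (pinv (proj_map fst T) w)) z v \<in> cartan CARD('r) z'"
        using fderiv_pinv[OF T(6) *] by (auto simp flip: im) }
    { assume "v \<in> cartan CARD('r) z'"
      then show "v \<in> fderiv (\<lambda>w. the (pinv (proj_map fst T) w)) z ` cartan CARD('r) z"
        unfolding im[symmetric] image_image using fderiv_pinv[OF T(6) *] by simp }
  qed
  then show ?thesis
    using point_transformation_pinv[OF pt] T by (simp add: contact_transformation_def proj_map_pinv)
qed

lemma contact_transformation_comp: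
  fixes S T :: "('n::finite, 'm::finite, 'r::finite, 'k::finite) ext \<rightharpoonup> ('n, 'm, 'r, 'k) ext"
  assumes "contact_transformation S" "contact_transformation T"
  shows "contact_transformation (S \<circ>\<^sub>m T)"
proof -
  have pt: "point_transformation S" "point_transformation T"
    using assms by (auto simp: contact_transformation_def)
  note S = point_transformationD[OF pt(1)] and T = point_transformationD[OF pt(2)]
  note ST = point_transformation_comp[OF pt]
  let ?s = "proj_map fst S" and ?t = "proj_map fst T" and ?st = "proj_map fst (S \<circ>\<^sub>m T)"
  have le: "?st \<subseteq>\<^sub>m ?s \<circ>\<^sub>m ?t" by (rule proj_map_comp_le[OF S(5) T(5)])
  have "contact_map CARD('r) ?st"
    unfolding contact_map_card
  proof (intro allI impI)
    fix z z' assume *: "?st z = Some z'"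
    then obtain y where y: "?t z = Some y" "?s y = Some z'"
      using map_le_Some[OF le *] unfolding map_comp_Some_iff by blast
    have "fderiv (\<lambda>w. the (?st w)) z v = fderiv (\<lambda>w. the (?s w)) y (fderiv (\<lambda>w. the (?t w)) z v)" for v
      using fderiv_map_le[OF le local_diffeo_open[OF point_transformationD(6)[OF ST]] domI[of ?st z, OF *]]
        fderiv_map_comp[OF T(6) S(6) y(1) domI[of ?s y, OF y(2)]] by simp
    then have "fderiv (\<lambda>w. the (?st w)) z ` cartan CARD('r) z
        = fderiv (\<lambda>w. the (?s w)) y ` fderiv (\<lambda>w. the (?t w)) z ` cartan CARD('r) z"
      by (simp add: image_image)
    then show "fderiv (\<lambda>w. the (?st w)) z ` cartan CARD('r) z = cartan CARD('r) z'"
      using assms y by (simp add: contact_transformation_def contact_map_card)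
  qed
  with ST show ?thesis by (simp add: contact_transformation_def)
qed

section \<open>Images of arbitrary elements and of systems\<close>

text \<open>The image of a graph is again a graph: the projection of \<open>T\<close> is injective,
  so two image points over the same \<open>z\<close> come from the same \<open>y\<close> and hence
  from the same point of the graph of \<theta>. The choice in \<open>push_arb\<close> thus has one
  candidate.\<close>

lemma push_arb_Some:
  assumes T: "point_transformation T"
  shows "push_arb T \<theta> z = Some t \<longleftrightarrow> (\<exists>y s. \<theta> y = Some s \<and> T (y, s) = Some (z, t))"
proof -
  have iff: "Some (z, t) \<in> T ` Map.graph \<theta> \<longleftrightarrow> (\<exists>y s. \<theta> y = Some s \<and> T (y, s) = Some (z, t))" for t
    unfolding Map.graph_def image_iff eq_commute[of "Some (z, t)"] by auto
  have unique: "t = t'" if "Some (z, t) \<in> T ` Map.graph \<theta>" "Some (z, t') \<in> T ` Map.graph \<theta>" for t t'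
  proof -
    obtain y s y' s' where *: "\<theta> y = Some s" "T (y, s) = Some (z, t)" "\<theta> y' = Some s'" "T (y', s') = Some (z, t')"
      using \<open>Some (z, t) \<in> _\<close> \<open>Some (z, t') \<in> _\<close> unfolding iff by blast
    note d = point_transformationD[OF T]
    have "proj_map fst T y = Some z" "proj_map fst T y' = Some z"
      using proj_map_Some[OF d(5) *(2)] proj_map_Some[OF d(5) *(4)] by simp_all
    then have "y = y'" using inj_onD_Some[OF d(7)] by blast
    with * show ?thesis by simp
  qed
  show ?thesis
    unfolding iff[symmetric] push_arb_def
    using unique by (auto intro: someI some_equality)
qed

text \<open>A point of the graph that leaves the domains on the way is lost on both sides
  alike.\<close>

lemma push_arb_comp:
  assumes "point_transformation S" "point_transformation T"
  shows "push_arb (S \<circ>\<^sub>m T) \<theta> = push_arb S (push_arb T \<theta>)"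
  by (rule map_eqI)
     (unfold push_arb_Some[OF point_transformation_comp[OF assms]] push_arb_Some[OF assms(1)]
        push_arb_Some[OF assms(2)] map_comp_Some_iff, force)

lemma push_arb_pinv:
  assumes "point_transformation T" "Map.graph \<theta> \<subseteq> dom T"
  shows "push_arb (pinv T) (push_arb T \<theta>) = \<theta>"
proof (rule map_eqI)
  note inj = point_transformationD(1)[OF assms(1)]
  have "\<theta> y = Some s \<Longrightarrow> \<exists>w. T (y, s) = Some w" for y s
    using assms(2) by (auto simp: Map.graph_def)
  then show "push_arb (pinv T) (push_arb T \<theta>) y = Some s \<longleftrightarrow> \<theta> y = Some s" for y s
    unfolding push_arb_Some[OF point_transformation_pinv[OF assms(1)]] push_arb_Some[OF assms(1)]
      pinv_eq_Some[OF inj] using inj_onD_Some[OF inj] by (metis prod.inject surj_pair)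
qed

lemma graph_push_arb: "point_transformation T \<Longrightarrow> Map.graph (push_arb T \<theta>) \<subseteq> ran T"
  by (auto simp: Map.graph_def push_arb_Some ran_def)

lemma proj_map_Some_ex:
  assumes "z \<in> p ` dom T"
  obtains z' where "proj_map p T z = Some z'"
  using assms unfolding dom_proj_map[symmetric] by auto

text \<open>\<open>push_system\<close> applies \<open>the\<close> to the projected map; the
  inclusion keeps \<open>V\<close> where this map has a value.\<close>

lemma push_system_eq:
  assumes "V \<subseteq> fst ` dom T"
  shows "z' \<in> push_system T V \<longleftrightarrow> (\<exists>z\<in>V. proj_map fst T z = Some z')"
proof
  assume "z' \<in> push_system T V"
  then obtain z where z: "z \<in> V" "z' = the (proj_map fst T z)" by (auto simp: push_system_def)
  moreover obtain y where "proj_map fst T z = Some y"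
    using z(1) assms by (auto intro: proj_map_Some_ex[of z fst T])
  ultimately show "\<exists>z\<in>V. proj_map fst T z = Some z'" by auto
next
  assume "\<exists>z\<in>V. proj_map fst T z = Some z'"
  then show "z' \<in> push_system T V" by (force simp: push_system_def)
qed

lemma dom_push_arb:
  assumes "point_transformation T" "Map.graph \<theta> \<subseteq> dom T"
  shows "dom (push_arb T \<theta>) = push_system T (dom \<theta>)"
proof -
  note d = point_transformationD[OF assms(1)]
  have sub: "dom \<theta> \<subseteq> fst ` dom T" using assms(2) by (force simp: Map.graph_def)
  have *: "\<theta> y = Some s \<Longrightarrow> \<exists>w. T (y, s) = Some w" for y s
    using assms(2) by (auto simp: Map.graph_def)
  show ?thesis
  proof (intro set_eqI iffI)
    fix z assume "z \<in> dom (push_arb T \<theta>)"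
    then obtain t where "push_arb T \<theta> z = Some t" by auto
    then obtain y s where "\<theta> y = Some s" "T (y, s) = Some (z, t)"
      using push_arb_Some[OF assms(1)] by blast
    then show "z \<in> push_system T (dom \<theta>)"
      using proj_map_Some[OF d(5)] unfolding push_system_eq[OF sub] by fastforce
  next
    fix z assume "z \<in> push_system T (dom \<theta>)"
    then obtain y s where "\<theta> y = Some s" "proj_map fst T y = Some z"
      unfolding push_system_eq[OF sub] by blast
    moreover then obtain w where "T (y, s) = Some w" using * by blast
    ultimately have "fst w = z" "push_arb T \<theta> (fst w) = Some (snd w)"
      using proj_map_Some[OF d(5), of "(y,s)" w] by (auto simp: push_arb_Some[OF assms(1)])
    then show "z \<in> dom (push_arb T \<theta>)" by auto
  qed
qed

text \<open>The inclusion keeps \<open>V\<close> in the domain of the projected composition, where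
  it agrees with the composition of the projections.\<close>

lemma push_system_comp:
  assumes "projectable fst S" "projectable fst T" "V \<subseteq> fst ` dom (S \<circ>\<^sub>m T)"
  shows "push_system (S \<circ>\<^sub>m T) V = push_system S (push_system T V)"
proof -
  have "the (proj_map fst (S \<circ>\<^sub>m T) z) = the (proj_map fst S (the (proj_map fst T z)))" if "z \<in> V" for z
  proof -
    have "z \<in> dom (proj_map fst (S \<circ>\<^sub>m T))" using assms(3) that unfolding dom_proj_map by blast
    then obtain z' where z': "proj_map fst (S \<circ>\<^sub>m T) z = Some z'" using domD[of z] by blast
    from map_le_Some[OF proj_map_comp_le[OF assms(1,2)] z'] show ?thesis
      unfolding map_comp_Some_iff using z' by auto
  qed
  then show ?thesis unfolding push_system_def by (auto simp: image_image)
qed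

lemma push_system_pinv:
  assumes "point_transformation T" "V \<subseteq> fst ` dom T"
  shows "push_system (pinv T) (push_system T V) = V"
proof -
  note d = point_transformationD[OF assms(1)]
  have "the (pinv (proj_map fst T) (the (proj_map fst T z))) = z" if zV: "z \<in> V" for z
  proof -
    obtain z' where "proj_map fst T z = Some z'"
      using proj_map_Some_ex[of z fst T] zV assms(2) by blast
    moreover from this have "pinv (proj_map fst T) z' = Some z" by (simp add: pinv_eq_Some[OF d(7)])
    ultimately show ?thesis by simp
  qed
  then show ?thesis
    unfolding push_system_def proj_map_pinv[OF d(1,5,7)] by (force simp: image_image)
qed

lemma graph_subset_imp: "Map.graph \<theta> \<subseteq> dom T \<Longrightarrow> dom \<theta> \<subseteq> fst ` dom T"
  by (force simp: Map.graph_def)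

lemma de_system_subset: "de_system C \<theta> \<subseteq> dom \<theta>"
  by (auto simp: de_system_def)

subsection \<open>Conjugation of the equivalence group\<close>

definition class_iso ::
  "(('n::finite, 'm::finite, 'r::finite, 'k::finite) ext \<rightharpoonup> ('n, 'm, 'r, 'k) ext) \<Rightarrow>
   ('n, 'm, 'r, 'k, 'l::finite, 'q::finite) de_class \<Rightarrow>
   ('n, 'm, 'r, 'k, 'l, 's::finite) de_class \<Rightarrow> bool" where
  "class_iso \<Psi> C C' \<longleftrightarrow>
     contact_transformation \<Psi> \<and> (\<forall>\<theta>\<in>arbs C. Map.graph \<theta> \<subseteq> dom \<Psi>) \<and> push_arb \<Psi> ` arbs C = arbs C' \<and>
     (\<forall>\<theta>\<in>arbs C. push_system \<Psi> (de_system C \<theta>) = de_system C' (push_arb \<Psi> \<theta>))"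

lemma class_isoD:
  assumes "class_iso \<Psi> C C'"
  shows "contact_transformation \<Psi>" "point_transformation \<Psi>"
    "\<And>\<theta>. \<theta> \<in> arbs C \<Longrightarrow> Map.graph \<theta> \<subseteq> dom \<Psi>"
    "\<And>\<theta>. \<theta> \<in> arbs C \<Longrightarrow> push_arb \<Psi> \<theta> \<in> arbs C'"
    "\<And>\<theta>'. \<theta>' \<in> arbs C' \<Longrightarrow> \<exists>\<theta>\<in>arbs C. \<theta>' = push_arb \<Psi> \<theta>"
    "\<And>\<theta>. \<theta> \<in> arbs C \<Longrightarrow> push_system \<Psi> (de_system C \<theta>) = de_system C' (push_arb \<Psi> \<theta>)"
  using assms unfolding class_iso_def contact_transformation_def by blast+

lemma similarity_imp_class_iso:
  fixes C :: "('n::finite, 'm::finite, 'r::finite, 'k::finite, 'l::finite, 'q::finite) de_class"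
  assumes "similarity_transformation \<Psi> C C'"
  shows "class_iso \<Psi> C C'"
proof -
  have "pip CARD('r) = (fst :: ('n, 'm, 'r, 'k) ext \<Rightarrow> _)" by (rule ext) (simp add: pip_def trunc_card)
  moreover have "contact_map CARD('r) (proj_map (pip CARD('r)) \<Psi>)"
    using assms unfolding similarity_transformation_def prolongs_def by blast
  ultimately show ?thesis
    using assms by (simp add: similarity_transformation_def class_iso_def contact_transformation_def)
qed

text \<open>Every element of \<open>arbs C'\<close> is the image of some \<theta> in
  \<open>arbs C\<close>, and \<open>pinv \<Psi>\<close> returns it to \<theta>. The conditions on
  the inverse can therefore be read off at \<theta>.\<close>

lemma class_iso_pinv:
  assumes "class_iso \<Psi> C C'"
  shows "class_iso (pinv \<Psi>) C' C"
proof -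
  note \<Psi> = class_isoD[OF assms]
  have ret: "push_arb (pinv \<Psi>) (push_arb \<Psi> \<theta>) = \<theta>" if "\<theta> \<in> arbs C" for \<theta>
    using push_arb_pinv[OF \<Psi>(2,3)] that .
  have "push_arb (pinv \<Psi>) ` arbs C' = arbs C"
    using \<Psi>(4,5) ret by (force simp: image_iff)
  moreover have "Map.graph \<theta>' \<subseteq> dom (pinv \<Psi>)" if "\<theta>' \<in> arbs C'" for \<theta>'
    unfolding dom_pinv using \<Psi>(5)[OF that] graph_push_arb[OF \<Psi>(2)] by blast
  moreover have "push_system (pinv \<Psi>) (de_system C' \<theta>') = de_system C (push_arb (pinv \<Psi>) \<theta>')"
    if "\<theta>' \<in> arbs C'" for \<theta>'
  proof -
    obtain \<theta> where \<theta>: "\<theta> \<in> arbs C" "\<theta>' = push_arb \<Psi> \<theta>" using \<Psi>(5) \<open>\<theta>' \<in> arbs C'\<close> by blast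
    have "de_system C \<theta> \<subseteq> fst ` dom \<Psi>"
      using de_system_subset graph_subset_imp[OF \<Psi>(3)[OF \<theta>(1)]] by blast
    then show ?thesis
      using push_system_pinv[OF \<Psi>(2)] \<Psi>(6)[OF \<theta>(1)] ret[OF \<theta>(1)] \<theta>(2) by metis
  qed
  ultimately show ?thesis
    unfolding class_iso_def using contact_transformation_pinv[OF \<Psi>(1)] by blast
qed

definition conjugate :: "('a \<rightharpoonup> 'b) \<Rightarrow> ('a \<rightharpoonup> 'a) \<Rightarrow> ('b \<rightharpoonup> 'b)" where
  "conjugate \<Psi> T = \<Psi> \<circ>\<^sub>m (T \<circ>\<^sub>m pinv \<Psi>)"

lemma conjugate_Some:
  "inj_on \<Psi> (dom \<Psi>) \<Longrightarrow>
    conjugate \<Psi> T y = Some y' \<longleftrightarrow> (\<exists>x x'. \<Psi> x = Some y \<and> T x = Some x' \<and> \<Psi> x' = Some y')"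
  unfolding conjugate_def map_comp_Some_iff by (simp add: pinv_eq_Some) blast

lemma pinv_conjugate:
  assumes "inj_on \<Psi> (dom \<Psi>)" "inj_on T (dom T)"
  shows "pinv (conjugate \<Psi> T) = conjugate \<Psi> (pinv T)"
proof (rule map_eqI)
  have inj: "inj_on (conjugate \<Psi> T) (dom (conjugate \<Psi> T))"
    unfolding conjugate_def by (intro inj_map_comp inj_pinv assms)
  show "pinv (conjugate \<Psi> T) y = Some x \<longleftrightarrow> conjugate \<Psi> (pinv T) y = Some x" for y x
    unfolding pinv_eq_Some[OF inj] conjugate_Some[OF assms(1)] pinv_eq_Some[OF assms(2)] by blast
qed

lemma contact_transformation_conjugate:
  "contact_transformation \<Psi> \<Longrightarrow> contact_transformation T \<Longrightarrow> contact_transformation (conjugate \<Psi> T)"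
  unfolding conjugate_def by (intro contact_transformation_comp contact_transformation_pinv)

lemma point_transformation_conjugate:
  "point_transformation \<Psi> \<Longrightarrow> point_transformation T \<Longrightarrow> point_transformation (conjugate \<Psi> T)"
  unfolding conjugate_def by (intro point_transformation_comp point_transformation_pinv)

lemma push_arb_conjugate:
  assumes "class_iso \<Psi> C C'" "point_transformation T" "\<theta> \<in> arbs C"
  shows "push_arb (conjugate \<Psi> T) (push_arb \<Psi> \<theta>) = push_arb \<Psi> (push_arb T \<theta>)"
proof -
  note \<Psi> = class_isoD[OF assms(1)]
  note p = point_transformation_pinv[OF \<Psi>(2)]
  show ?thesis unfolding conjugate_def
    using push_arb_comp[OF \<Psi>(2) point_transformation_comp[OF assms(2) p]] push_arb_comp[OF assms(2) p]
      push_arb_pinv[OF \<Psi>(2) \<Psi>(3)[OF assms(3)]] by simp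
qed

text \<open>Over each point of the new domain the conjugate is defined somewhere, though perhaps not
  on the graph. The preimage of such a point under \<Psi> lies in \<open>dom T\<close> and, since
  the projection of \<Psi> is injective, over the original point \<open>z\<close>. This is all that
  \<open>acts_on\<close> asks for.\<close>

lemma acts_on_conjugateD:
  assumes "class_iso \<Psi> C C'" "point_transformation T" "\<theta> \<in> arbs C"
    and "acts_on (conjugate \<Psi> T) (push_arb \<Psi> \<theta>)"
  shows "acts_on T \<theta>"
  unfolding acts_on_def
proof
  note \<Psi> = class_isoD[OF assms(1)]
  note d = point_transformationD[OF \<Psi>(2)]
  fix z assume z: "z \<in> dom \<theta>"
  have sub: "dom \<theta> \<subseteq> fst ` dom \<Psi>" using graph_subset_imp[OF \<Psi>(3)[OF assms(3)]] .
  then obtain z' where z': "proj_map fst \<Psi> z = Some z'"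
    using proj_map_Some_ex[of z fst \<Psi>] z by blast
  then have "z' \<in> dom (push_arb \<Psi> \<theta>)"
    unfolding dom_push_arb[OF \<Psi>(2) \<Psi>(3)[OF assms(3)]] push_system_eq[OF sub] using z by blast
  then have "z' \<in> fst ` dom (conjugate \<Psi> T)" using assms(4) by (auto simp: acts_on_def)
  then obtain w w' x x' where "fst w = z'" "\<Psi> x = Some w" "T x = Some x'"
    by (auto simp: conjugate_Some[OF d(1)])
  moreover then have "proj_map fst \<Psi> (fst x) = Some z'" using proj_map_Some[OF d(5)] by blast
  ultimately have "z = fst x" "x \<in> dom T" using z' inj_onD_Some[OF d(7)] by auto
  then show "z \<in> fst ` dom T" by blast
qed

text \<open>For the conjugate to be defined on the new graph, \<open>T\<close> has to lead back into
  \<open>dom \<Psi>\<close>. Along the graph of \<theta> it does, because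
  \<open>push_arb T \<theta>\<close> is again in \<open>arbs C\<close> and \<Psi> is defined on the
  graphs of all such elements.\<close>

lemma maps_class_conjugate:
  assumes \<Psi>iso: "class_iso \<Psi> C C'" and T: "point_transformation T" and m: "maps_class_into_itself C T"
    and \<theta>: "\<theta> \<in> arbs C" and a: "acts_on T \<theta>"
  shows "Map.graph (push_arb \<Psi> \<theta>) \<subseteq> dom (conjugate \<Psi> T)"
    "push_arb (conjugate \<Psi> T) (push_arb \<Psi> \<theta>) \<in> arbs C'"
    "push_system (conjugate \<Psi> T) (de_system C' (push_arb \<Psi> \<theta>))
       = de_system C' (push_arb (conjugate \<Psi> T) (push_arb \<Psi> \<theta>))"
proof -
  note \<Psi> = class_isoD[OF \<Psi>iso]
  note d = point_transformationD[OF \<Psi>(2)] and e = point_transformationD[OF T]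
  note cnj = push_arb_conjugate[OF \<Psi>iso T \<theta>]
  have g: "Map.graph \<theta> \<subseteq> dom T" and p: "push_arb T \<theta> \<in> arbs C"
    and s: "push_system T (de_system C \<theta>) = de_system C (push_arb T \<theta>)"
    using m \<theta> a unfolding maps_class_into_itself_def by blast+
  show gr: "Map.graph (push_arb \<Psi> \<theta>) \<subseteq> dom (conjugate \<Psi> T)"
  proof
    fix w assume "w \<in> Map.graph (push_arb \<Psi> \<theta>)"
    then obtain z t where "w = (z, t)" "push_arb \<Psi> \<theta> z = Some t" by (auto simp: Map.graph_def)
    then obtain y s where *: "w = (z, t)" "\<theta> y = Some s" "\<Psi> (y, s) = Some (z, t)"
      using push_arb_Some[OF \<Psi>(2)] by blast
    then have "(y, s) \<in> dom T" using g by (auto simp: Map.graph_def)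
    then obtain y' s' where 1: "T (y, s) = Some (y', s')" by auto
    then have "(y', s') \<in> Map.graph (push_arb T \<theta>)"
      using *(2) by (auto simp: Map.graph_def push_arb_Some[OF T])
    then have "(y', s') \<in> dom \<Psi>" using \<Psi>(3)[OF p] by blast
    then obtain w' where "\<Psi> (y', s') = Some w'" by blast
    then have "conjugate \<Psi> T w = Some w'"
      unfolding conjugate_Some[OF d(1)] using * 1 by blast
    then show "w \<in> dom (conjugate \<Psi> T)" by blast
  qed
  show "push_arb (conjugate \<Psi> T) (push_arb \<Psi> \<theta>) \<in> arbs C'"
    unfolding cnj using \<Psi>(4)[OF p] .
  have V: "de_system C \<theta> \<subseteq> fst ` dom \<Psi>"
    using de_system_subset graph_subset_imp[OF \<Psi>(3)[OF \<theta>]] by blast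
  have V': "de_system C' (push_arb \<Psi> \<theta>) \<subseteq> fst ` dom (conjugate \<Psi> T)"
    using de_system_subset graph_subset_imp[OF gr] by blast
  have V'': "de_system C' (push_arb \<Psi> \<theta>) \<subseteq> fst ` dom (T \<circ>\<^sub>m pinv \<Psi>)"
  proof -
    have "dom (conjugate \<Psi> T) \<subseteq> dom (T \<circ>\<^sub>m pinv \<Psi>)" by (auto simp: conjugate_def map_comp_Some_iff)
    then show ?thesis using V' by blast
  qed
  note pp = point_transformationD(5)[OF point_transformation_pinv[OF \<Psi>(2)]]
  have "push_system (conjugate \<Psi> T) (de_system C' (push_arb \<Psi> \<theta>))
      = push_system \<Psi> (push_system T (push_system (pinv \<Psi>) (push_system \<Psi> (de_system C \<theta>))))"
    using push_system_comp[OF d(5) projectable_comp[OF e(5) pp] V'[unfolded conjugate_def]]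
      push_system_comp[OF e(5) pp V''] \<Psi>(6)[OF \<theta>] by (simp add: conjugate_def)
  also have "\<dots> = de_system C' (push_arb \<Psi> (push_arb T \<theta>))"
    using push_system_pinv[OF \<Psi>(2) V] s \<Psi>(6)[OF p] by simp
  finally show "push_system (conjugate \<Psi> T) (de_system C' (push_arb \<Psi> \<theta>))
       = de_system C' (push_arb (conjugate \<Psi> T) (push_arb \<Psi> \<theta>))" by (simp add: cnj)
qed

lemma maps_class_into_itself_conjugate:
  assumes "class_iso \<Psi> C C'" "point_transformation T" "maps_class_into_itself C T"
  shows "maps_class_into_itself C' (conjugate \<Psi> T)"
  unfolding maps_class_into_itself_def
proof (intro ballI impI)
  fix \<theta>' assume "\<theta>' \<in> arbs C'" "acts_on (conjugate \<Psi> T) \<theta>'"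
  moreover then obtain \<theta> where "\<theta> \<in> arbs C" "\<theta>' = push_arb \<Psi> \<theta>"
    using class_isoD(5)[OF assms(1)] by blast
  ultimately show "Map.graph \<theta>' \<subseteq> dom (conjugate \<Psi> T) \<and> push_arb (conjugate \<Psi> T) \<theta>' \<in> arbs C' \<and>
        push_system (conjugate \<Psi> T) (de_system C' \<theta>') = de_system C' (push_arb (conjugate \<Psi> T) \<theta>')"
    using maps_class_conjugate[OF assms] acts_on_conjugateD[OF assms(1,2)] by blast
qed

lemma equiv_groupD:
  assumes "T \<in> equiv_group C"
  shows "contact_transformation T" "point_transformation T"
    "maps_class_into_itself C T" "maps_class_into_itself C (pinv T)"
  using assms by (auto simp: equiv_group_def contact_transformation_def)

text \<open>Inversion commutes with conjugation, so the condition on the inverse is obtained by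
  conjugating \<open>pinv T\<close>.\<close>

lemma equiv_group_conjugate:
  assumes "class_iso \<Psi> C C'" "T \<in> equiv_group C"
  shows "conjugate \<Psi> T \<in> equiv_group C'"
proof -
  note T = equiv_groupD[OF assms(2)] and \<Psi> = class_isoD[OF assms(1)]
  have "contact_transformation (conjugate \<Psi> T)"
    using contact_transformation_conjugate[OF \<Psi>(1) T(1)] .
  moreover have "maps_class_into_itself C' (pinv (conjugate \<Psi> T))"
    using maps_class_into_itself_conjugate[OF assms(1) point_transformation_pinv[OF T(2)] T(4)]
    by (simp add: pinv_conjugate point_transformationD(1)[OF \<Psi>(2)] point_transformationD(1)[OF T(2)])
  ultimately show ?thesis
    using maps_class_into_itself_conjugate[OF assms(1) T(2,3)]
    by (simp add: equiv_group_def contact_transformation_def)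
qed

lemma equivalent_arbs_push:
  assumes "class_iso \<Psi> C C'" "\<theta>\<^sub>1 \<in> arbs C" "equivalent_arbs C \<theta>\<^sub>1 \<theta>\<^sub>2"
  shows "equivalent_arbs C' (push_arb \<Psi> \<theta>\<^sub>1) (push_arb \<Psi> \<theta>\<^sub>2)"
proof -
  obtain T where T: "T \<in> equiv_group C" "acts_on T \<theta>\<^sub>1" "push_arb T \<theta>\<^sub>1 = \<theta>\<^sub>2"
    using assms(3) unfolding equivalent_arbs_def by blast
  note t = equiv_groupD[OF T(1)]
  have "acts_on (conjugate \<Psi> T) (push_arb \<Psi> \<theta>\<^sub>1)"
    unfolding acts_on_def
    using graph_subset_imp[OF maps_class_conjugate(1)[OF assms(1) t(2,3) assms(2) T(2)]] .
  then show ?thesis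
    unfolding equivalent_arbs_def
    using equiv_group_conjugate[OF assms(1) T(1)] push_arb_conjugate[OF assms(1) t(2) assms(2)] T(3)
    by blast
qed

lemma equivalent_arbs_push_iff:
  assumes "class_iso \<Psi> C C'" "\<theta>\<^sub>1 \<in> arbs C" "\<theta>\<^sub>2 \<in> arbs C"
  shows "equivalent_arbs C' (push_arb \<Psi> \<theta>\<^sub>1) (push_arb \<Psi> \<theta>\<^sub>2) \<longleftrightarrow> equivalent_arbs C \<theta>\<^sub>1 \<theta>\<^sub>2"
proof
  note \<Psi> = class_isoD[OF assms(1)]
  assume "equivalent_arbs C' (push_arb \<Psi> \<theta>\<^sub>1) (push_arb \<Psi> \<theta>\<^sub>2)"
  from equivalent_arbs_push[OF class_iso_pinv[OF assms(1)] \<Psi>(4)[OF assms(2)] this]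
  show "equivalent_arbs C \<theta>\<^sub>1 \<theta>\<^sub>2"
    using push_arb_pinv[OF \<Psi>(2,3)] assms(2,3) by metis
qed (use equivalent_arbs_push[OF assms(1,2)] in blast)

subsection \<open>Push-forward of vector fields\<close>

lemma local_diffeo_pinv_Some: "local_diffeo f \<Longrightarrow> f x = Some y \<Longrightarrow> pinv f y = Some x"
  by (simp add: pinv_eq_Some[OF local_diffeo_inj])

lemma push_field_at:
  assumes "local_diffeo f" "f x = Some y"
  shows "push_field f Q y = fderiv (\<lambda>x. the (f x)) x (Q x)"
  using local_diffeo_pinv_Some[OF assms] by (simp add: push_field_def)

text \<open>Covers both sources of a zero value: the default off the range of \<open>f\<close>, and
  linearity of the differential where \<open>Q\<close> vanishes.\<close>

lemma push_field_eq_0: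
  assumes "local_diffeo f" "\<And>x. f x = Some y \<Longrightarrow> Q x = 0"
  shows "push_field f Q y = 0"
proof (cases "pinv f y")
  case (Some x)
  then have *: "f x = Some y" by (simp add: pinv_eq_Some[OF local_diffeo_inj[OF assms(1)]])
  then have "x \<in> dom f" by blast
  then show ?thesis
    using push_field_at[OF assms(1) *] assms(2)[OF *] local_diffeo_linear[OF assms(1)]
    by (simp add: linear_0)
qed (simp add: push_field_def)

text \<open>Since projecting a composition may shrink its domain, \<open>h\<close> is compared with
  the composition on \<open>M\<close> only. Off the image of \<open>M\<close> both fields vanish: a
  nonzero value must originate at a point of \<open>M\<close>, and both routes send that point into
  this image.\<close>

lemma push_field_comp:
  assumes f: "local_diffeo f" and g: "local_diffeo g" and h: "local_diffeo h"
    and M: "open M" "\<And>x. x \<notin> M \<Longrightarrow> Q x = 0"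
    and fgh: "\<And>x. x \<in> M \<Longrightarrow> \<exists>w y. f x = Some w \<and> g w = Some y \<and> h x = Some y"
  shows "push_field g (push_field f Q) = push_field h Q"
proof
  fix y
  show "push_field g (push_field f Q) y = push_field h Q y"
  proof (cases "\<exists>x\<in>M. h x = Some y")
    case True
    then obtain x w where x: "x \<in> M" "h x = Some y" "f x = Some w" "g w = Some y"
      using fgh by force
    have "(g \<circ>\<^sub>m f) x' = h x'" if "x' \<in> M" for x'
      using fgh[OF that] by auto
    then have "fderiv (\<lambda>x. the (h x)) x = fderiv (\<lambda>x. the ((g \<circ>\<^sub>m f) x)) x"
      by (intro fderiv_cong_open[OF M(1) x(1)]) simp
    then show ?thesis
      using push_field_at[OF h x(2)] push_field_at[OF g x(4)] push_field_at[OF f x(3)]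
        fderiv_map_comp[OF f g x(3) domI[of g, OF x(4)]] by simp
  next
    case False
    have "push_field h Q y = 0"
      using False M(2) by (intro push_field_eq_0[OF h]) blast
    moreover have "push_field g (push_field f Q) y = 0"
    proof (intro push_field_eq_0[OF g] push_field_eq_0[OF f] M(2) notI)
      fix w x assume "g w = Some y" "f x = Some w" "x \<in> M"
      then show False using fgh[OF \<open>x \<in> M\<close>] False by auto
    qed
    ultimately show ?thesis by simp
  qed
qed

text \<open>Outside \<open>dom f\<close> the left side is 0 by default, and there \<open>Q\<close>
  is 0 as well because it vanishes off \<open>M\<close>.\<close>

lemma push_field_pinv:
  assumes f: "local_diffeo f" and M: "M \<subseteq> dom f" "\<And>x. x \<notin> M \<Longrightarrow> Q x = 0"
  shows "push_field (pinv f) (push_field f Q) = Q"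
proof
  fix x
  note inj = local_diffeo_inj[OF f]
  show "push_field (pinv f) (push_field f Q) x = Q x"
  proof (cases "f x")
    case None
    then have "x \<notin> M" using M(1) by auto
    then show ?thesis using None M(2) by (simp add: push_field_def[of "pinv f"] pinv_pinv[OF inj])
  next
    case (Some y)
    then have "pinv f y = Some x" by (simp add: pinv_eq_Some[OF inj])
    then show ?thesis
      using push_field_at[OF local_diffeo_pinv[OF f]] push_field_at[OF f Some] fderiv_pinv[OF f Some] by simp
  qed
qed

lemma map_image_Some:
  assumes "M \<subseteq> dom f"
  shows "y \<in> (\<lambda>x. the (f x)) ` M \<longleftrightarrow> (\<exists>x\<in>M. f x = Some y)"
  using assms by (force simp: image_iff)

lemma open_diffeo_image:
  assumes "local_diffeo f" "open M" "M \<subseteq> dom f"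
  shows "open ((\<lambda>x. the (f x)) ` M)"
proof -
  have "(\<lambda>x. the (f x)) ` M = {y. \<exists>x\<in>M. pinv f y = Some x}"
    by (rule set_eqI) (simp add: map_image_Some[OF assms(3)] pinv_eq_Some[OF local_diffeo_inj[OF assms(1)]])
  moreover have "open \<dots>"
    using assms by (intro open_preimage_map smooth_on_continuous) (auto simp: local_diffeo_def dom_pinv)
  ultimately show ?thesis by simp
qed

lemma push_field_eq_compose:
  assumes "local_diffeo f" "y \<in> ran f"
  shows "push_field f Q y = (\<lambda>x. fderiv (\<lambda>x. the (f x)) x (Q x)) (the (pinv f y))"
proof -
  obtain x where "f x = Some y" using assms(2) by (auto simp: ran_def)
  moreover then have "pinv f y = Some x" by (rule local_diffeo_pinv_Some[OF assms(1)])
  ultimately show ?thesis using push_field_at[OF assms(1)] by simp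
qed

lemma smooth_push_field:
  assumes f: "local_diffeo f" and M: "open M" "M \<subseteq> dom f" and Q: "smooth_on M Q"
  shows "smooth_on ((\<lambda>x. the (f x)) ` M) (push_field f Q)"
proof -
  let ?N = "(\<lambda>x. the (f x)) ` M"
  have o: "open ?N" by (rule open_diffeo_image[OF f M])
  have N: "?N \<subseteq> ran f" using map_image_Some[OF M(2)] by (auto simp: ran_def)
  have "smooth_on ?N (\<lambda>y. (\<lambda>x. fderiv (\<lambda>x. the (f x)) x (Q x)) (the (pinv f y)))"
  proof (rule smooth_on_compose[OF o M(1), where f="\<lambda>y. the (pinv f y)"])
    show "smooth_on ?N (\<lambda>y. the (pinv f y))"
      using f N smooth_on_subset by (auto simp: local_diffeo_def)
    show "(\<lambda>y. the (pinv f y)) ` ?N \<subseteq> M"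
    proof
      fix x assume "x \<in> (\<lambda>y. the (pinv f y)) ` ?N"
      then obtain y where y: "y \<in> ?N" "x = the (pinv f y)" by blast
      then obtain x' where "x' \<in> M" "f x' = Some y" using map_image_Some[OF M(2)] by blast
      then show "x \<in> M" using y(2) pinv_eq_Some[OF local_diffeo_inj[OF f], of y x'] by simp
    qed
    show "smooth_on M (\<lambda>x. fderiv (\<lambda>x. the (f x)) x (Q x))"
      using f smooth_on_subset[OF _ M(2)] by (intro smooth_on_fderiv_field M Q) (auto simp: local_diffeo_def)
  qed
  moreover have "smooth_on ?N (\<lambda>y. (\<lambda>x. fderiv (\<lambda>x. the (f x)) x (Q x)) (the (pinv f y)))
      \<longleftrightarrow> smooth_on ?N (push_field f Q)"
    using push_field_eq_compose[OF f] N by (intro smooth_on_cong[OF o]) (simp add: subset_iff)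
  ultimately show ?thesis by simp
qed

lemma push_vector_field:
  assumes f: "local_diffeo f" and M: "open M" "M \<subseteq> dom f" and Q: "Q \<in> vector_fields M"
  shows "push_field f Q \<in> vector_fields ((\<lambda>x. the (f x)) ` M)"
proof -
  have "push_field f Q y = 0" if y: "y \<notin> (\<lambda>x. the (f x)) ` M" for y
  proof (rule push_field_eq_0[OF f])
    fix x assume "f x = Some y"
    then have "x \<notin> M" using y map_image_Some[OF M(2)] by blast
    then show "Q x = 0" using Q by (simp add: vector_fields_def)
  qed
  then show ?thesis using smooth_push_field[OF f M] Q by (simp add: vector_fields_def)
qed

text \<open>The right side is the derivative of the map that sends \<open>(x, v)\<close> to the
  differential of \<open>f\<close> at \<open>x\<close> applied to \<open>v\<close>, taken in the
  direction \<open>(Q x, fderiv Q x v)\<close>. So lifting a field to tangent vectors commutes with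
  pushing it forward. Evaluating on the image of \<open>v\<close> cancels the differential of the
  inverse.\<close>

lemma fderiv_push_field:
  assumes f: "local_diffeo f" "f x = Some y" and Q: "Q differentiable (at x)"
  shows "push_field f Q differentiable (at y)"
    "fderiv (push_field f Q) y (fderiv (\<lambda>x. the (f x)) x v)
      = fderiv (\<lambda>p. fderiv (\<lambda>x. the (f x)) p v) x (Q x) + fderiv (\<lambda>x. the (f x)) x (fderiv Q x v)"
proof -
  let ?f = "\<lambda>x. the (f x)" and ?g = "\<lambda>y. the (pinv f y)"
  have x: "x \<in> dom f" and y: "y \<in> dom (pinv f)" using f(2) by (auto simp: dom_pinv ran_def)
  have g: "?g y = x" using local_diffeo_pinv_Some[OF f] by simp
  have s: "open (dom f)" "smooth_on (dom f) ?f" "open (ran f)" using f(1) by (auto simp: local_diffeo_def)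
  have "((\<lambda>p. fderiv ?f p (Q p)) has_derivative
      (\<lambda>v. fderiv (\<lambda>p. fderiv ?f p v) x (Q x) + fderiv ?f x (fderiv Q x v))) (at (?g y))"
    unfolding g by (rule fderiv_fderiv_field[OF s(1,2) x Q])
  from has_derivative_compose[OF local_diffeo_has_derivative[OF local_diffeo_pinv[OF f(1)] y] this]
  have "((\<lambda>y. fderiv ?f (?g y) (Q (?g y))) has_derivative
      (\<lambda>u. fderiv (\<lambda>p. fderiv ?f p (fderiv ?g y u)) x (Q x)
        + fderiv ?f x (fderiv Q x (fderiv ?g y u)))) (at y)" .
  then have D: "(push_field f Q has_derivative
      (\<lambda>u. fderiv (\<lambda>p. fderiv ?f p (fderiv ?g y u)) x (Q x)
        + fderiv ?f x (fderiv Q x (fderiv ?g y u)))) (at y)"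
    by (rule has_derivative_transform_within_open[OF _ s(3)])
       (use y push_field_eq_compose[OF f(1)] in \<open>simp_all add: dom_pinv\<close>)
  then show "push_field f Q differentiable (at y)" by (rule differentiableI)
  show "fderiv (push_field f Q) y (fderiv ?f x v)
      = fderiv (\<lambda>p. fderiv ?f p v) x (Q x) + fderiv ?f x (fderiv Q x v)"
    using fderiv_eq[OF D] fderiv_pinv[OF f] by simp
qed

text \<open>By \<open>fderiv_push_field\<close> each half of the bracket acquires a second
  derivative of \<open>f\<close> in the directions \<open>Q x\<close> and \<open>R x\<close>; by
  symmetry these two terms cancel.\<close>

lemma push_lie_bracket:
  assumes f: "local_diffeo f" and M: "open M" "M \<subseteq> dom f"
    and Q: "Q \<in> vector_fields M" and R: "R \<in> vector_fields M"
  shows "push_field f (lie_bracket M Q R)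
    = lie_bracket ((\<lambda>x. the (f x)) ` M) (push_field f Q) (push_field f R)"
proof
  let ?f = "\<lambda>x. the (f x)"
  fix y
  show "push_field f (lie_bracket M Q R) y = lie_bracket (?f ` M) (push_field f Q) (push_field f R) y"
  proof (cases "y \<in> ?f ` M")
    case True
    then obtain x where x: "x \<in> M" "f x = Some y" using map_image_Some[OF M(2)] by blast
    then have xd: "x \<in> dom f" by blast
    have d: "Q differentiable (at x)" "R differentiable (at x)"
      using Q R x(1) smooth_on_differentiable by (auto simp: vector_fields_def)
    have "fderiv (\<lambda>p. fderiv ?f p (Q x)) x (R x) = fderiv (\<lambda>p. fderiv ?f p (R x)) x (Q x)"
      using f xd by (intro second_fderiv_symmetric[of "dom f"]) (auto simp: local_diffeo_def)
    moreover have "linear (fderiv ?f x)" by (rule local_diffeo_linear[OF f xd])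
    ultimately show ?thesis
      using True x push_field_at[OF f x(2)] fderiv_push_field(2)[OF f x(2) d(1)]
        fderiv_push_field(2)[OF f x(2) d(2)]
      by (simp add: lie_bracket_def linear_diff)
  next
    case False
    have "push_field f (lie_bracket M Q R) y = 0"
    proof (rule push_field_eq_0[OF f])
      fix x assume "f x = Some y"
      then show "lie_bracket M Q R x = 0"
        using False map_image_Some[OF M(2)] by (auto simp: lie_bracket_def)
    qed
    then show ?thesis using False by (simp add: lie_bracket_def)
  qed
qed

lemma push_field_linear:
  assumes f: "local_diffeo f"
  shows "push_field f (\<lambda>_. 0) = (\<lambda>_. 0)"
    "push_field f (\<lambda>x. c *\<^sub>R Q x) = (\<lambda>y. c *\<^sub>R push_field f Q y)"
    "push_field f (\<lambda>x. Q x + R x) = (\<lambda>y. push_field f Q y + push_field f R y)"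
proof -
  have "linear (fderiv (\<lambda>x. the (f x)) x)" if "pinv f y = Some x" for x y
  proof -
    have "f x = Some y" using that by (simp add: pinv_eq_Some[OF local_diffeo_inj[OF f]])
    then have "x \<in> dom f" by blast
    then show ?thesis by (rule local_diffeo_linear[OF f])
  qed
  note lin = linear_0[OF this] linear_cmul[OF this] linear_add[OF this]
  show "push_field f (\<lambda>_. 0) = (\<lambda>_. 0)"
    "push_field f (\<lambda>x. c *\<^sub>R Q x) = (\<lambda>y. c *\<^sub>R push_field f Q y)"
    "push_field f (\<lambda>x. Q x + R x) = (\<lambda>y. push_field f Q y + push_field f R y)"
    using lin by (auto simp: push_field_def fun_eq_iff split: option.split)
qed

lemma push_lie_subalgebra:
  assumes f: "local_diffeo f" and M: "open M" "M \<subseteq> dom f"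
    and g: "g \<subseteq> vector_fields M" "push_field f ` g \<subseteq> g'" and h: "lie_subalgebra M h g"
  shows "lie_subalgebra ((\<lambda>x. the (f x)) ` M) (push_field f ` h) g'"
proof -
  let ?P = "push_field f"
  have hs: "h \<subseteq> g" "(\<lambda>_. 0) \<in> h" "\<And>c Q. Q \<in> h \<Longrightarrow> (\<lambda>x. c *\<^sub>R Q x) \<in> h"
    "\<And>Q R. Q \<in> h \<Longrightarrow> R \<in> h \<Longrightarrow> (\<lambda>x. Q x + R x) \<in> h"
    "\<And>Q R. Q \<in> h \<Longrightarrow> R \<in> h \<Longrightarrow> lie_bracket M Q R \<in> h"
    using h by (auto simp: lie_subalgebra_def)
  have "(\<lambda>_. 0) \<in> ?P ` h"
    using hs(2) push_field_linear(1)[OF f] by (metis (no_types) imageI)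
  moreover have "(\<lambda>y. c *\<^sub>R ?P Q y) \<in> ?P ` h" if "Q \<in> h" for c Q
    unfolding push_field_linear(2)[OF f, symmetric] using hs(3) that by blast
  moreover have "(\<lambda>y. ?P Q y + ?P R y) \<in> ?P ` h" if "Q \<in> h" "R \<in> h" for Q R
    unfolding push_field_linear(3)[OF f, symmetric] using hs(4) that by blast
  moreover have "lie_bracket ((\<lambda>x. the (f x)) ` M) (?P Q) (?P R) \<in> ?P ` h" if "Q \<in> h" "R \<in> h" for Q R
  proof -
    have "Q \<in> vector_fields M" "R \<in> vector_fields M" using that hs(1) g(1) by auto
    from push_lie_bracket[OF f M this, symmetric] show ?thesis using hs(5) that by simp
  qed
  ultimately show ?thesis
    unfolding lie_subalgebra_def using hs(1) g(2) by blast
qed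

subsection \<open>Prolongations and contact forms\<close>

lemma midx_fun_incr:
  assumes "midx_ord (\<alpha> :: ('n::finite, 'r::finite) midx) < CARD('r)"
  shows "midx_fun (midx_incr \<alpha> i) = (midx_fun \<alpha>)(i := Suc (midx_fun \<alpha> i))"
    and "midx_ord (midx_incr \<alpha> i) = Suc (midx_ord \<alpha>)"
proof -
  let ?f = "(midx_fun \<alpha>)(i := Suc (midx_fun \<alpha> i))"
  have s: "(\<Sum>j\<in>UNIV. ?f j) = Suc (midx_ord \<alpha>)"
    by (simp add: midx_ord_def sum.remove[of UNIV i])
  then have "?f \<in> {\<alpha> :: 'n \<Rightarrow> nat. (\<Sum>i\<in>UNIV. \<alpha> i) \<le> CARD('r)}" using assms by simp
  then show *: "midx_fun (midx_incr \<alpha> i) = ?f" unfolding midx_incr_def by (rule Abs_midx_inverse)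
  show "midx_ord (midx_incr \<alpha> i) = Suc (midx_ord \<alpha>)"
    unfolding midx_ord_def[of "midx_incr \<alpha> i"] * by (rule s)
qed

lemma midx_ord_le: "midx_ord (\<alpha> :: ('n::finite, 'r::finite) midx) \<le> CARD('r)"
  using midx_fun[of \<alpha>] by (simp add: midx_ord_def)

lemma midx_zero_simps:
  "midx_fun (midx_zero :: ('n::finite, 'r::finite) midx) = (\<lambda>_. 0)"
  "midx_ord (midx_zero :: ('n::finite, 'r::finite) midx) = 0"
proof -
  show "midx_fun (midx_zero :: ('n, 'r) midx) = (\<lambda>_. 0)"
    unfolding midx_zero_def by (rule Abs_midx_inverse) simp
  then show "midx_ord (midx_zero :: ('n, 'r) midx) = 0" by (simp add: midx_ord_def)
qed

text \<open>Lowering a nonzero exponent by one yields \<open>\<beta>\<close>. This drives the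
  induction along the prolongation formula.\<close>

lemma midx_cases:
  fixes \<alpha> :: "('n::finite, 'r::finite) midx"
  obtains "\<alpha> = midx_zero" | \<beta> i where "midx_ord \<beta> < CARD('r)" "\<alpha> = midx_incr \<beta> i"
proof (cases "midx_fun \<alpha> = (\<lambda>_. 0)")
  case True
  then have "\<alpha> = midx_zero" by (simp add: midx_zero_simps flip: midx_fun_inject)
  then show ?thesis by (rule that)
next
  case False
  then obtain i where i: "midx_fun \<alpha> i \<noteq> 0" by auto
  let ?f = "(midx_fun \<alpha>)(i := midx_fun \<alpha> i - 1)"
  have s: "Suc (\<Sum>j\<in>UNIV. ?f j) = midx_ord \<alpha>"
    using i by (simp add: midx_ord_def sum.remove[of UNIV i])
  then have le: "(\<Sum>j\<in>UNIV. ?f j) < CARD('r)" using midx_ord_le[of \<alpha>] by linarith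
  define \<beta> where "\<beta> = (Abs_midx ?f :: ('n, 'r) midx)"
  have \<beta>: "midx_fun \<beta> = ?f" unfolding \<beta>_def using le by (intro Abs_midx_inverse) simp
  have o: "midx_ord \<beta> < CARD('r)" unfolding midx_ord_def \<beta> by (rule le)
  have "midx_fun (midx_incr \<beta> i) = midx_fun \<alpha>"
    unfolding midx_fun_incr(1)[OF o] \<beta> using i by auto
  then have "\<alpha> = midx_incr \<beta> i" by (simp add: midx_fun_inject)
  then show ?thesis by (rule that(2)[OF o])
qed

section \<open>Functions of jet coordinates of bounded order\<close>

lemma trunc_nth:
  "trunc k z $ Inl i = z $ Inl i"
  "trunc k z $ Inr (\<alpha>, a) = (if midx_ord \<alpha> \<le> k then z $ Inr (\<alpha>, a) else 0)"
  by (simp_all add: trunc_def)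

lemma jet_eq_iff:
  "(z :: ('n::finite, 'm::finite, 'r::finite) jet) = w \<longleftrightarrow>
    (\<forall>i. z $ Inl i = w $ Inl i) \<and> (\<forall>\<alpha> a. z $ Inr (\<alpha>, a) = w $ Inr (\<alpha>, a))"
  unfolding vec_eq_iff by (metis surj_pair sumE)

lemma trunc_eq_iff:
  "trunc k z = trunc k w \<longleftrightarrow> (\<forall>i. z $ Inl i = w $ Inl i) \<and>
    (\<forall>\<alpha> a. midx_ord \<alpha> \<le> k \<longrightarrow> z $ Inr (\<alpha>, a) = w $ Inr (\<alpha>, a))"
  unfolding jet_eq_iff[of "trunc k z"] trunc_nth by auto

text \<open>Stated by values rather than by vanishing derivatives, the property passes through total
  differentiation without any second derivatives.\<close>

definition depends_upto ::
  "nat \<Rightarrow> ('n::finite, 'm::finite, 'r::finite) jet set \<Rightarrow> (('n, 'm, 'r) jet \<Rightarrow> real) \<Rightarrow> bool" where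
  "depends_upto k D f \<longleftrightarrow> (\<forall>w\<in>D. \<forall>w'\<in>D. trunc k w = trunc k w' \<longrightarrow> f w = f w')"

lemma depends_upto_mono: "depends_upto k D f \<Longrightarrow> k \<le> l \<Longrightarrow> depends_upto l D f"
  unfolding depends_upto_def trunc_eq_iff by (meson le_trans)

text \<open>Near \<open>w\<close>, the function is constant on the line in the direction
  \<open>u\<close>, since moving along it only changes coordinates of order above
  \<open>k\<close>.\<close>

lemma depends_upto_fderiv_0:
  assumes f: "depends_upto k D f" "f differentiable (at w)" and D: "open D" "w \<in> D"
    and u: "trunc k u = trunc k 0"
  shows "fderiv f w u = 0"
proof -
  let ?c = "\<lambda>t::real. w + t *\<^sub>R u"
  have c: "(?c has_derivative (\<lambda>t. t *\<^sub>R u)) (at 0)" by (auto intro!: derivative_eq_intros)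
  have "(f has_derivative fderiv f w) (at (?c 0))" using has_fderiv[OF f(2)] by simp
  from has_derivative_compose[OF c this]
  have 1: "((\<lambda>t. f (?c t)) has_derivative (\<lambda>t. fderiv f w (t *\<^sub>R u))) (at 0)" .
  have "open (?c -` D)" by (intro open_vimage D continuous_intros)
  then have "((\<lambda>t. f w) has_derivative (\<lambda>t. fderiv f w (t *\<^sub>R u))) (at 0)"
  proof (rule has_derivative_transform_within_open[OF 1])
    fix t assume "t \<in> ?c -` D"
    moreover have "trunc k (?c t) = trunc k w" using u by (simp add: trunc_eq_iff)
    ultimately show "f (?c t) = f w" using f(1) D(2) unfolding depends_upto_def vimage_eq by blast
  qed (use D in simp)
  from has_derivative_unique[OF this has_derivative_const]
  have "fderiv f w (1 *\<^sub>R u) = 0" by metis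
  then show ?thesis by simp
qed

text \<open>Translation by \<open>w' - w\<close> leaves the coordinates up to order \<open>k\<close>
  fixed and takes \<open>w\<close> to \<open>w'\<close>. So \<open>f\<close> agrees with its
  translate near \<open>w\<close>, on the points whose translates are also in
  \<open>D\<close>.\<close>

lemma depends_upto_fderiv_eq:
  assumes f: "depends_upto k D f" and D: "open D" "w \<in> D" "w' \<in> D" and w: "trunc k w = trunc k w'"
  shows "fderiv f w = fderiv f w'"
proof -
  have "(f has_derivative f') (at w)"
    if f': "(f has_derivative f') (at w')" and w: "w \<in> D" "w' \<in> D" "trunc k w = trunc k w'" for f' w w'
  proof -
    let ?u = "w' - w"
    let ?E = "D \<inter> (\<lambda>y. y + ?u) -` D"
    have o: "open ?E" by (intro open_Int open_vimage D continuous_intros)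
    have eq: "f (y + ?u) = f y" if "y \<in> ?E" for y
    proof -
      have "trunc k (y + ?u) = trunc k y" using w(3) by (simp add: trunc_eq_iff)
      then show ?thesis using f that unfolding depends_upto_def vimage_eq by blast
    qed
    have "((\<lambda>y. y + ?u) has_derivative (\<lambda>h. h)) (at w)" by (auto intro!: derivative_eq_intros)
    from has_derivative_compose[OF this, of f f'] f'
    have "((\<lambda>y. f (y + ?u)) has_derivative f') (at w)" by simp
    then show ?thesis
      by (rule has_derivative_transform_within_open[OF _ o]) (use w eq in auto)
  qed
  from this[OF _ D(2,3) w] this[OF _ D(3,2) w[symmetric]]
  have "(f has_derivative f') (at w) \<longleftrightarrow> (f has_derivative f') (at w')" for f' by blast
  then show ?thesis unfolding frechet_derivative_def by simp
qed

text \<open>The components of \<open>total_vec\<close> up to order \<open>k\<close> only involve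
  coordinates up to order \<open>k + 1\<close>, and its components of higher order are annihilated
  by the derivative of \<open>f\<close>.\<close>

lemma depends_upto_total_deriv:
  fixes D :: "('n::finite, 'm::finite, 'r::finite) jet set"
  assumes f: "depends_upto k D f" "\<And>w. w \<in> D \<Longrightarrow> f differentiable (at w)"
    and D: "open D" and k: "k < CARD('r)"
  shows "depends_upto (Suc k) D (total_deriv i f)"
  unfolding depends_upto_def
proof (intro ballI impI)
  fix w w' assume w: "w \<in> D" "w' \<in> D" and t: "trunc (Suc k) w = trunc (Suc k) w'"
  then have "trunc k w = trunc k w'" by (simp add: trunc_eq_iff)
  then have 1: "fderiv f w = fderiv f w'" by (rule depends_upto_fderiv_eq[OF f(1) D w])
  have "trunc k (total_vec i w - total_vec i w') = trunc k 0"
    using t k unfolding trunc_eq_iff by (auto simp: total_vec_def midx_fun_incr(2))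
  from depends_upto_fderiv_0[OF f(1) f(2)[OF w(1)] D w(1) this]
  have "fderiv f w (total_vec i w) = fderiv f w (total_vec i w')"
    using linear_diff[OF linear_frechet_derivative[OF f(2)[OF w(1)]]] by simp
  then show "total_deriv i f w = total_deriv i f w'" unfolding total_deriv_def 1 by simp
qed

lemma vec_nth_differentiable:
  "X differentiable (at z) \<Longrightarrow> (\<lambda>w. X w $ c) differentiable (at z)"
  by (rule differentiableI, rule bounded_linear.has_derivative[OF bounded_linear_vec_nth has_fderiv])

lemma fderiv_vec_nth:
  "X differentiable (at z) \<Longrightarrow> fderiv (\<lambda>w. X w $ c) z v = fderiv X z v $ c"
  using fderiv_eq[OF bounded_linear.has_derivative[OF bounded_linear_vec_nth has_fderiv], of X z c] by simp

text \<open>The components of order 0 come from \<open>Q\<close> and are functions of (x, u); each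
  application of the prolongation formula raises the order by at most one.\<close>

lemma prolongs_field_depends:
  fixes X :: "('n::finite, 'm::finite, 'r::finite) jet \<Rightarrow> ('n, 'm, 'r) jet"
  assumes X: "prolongs_field D Q X" and D: "open D"
  shows "depends_upto 0 D (\<lambda>w. X w $ Inl j)"
    and "depends_upto (midx_ord \<alpha>) D (\<lambda>w. X w $ Inr (\<alpha>, a))"
proof -
  have s: "smooth_on D X" and b: "\<And>z. z \<in> D \<Longrightarrow> to_base (X z) = Q (to_base z)"
    and p: "\<And>z i \<alpha> a. z \<in> D \<Longrightarrow> midx_ord \<alpha> < CARD('r) \<Longrightarrow> X z $ Inr (midx_incr \<alpha> i, a) =
          total_deriv i (\<lambda>w. X w $ Inr (\<alpha>, a)) z
          - (\<Sum>j\<in>UNIV. z $ Inr (midx_incr \<alpha> j, a) * total_deriv i (\<lambda>w. X w $ Inl j) z)"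
    using X by (auto simp: prolongs_field_def)
  have base: "to_base (X w) = to_base (X w')" if "w \<in> D" "w' \<in> D" "trunc 0 w = trunc 0 w'" for w w'
  proof -
    have "to_base w = to_base w'"
      using that(3) unfolding trunc_eq_iff by (simp add: to_base_def vec_eq_iff midx_zero_simps)
    then show ?thesis using b that(1,2) by metis
  qed
  have "X w $ Inl j = X w' $ Inl j" "X w $ Inr (midx_zero, a) = X w' $ Inr (midx_zero, a)"
    if "w \<in> D" "w' \<in> D" "trunc 0 w = trunc 0 w'" for w w' j a
    using base[OF that] by (simp_all add: to_base_def vec_eq_iff)
  then have 0: "depends_upto 0 D (\<lambda>w. X w $ Inl j)" and 00: "depends_upto 0 D (\<lambda>w. X w $ Inr (midx_zero, a))" for j a
    unfolding depends_upto_def by blast+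
  show "depends_upto 0 D (\<lambda>w. X w $ Inl j)" by (rule 0)
  have d: "(\<lambda>w. X w $ c) differentiable (at w)" if "w \<in> D" for w c
    using vec_nth_differentiable smooth_on_differentiable[OF s that] by blast
  have "midx_ord \<alpha> = k \<Longrightarrow> depends_upto k D (\<lambda>w. X w $ Inr (\<alpha>, a))" for k
  proof (induction k arbitrary: \<alpha>)
    case 0
    then have "\<alpha> = midx_zero" by (metis midx_cases midx_fun_incr(2) nat.distinct(1))
    then show ?case using 00 by simp
  next
    case (Suc k)
    then obtain \<beta> i where \<beta>: "midx_ord \<beta> < CARD('r)" "\<alpha> = midx_incr \<beta> i"
      by (metis midx_cases midx_zero_simps(2) nat.distinct(1))
    then have k: "midx_ord \<beta> = k" "k < CARD('r)" using Suc.prems midx_fun_incr(2)[OF \<beta>(1), of i] by auto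
    note IH = depends_upto_total_deriv[OF Suc.IH[OF k(1)] d D k(2)]
    \<comment> \<open>The total derivatives of the x-components have order at most 1, which
      \<open>Suc k\<close> absorbs.\<close>
    have 1: "depends_upto (Suc k) D (total_deriv i (\<lambda>w. X w $ Inl j))" for j
      by (rule depends_upto_mono[OF depends_upto_total_deriv[OF 0 d D]]) auto
    show ?case
      unfolding depends_upto_def
    proof (intro ballI impI)
      fix w w' assume w: "w \<in> D" "w' \<in> D" "trunc (Suc k) w = trunc (Suc k) w'"
      have "w $ Inr (midx_incr \<beta> j, a) = w' $ Inr (midx_incr \<beta> j, a)" for j
        using w(3) midx_fun_incr(2)[OF \<beta>(1)] k(1) unfolding trunc_eq_iff by simp
      moreover have "total_deriv i (\<lambda>w. X w $ Inl j) w = total_deriv i (\<lambda>w. X w $ Inl j) w'" for j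
        using 1 w unfolding depends_upto_def by blast
      moreover have "total_deriv i (\<lambda>w. X w $ Inr (\<beta>, a)) w = total_deriv i (\<lambda>w. X w $ Inr (\<beta>, a)) w'"
        using IH w unfolding depends_upto_def by blast
      ultimately show "X w $ Inr (\<alpha>, a) = X w' $ Inr (\<alpha>, a)"
        unfolding \<beta>(2) p[OF w(1) \<beta>(1)] p[OF w(2) \<beta>(1)] by simp
    qed
  qed
  then show "depends_upto (midx_ord \<alpha>) D (\<lambda>w. X w $ Inr (\<alpha>, a))" by simp
qed

section \<open>Contact forms and infinitesimal contact symmetries\<close>

definition contact_form ::
  "('n::finite, 'r::finite) midx \<Rightarrow> 'm::finite \<Rightarrow> ('n, 'm, 'r) jet \<Rightarrow> ('n, 'm, 'r) jet \<Rightarrow> real" where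
  "contact_form \<alpha> a z v = v $ Inr (\<alpha>, a) - (\<Sum>i\<in>UNIV. z $ Inr (midx_incr \<alpha> i, a) * v $ Inl i)"

lemma cartan_iff:
  "v \<in> cartan CARD('r) (z :: ('n::finite, 'm::finite, 'r::finite) jet) \<longleftrightarrow>
    (\<forall>\<alpha> a. midx_ord \<alpha> < CARD('r) \<longrightarrow> contact_form \<alpha> a z v = 0)"
proof -
  have "v \<in> range (trunc CARD('r))" by (metis rangeI trunc_card)
  then show ?thesis by (auto simp: cartan_def contact_form_def)
qed

text \<open>
  The derivative of \<open>contact_form \<alpha> a\<close> at \<open>(z, v)\<close> in the direction \<open>(\<zeta>, \<nu>)\<close>. A vector field \<open>X\<close>
  is a prolongation iff its flow preserves the contact forms up to linear combination, and along
  the flow the pair \<open>(z, v)\<close> moves in the direction \<open>(X z, dX v)\<close>.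
\<close>

definition contact_form_deriv ::
  "('n::finite, 'r::finite) midx \<Rightarrow> 'm::finite \<Rightarrow> ('n, 'm, 'r) jet \<Rightarrow> ('n, 'm, 'r) jet \<Rightarrow>
    ('n, 'm, 'r) jet \<Rightarrow> ('n, 'm, 'r) jet \<Rightarrow> real" where
  "contact_form_deriv \<alpha> a z v \<zeta> \<nu> = \<nu> $ Inr (\<alpha>, a)
     - (\<Sum>i\<in>UNIV. z $ Inr (midx_incr \<alpha> i, a) * \<nu> $ Inl i + \<zeta> $ Inr (midx_incr \<alpha> i, a) * v $ Inl i)"

text \<open>The Lie derivative along \<open>X\<close> of each contact form vanishes on the Cartan
  distribution. Written with \<open>contact_form_deriv\<close>, this takes neither flows nor
  exterior derivatives.\<close>

definition contact_field ::
  "('n::finite, 'm::finite, 'r::finite) jet set \<Rightarrow> (('n, 'm, 'r) jet \<Rightarrow> ('n, 'm, 'r) jet) \<Rightarrow> bool" where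
  "contact_field D X \<longleftrightarrow>
     (\<forall>z\<in>D. \<forall>v\<in>cartan CARD('r) z. \<forall>\<alpha> a. midx_ord \<alpha> < CARD('r) \<longrightarrow>
        contact_form_deriv \<alpha> a z v (X z) (fderiv X z v) = 0)"

lemma has_derivative_contact_form:
  fixes p q :: "real \<Rightarrow> ('n::finite, 'm::finite, 'r::finite) jet"
  assumes p: "(p has_vector_derivative \<zeta>) (at t)" and q: "(q has_vector_derivative \<nu>) (at t)"
  shows "((\<lambda>t. contact_form \<alpha> a (p t) (q t)) has_real_derivative
    contact_form_deriv \<alpha> a (p t) (q t) \<zeta> \<nu>) (at t)"
proof -
  have nth: "((\<lambda>t. h t $ c) has_real_derivative d $ c) (at t)"
    if "(h has_vector_derivative d) (at t)" for h :: "real \<Rightarrow> ('n, 'm, 'r) jet" and d c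
    using bounded_linear.has_vector_derivative[OF bounded_linear_vec_nth that]
    by (simp add: has_real_derivative_iff_has_vector_derivative)
  show ?thesis
    unfolding contact_form_def contact_form_deriv_def
    by (auto intro!: derivative_eq_intros nth[OF p] nth[OF q] sum.cong simp: algebra_simps)
qed

lemma total_vec_cartan: "total_vec i z \<in> cartan CARD('r) (z :: ('n::finite, 'm::finite, 'r::finite) jet)"
  by (simp add: cartan_iff contact_form_def total_vec_def if_distrib[of "(*) _"] cong: if_cong)

text \<open>The prolongation formula is the condition of \<open>contact_field\<close> on the Cartan
  vectors \<open>total_vec i z\<close>. Any other Cartan vector differs from a combination of these
  by a vector with components of order r only, and along such a vector the derivatives of the
  components of \<open>X\<close> that enter the condition vanish by
  \<open>prolongs_field_depends\<close>.\<close>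

lemma prolongs_field_iff:
  fixes X :: "('n::finite, 'm::finite, 'r::finite) jet \<Rightarrow> ('n, 'm, 'r) jet"
  assumes D: "open D"
  shows "prolongs_field D Q X \<longleftrightarrow>
    smooth_on D X \<and> (\<forall>z\<in>D. to_base (X z) = Q (to_base z)) \<and> contact_field D X"
proof (intro iffI conjI; (elim conjE)?)
  assume p: "prolongs_field D Q X"
  then show s: "smooth_on D X" and "\<forall>z\<in>D. to_base (X z) = Q (to_base z)"
    by (auto simp: prolongs_field_def)
  show "contact_field D X"
    unfolding contact_field_def
  proof (intro ballI allI impI)
    fix z v and \<alpha> :: "('n, 'r) midx" and a
    assume z: "z \<in> D" and v: "v \<in> cartan CARD('r) z" and \<alpha>: "midx_ord \<alpha> < CARD('r)"
    have d: "X differentiable (at z)" by (rule smooth_on_differentiable[OF s z])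
    \<comment> \<open>The coefficients match the x-components of \<open>v\<close>; the Cartan
      condition then forces agreement in all coordinates of order below r.\<close>
    let ?w = "\<Sum>i\<in>UNIV. v $ Inl i *\<^sub>R total_vec i z"
    \<comment> \<open>The order is at least 1, so the subtraction of natural numbers is exact and
      order at most r - 1 means order below r.\<close>
    have "trunc (CARD('r) - 1) (v - ?w) = trunc (CARD('r) - 1) 0"
      unfolding trunc_eq_iff
    proof (intro conjI allI impI)
      show "(v - ?w) $ Inl i = 0 $ Inl i" for i
        by (simp add: total_vec_def if_distrib[of "(*) _"] cong: if_cong)
      fix \<beta> :: "('n, 'r) midx" and b assume "midx_ord \<beta> \<le> CARD('r) - 1"
      moreover have "CARD('r) > 0" by (rule zero_less_card_finite)
      ultimately have "midx_ord \<beta> < CARD('r)" by linarith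
      then show "(v - ?w) $ Inr (\<beta>, b) = 0 $ Inr (\<beta>, b)"
        using v by (simp add: cartan_iff contact_form_def total_vec_def mult.commute)
    qed
    note zero = depends_upto_fderiv_0[OF depends_upto_mono vec_nth_differentiable[OF d] D z this]
    have lin: "linear (fderiv X z)" by (rule linear_frechet_derivative[OF d])
    have "fderiv X z (v - ?w) $ Inr (\<alpha>, a) = 0"
      using zero[OF prolongs_field_depends(2)[OF p D]] \<alpha> fderiv_vec_nth[OF d] by simp
    then have 1: "fderiv X z v $ Inr (\<alpha>, a) = (\<Sum>i\<in>UNIV. v $ Inl i * fderiv X z (total_vec i z) $ Inr (\<alpha>, a))"
      using lin by (simp add: linear_diff linear_sum linear_cmul)
    have "fderiv X z (v - ?w) $ Inl j = 0" for j
      using zero[OF prolongs_field_depends(1)[OF p D]] fderiv_vec_nth[OF d] by simp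
    then have 2: "fderiv X z v $ Inl j = (\<Sum>i\<in>UNIV. v $ Inl i * fderiv X z (total_vec i z) $ Inl j)" for j
      using lin by (simp add: linear_diff linear_sum linear_cmul)
    have 3: "X z $ Inr (midx_incr \<alpha> i, a) = fderiv X z (total_vec i z) $ Inr (\<alpha>, a)
        - (\<Sum>j\<in>UNIV. z $ Inr (midx_incr \<alpha> j, a) * fderiv X z (total_vec i z) $ Inl j)" for i
      using p z \<alpha> fderiv_vec_nth[OF d] by (simp add: prolongs_field_def total_deriv_def)
    have "(\<Sum>j\<in>UNIV. z $ Inr (midx_incr \<alpha> j, a) * fderiv X z v $ Inl j)
        = (\<Sum>i\<in>UNIV. v $ Inl i * (\<Sum>j\<in>UNIV. z $ Inr (midx_incr \<alpha> j, a) * fderiv X z (total_vec i z) $ Inl j))"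
      unfolding 2 sum_distrib_left by (subst sum.swap) (simp add: mult.left_commute)
    then show "contact_form_deriv \<alpha> a z v (X z) (fderiv X z v) = 0"
      unfolding contact_form_deriv_def 1 3
      by (simp add: sum.distrib sum_subtractf left_diff_distrib right_diff_distrib mult.commute)
  qed
next
  assume s: "smooth_on D X" and b: "\<forall>z\<in>D. to_base (X z) = Q (to_base z)" and c: "contact_field D X"
  show "prolongs_field D Q X"
    unfolding prolongs_field_def
  proof (intro conjI s b ballI allI impI)
    fix z i and \<alpha> :: "('n, 'r) midx" and a assume z: "z \<in> D" and \<alpha>: "midx_ord \<alpha> < CARD('r)"
    have d: "X differentiable (at z)" by (rule smooth_on_differentiable[OF s z])
    have "contact_form_deriv \<alpha> a z (total_vec i z) (X z) (fderiv X z (total_vec i z)) = 0"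
      using c z \<alpha> total_vec_cartan unfolding contact_field_def by blast
    moreover have "(\<Sum>j\<in>UNIV. X z $ Inr (midx_incr \<alpha> j, a) * total_vec i z $ Inl j)
        = X z $ Inr (midx_incr \<alpha> i, a)"
      by (simp add: total_vec_def if_distrib[of "(*) _"] cong: if_cong)
    ultimately show "X z $ Inr (midx_incr \<alpha> i, a) = total_deriv i (\<lambda>w. X w $ Inr (\<alpha>, a)) z
          - (\<Sum>j\<in>UNIV. z $ Inr (midx_incr \<alpha> j, a) * total_deriv i (\<lambda>w. X w $ Inl j) z)"
      unfolding total_deriv_def contact_form_deriv_def by (simp add: fderiv_vec_nth[OF d] sum.distrib)
  qed
qed

section \<open>Naturality of contact fields, prolongations and flows\<close>

lemma linear_contact_form: "linear (contact_form \<alpha> a z)"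
  by (rule linearI)
     (simp_all add: contact_form_def algebra_simps sum.distrib sum_distrib_left)

text \<open>The axes of the derivative coordinates have no x-components and so form a dual family to
  the contact forms at every \<open>z\<close>.\<close>

lemma contact_form_axis:
  "contact_form \<alpha> a z (axis (Inr (\<beta>, b)) 1) = (if \<beta> = \<alpha> \<and> b = a then 1 else 0)"
  by (auto simp: contact_form_def axis_def)

text \<open>The pullback of a contact form vanishes on the common kernel of the contact forms, hence
  is a combination of them. Its coefficients are its values on the dual axes; this explicit form
  shows that they are differentiable along a curve of base points.\<close>

lemma contact_map_pullback:
  fixes F :: "('n::finite, 'm::finite, 'r::finite) jet \<rightharpoonup> ('n, 'm, 'r) jet"
  assumes F: "local_diffeo F" "contact_map CARD('r) F" "F p = Some p'" and \<beta>: "midx_ord \<beta> < CARD('r)"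
  defines "dF \<equiv> fderiv (\<lambda>x. the (F x)) p"
  shows "contact_form \<beta> b p' (dF v) = (\<Sum>c\<in>{c. midx_ord (fst c) < CARD('r)}.
     contact_form (fst c) (snd c) p v * contact_form \<beta> b p' (dF (axis (Inr c) 1)))"
proof -
  let ?I = "{c :: ('n, 'r) midx \<times> 'm. midx_ord (fst c) < CARD('r)}"
  let ?e = "\<lambda>c. axis (Inr c) 1 :: ('n, 'm, 'r) jet"
  \<comment> \<open>By duality \<open>?w\<close> has the same values of all contact forms as
    \<open>v\<close>, so subtracting it projects \<open>v\<close> onto the Cartan
    distribution.\<close>
  let ?w = "\<Sum>c\<in>?I. contact_form (fst c) (snd c) p v *\<^sub>R ?e c"
  have "p \<in> dom F" using F(3) by blast
  then have lin: "linear dF" unfolding dF_def by (rule local_diffeo_linear[OF F(1)])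
  have "v - ?w \<in> cartan CARD('r) p"
    unfolding cartan_iff
  proof (intro allI impI)
    fix \<alpha> :: "('n, 'r) midx" and a :: 'm assume \<alpha>: "midx_ord \<alpha> < CARD('r)"
    have "contact_form \<alpha> a p ?w = (\<Sum>c\<in>?I. contact_form (fst c) (snd c) p v * contact_form \<alpha> a p (?e c))"
      by (simp add: linear_sum[OF linear_contact_form] linear_cmul[OF linear_contact_form])
    also have "\<dots> = (\<Sum>c\<in>?I. if c = (\<alpha>, a) then contact_form \<alpha> a p v else 0)"
      by (intro sum.cong) (auto simp: contact_form_axis split: if_splits)
    also have "\<dots> = contact_form \<alpha> a p v" using \<alpha> by simp
    finally show "contact_form \<alpha> a p (v - ?w) = 0"
      by (simp add: linear_diff[OF linear_contact_form])
  qed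
  then have "dF (v - ?w) \<in> cartan CARD('r) p'"
    using F(2,3) unfolding contact_map_card dF_def by blast
  then have "contact_form \<beta> b p' (dF (v - ?w)) = 0" using \<beta> by (simp add: cartan_iff)
  then have "contact_form \<beta> b p' (dF v) = contact_form \<beta> b p' (dF ?w)"
    by (simp add: linear_diff[OF lin] linear_diff[OF linear_contact_form])
  also have "\<dots> = (\<Sum>c\<in>?I. contact_form (fst c) (snd c) p v * contact_form \<beta> b p' (dF (?e c)))"
    by (simp add: linear_sum[OF lin] linear_cmul[OF lin] linear_sum[OF linear_contact_form]
        linear_cmul[OF linear_contact_form])
  finally show ?thesis .
qed

text \<open>The expression to be shown zero is the derivative at 0 of a contact form along the image
  of a curve of pairs \<open>(p t, q t)\<close>. By the pullback formula this is the derivative of a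
  sum of products. In each product the contact form at \<open>(p t, q t)\<close> vanishes at 0
  because \<open>v\<close> is a Cartan vector, and so does its derivative because \<open>X\<close>
  is a contact field.\<close>

lemma push_contact_field:
  fixes F :: "('n::finite, 'm::finite, 'r::finite) jet \<rightharpoonup> ('n, 'm, 'r) jet"
  assumes F: "local_diffeo F" "contact_map CARD('r) F"
    and D: "open D" "D \<subseteq> dom F" and X: "smooth_on D X" "contact_field D X"
  shows "contact_field ((\<lambda>x. the (F x)) ` D) (push_field F X)"
  unfolding contact_field_def
proof (intro ballI allI impI)
  let ?F = "\<lambda>x. the (F x)" and ?X = "push_field F X"
  fix z' v' and \<beta> :: "('n, 'r) midx" and b
  assume "z' \<in> ?F ` D" and v': "v' \<in> cartan CARD('r) z'" and \<beta>: "midx_ord \<beta> < CARD('r)"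
  then obtain z where z: "z \<in> D" "F z = Some z'" using map_image_Some[OF D(2)] by blast
  then obtain v where v: "v \<in> cartan CARD('r) z" "v' = fderiv ?F z v"
    using v' F(2) unfolding contact_map_card by blast
  have zF: "z \<in> dom F" using z D by blast
  have sF: "open (dom F)" "smooth_on (dom F) ?F" using F(1) by (auto simp: local_diffeo_def)
  have dX: "X differentiable (at z)" by (rule smooth_on_differentiable[OF X(1) z(1)])
  \<comment> \<open>Straight lines replace the flow of \<open>X\<close> and of its lift to tangent
    vectors, as only first derivatives at 0 matter.\<close>
  define p where "p = (\<lambda>t::real. z + t *\<^sub>R X z)"
  define q where "q = (\<lambda>t::real. v + t *\<^sub>R fderiv X z v)"
  have p: "(p has_vector_derivative X z) (at 0)" and q: "(q has_vector_derivative fderiv X z v) (at 0)"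
    unfolding p_def q_def by (auto intro!: derivative_eq_intros)
  have p0: "p 0 = z" "q 0 = v" by (simp_all add: p_def q_def)
  have Fp: "((\<lambda>t. ?F (p t)) has_vector_derivative fderiv ?F z (X z)) (at 0)"
    using vector_derivative_diff_chain_within[of p "X z" 0 UNIV ?F "fderiv ?F z"]
      local_diffeo_has_derivative[OF F(1) zF] p by (simp add: p0 o_def has_derivative_at_withinI)
  have dFc: "((\<lambda>t. fderiv ?F (p t) u) has_vector_derivative fderiv (\<lambda>x. fderiv ?F x u) z (X z)) (at 0)" for u
  proof -
    have "((\<lambda>x. fderiv ?F x u) has_derivative fderiv (\<lambda>x. fderiv ?F x u) z) (at z)"
      by (intro has_fderiv smooth_on_differentiable[OF smooth_on_fderiv[OF sF(2)] zF])
    then show ?thesis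
      using vector_derivative_diff_chain_within[of p "X z" 0 UNIV "\<lambda>x. fderiv ?F x u"] p
      by (simp add: p0 o_def has_derivative_at_withinI)
  qed
  have dFq: "((\<lambda>t. fderiv ?F (p t) (q t)) has_vector_derivative
      fderiv (\<lambda>x. fderiv ?F x v) z (X z) + fderiv ?F z (fderiv X z v)) (at 0)"
  proof -
    let ?u = "fderiv X z v"
    \<comment> \<open>Linearity of the differential splits off the factor \<open>t\<close>. At 0 the
      product rule keeps the value of the second differential and multiplies its derivative by
      0.\<close>
    have 1: "((\<lambda>t. fderiv ?F (p t) v + t *\<^sub>R fderiv ?F (p t) ?u) has_vector_derivative
      fderiv (\<lambda>x. fderiv ?F x v) z (X z) + (0 *\<^sub>R fderiv (\<lambda>x. fderiv ?F x ?u) z (X z) + 1 *\<^sub>R fderiv ?F (p 0) ?u)) (at 0)"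
      by (intro has_vector_derivative_add has_vector_derivative_scaleR dFc DERIV_ident)
    have "open (p -` D)" unfolding p_def by (intro open_vimage D continuous_intros)
    then have "((\<lambda>t. fderiv ?F (p t) (q t)) has_vector_derivative
      fderiv (\<lambda>x. fderiv ?F x v) z (X z) + (0 *\<^sub>R fderiv (\<lambda>x. fderiv ?F x ?u) z (X z) + 1 *\<^sub>R fderiv ?F (p 0) ?u)) (at 0)"
    proof (rule has_vector_derivative_transform_within_open[OF 1])
      fix t assume "t \<in> p -` D"
      then have "linear (fderiv ?F (p t))" using D(2) by (intro local_diffeo_linear[OF F(1)]) auto
      then show "fderiv ?F (p t) v + t *\<^sub>R fderiv ?F (p t) ?u = fderiv ?F (p t) (q t)"
        by (simp add: q_def linear_add linear_cmul)
    qed (use z p0 in simp)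
    then show ?thesis by (simp add: p0)
  qed
  let ?I = "{c :: ('n, 'r) midx \<times> 'm. midx_ord (fst c) < CARD('r)}"
  let ?e = "\<lambda>c. axis (Inr c) 1 :: ('n, 'm, 'r) jet"
  have L: "((\<lambda>t. contact_form \<beta> b (?F (p t)) (fderiv ?F (p t) (q t))) has_real_derivative
     contact_form_deriv \<beta> b z' v' (?X z') (fderiv ?X z' v')) (at 0)"
    using has_derivative_contact_form[OF Fp dFq] z(2) v(2) push_field_at[OF F(1) z(2)]
      fderiv_push_field(2)[OF F(1) z(2) dX] by (simp add: p0)
  have "((\<lambda>t. \<Sum>c\<in>?I. contact_form (fst c) (snd c) (p t) (q t) * contact_form \<beta> b (?F (p t)) (fderiv ?F (p t) (?e c)))
    has_real_derivative (\<Sum>c\<in>?I. 0)) (at 0)"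
  proof (rule DERIV_sum)
    fix c assume "c \<in> ?I"
    then have c: "midx_ord (fst c) < CARD('r)" by auto
    let ?g = "\<lambda>t. contact_form \<beta> b (?F (p t)) (fderiv ?F (p t) (?e c))"
    \<comment> \<open>The value of \<open>g'\<close> is immaterial, since it is multiplied by a
      factor that vanishes at 0.\<close>
    obtain g' where g': "(?g has_real_derivative g') (at 0)"
      using has_derivative_contact_form[OF Fp dFc] by blast
    have "contact_form_deriv (fst c) (snd c) z v (X z) (fderiv X z v) = 0"
      using X(2) z(1) v(1) c unfolding contact_field_def by blast
    then have f': "((\<lambda>t. contact_form (fst c) (snd c) (p t) (q t)) has_real_derivative 0) (at 0)"
      using has_derivative_contact_form[OF p q, of "fst c" "snd c"] by (simp add: p0)
    have f0: "contact_form (fst c) (snd c) (p 0) (q 0) = 0"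
      using v(1) c by (simp add: p0 cartan_iff)
    show "((\<lambda>t. contact_form (fst c) (snd c) (p t) (q t) * ?g t) has_real_derivative 0) (at 0)"
      using DERIV_mult[OF f' g'] by (simp add: f0)
  qed
  then have R: "((\<lambda>t. \<Sum>c\<in>?I. contact_form (fst c) (snd c) (p t) (q t) * contact_form \<beta> b (?F (p t)) (fderiv ?F (p t) (?e c)))
    has_real_derivative 0) (at 0)" by simp
  have "open (p -` D)" unfolding p_def by (intro open_vimage D continuous_intros)
  then have "((\<lambda>t. contact_form \<beta> b (?F (p t)) (fderiv ?F (p t) (q t))) has_real_derivative 0) (at 0)"
  proof (rule has_field_derivative_transform_within_open[OF R])
    fix t assume "t \<in> p -` D"
    then obtain p' where p': "F (p t) = Some p'" using D(2) by blast
    show "(\<Sum>c\<in>?I. contact_form (fst c) (snd c) (p t) (q t) * contact_form \<beta> b (?F (p t)) (fderiv ?F (p t) (?e c)))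
       = contact_form \<beta> b (?F (p t)) (fderiv ?F (p t) (q t))"
      using contact_map_pullback[OF F p' \<beta>, of b "q t"] p' by simp
  qed (use z p0 in simp)
  from DERIV_unique[OF L this]
  show "contact_form_deriv \<beta> b z' v' (?X z') (fderiv ?X z' v') = 0" .
qed

text \<open>With \<open>prolongs_field_iff\<close>, what remains beyond
  \<open>push_contact_field\<close> and smoothness is the projection to the space of (x, u). It
  follows by differentiating the identity between \<open>to_base\<close> after \<open>F\<close> and
  \<phi> after \<open>to_base\<close>.\<close>

lemma push_prolongs_field:
  fixes F :: "('n::finite, 'm::finite, 'r::finite) jet \<rightharpoonup> ('n, 'm, 'r) jet"
  assumes F: "local_diffeo F" "contact_map CARD('r) F" and \<phi>: "local_diffeo \<phi>"
    and F\<phi>: "\<And>z z'. F z = Some z' \<Longrightarrow> \<phi> (to_base z) = Some (to_base z')"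
    and D: "open D" "D \<subseteq> dom F" and X: "prolongs_field D Q X"
  shows "prolongs_field ((\<lambda>z. the (F z)) ` D) (push_field \<phi> Q) (push_field F X)"
proof -
  let ?F = "\<lambda>z. the (F z)" and ?\<phi> = "\<lambda>x. the (\<phi> x)"
  have Xs: "smooth_on D X" "contact_field D X" and Xb: "\<And>z. z \<in> D \<Longrightarrow> to_base (X z) = Q (to_base z)"
    using X unfolding prolongs_field_iff[OF D(1)] by auto
  have tb: "bounded_linear (to_base :: ('n, 'm, 'r) jet \<Rightarrow> _)"
    using linear_to_base by (simp add: linear_conv_bounded_linear)
  have base: "to_base (push_field F X z') = push_field \<phi> Q (to_base z')" if z': "z' \<in> ?F ` D" for z'
  proof -
    obtain z where z: "z \<in> D" "F z = Some z'" using z' map_image_Some[OF D(2)] by blast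
    have zF: "z \<in> dom F" using z D by blast
    have b: "to_base z \<in> dom \<phi>" using F\<phi>[OF z(2)] by blast
    have "((\<lambda>x. to_base (?F x)) has_derivative (\<lambda>v. to_base (fderiv ?F z v))) (at z)"
      by (rule bounded_linear.has_derivative[OF tb local_diffeo_has_derivative[OF F(1) zF]])
    then have "((\<lambda>x. ?\<phi> (to_base x)) has_derivative (\<lambda>v. to_base (fderiv ?F z v))) (at z)"
    proof (rule has_derivative_transform_within_open[OF _ local_diffeo_open[OF F(1)] zF])
      fix x assume "x \<in> dom F"
      then obtain x' where "F x = Some x'" by blast
      then show "to_base (?F x) = ?\<phi> (to_base x)" using F\<phi>[of x x'] by simp
    qed
    moreover have "((\<lambda>x. ?\<phi> (to_base x)) has_derivative (\<lambda>v. fderiv ?\<phi> (to_base z) (to_base v))) (at z)"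
      by (rule has_derivative_compose[OF bounded_linear.has_derivative[OF tb has_derivative_ident]
            local_diffeo_has_derivative[OF \<phi> b]])
    ultimately have "to_base (fderiv ?F z v) = fderiv ?\<phi> (to_base z) (to_base v)" for v
      using has_derivative_unique by metis
    then show ?thesis
      using push_field_at[OF F(1) z(2)] push_field_at[OF \<phi> F\<phi>[OF z(2)]] Xb[OF z(1)] by simp
  qed
  show ?thesis
    unfolding prolongs_field_iff[OF open_diffeo_image[OF F(1) D]]
    using smooth_push_field[OF F(1) D Xs(1)] push_contact_field[OF F D Xs] base by blast
qed

text \<open>The inverse of \<open>F\<close> carries integral curves of the pushed field back to
  integral curves of \<open>X\<close>, to which the assumption applies.\<close>

lemma push_flow_invariant:
  assumes F: "local_diffeo F" and D: "D \<subseteq> dom F" "V \<subseteq> D" and X: "flow_invariant D X V"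
  shows "flow_invariant ((\<lambda>z. the (F z)) ` D) (push_field F X) ((\<lambda>z. the (F z)) ` V)"
  unfolding flow_invariant_def
proof (intro allI impI ballI; elim conjE)
  let ?F = "\<lambda>z. the (F z)" and ?G = "\<lambda>z. the (pinv F z)"
  fix c :: "real \<Rightarrow> _" and a b t
  assume c: "\<forall>t\<in>{a<..<b}. c t \<in> ?F ` D \<and> (c has_vector_derivative push_field F X (c t)) (at t)"
    and V: "\<exists>t\<in>{a<..<b}. c t \<in> ?F ` V" and t: "t \<in> {a<..<b}"
  have VF: "V \<subseteq> dom F" using D by blast
  have "?G (c t) \<in> D \<and> ((\<lambda>t. ?G (c t)) has_vector_derivative X (?G (c t))) (at t)"
    if t: "t \<in> {a<..<b}" for t
  proof -
    obtain z where z: "z \<in> D" "F z = Some (c t)" using c t map_image_Some[OF D(1)] by blast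
    then have G: "pinv F (c t) = Some z" by (intro local_diffeo_pinv_Some[OF F])
    then have "(?G has_derivative fderiv ?G (c t)) (at (c t))"
      by (intro local_diffeo_has_derivative[OF local_diffeo_pinv[OF F]]) blast
    then have "((\<lambda>t. ?G (c t)) has_vector_derivative fderiv ?G (c t) (push_field F X (c t))) (at t)"
      using vector_derivative_diff_chain_within[of c "push_field F X (c t)" t UNIV ?G "fderiv ?G (c t)"] c t
      by (simp add: o_def has_derivative_at_withinI)
    then show ?thesis using z G push_field_at[OF F z(2)] fderiv_pinv[OF F z(2)] by simp
  qed
  moreover have "\<exists>t\<in>{a<..<b}. ?G (c t) \<in> V"
  proof -
    obtain t z where "t \<in> {a<..<b}" "z \<in> V" "F z = Some (c t)" using V map_image_Some[OF VF] by blast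
    then show ?thesis using local_diffeo_pinv_Some[OF F, of z "c t"] by (intro bexI[of _ t]) simp_all
  qed
  ultimately have "?G (c t) \<in> V"
    using X[unfolded flow_invariant_def, rule_format, of a b "\<lambda>t. ?G (c t)" t] t by blast
  moreover obtain z where "z \<in> D" "F z = Some (c t)" using c t map_image_Some[OF D(1)] by blast
  ultimately show "c t \<in> ?F ` V"
    using local_diffeo_pinv_Some[OF F, of z "c t"] map_image_Some[OF VF] by auto
qed

subsection \<open>Invariance algebras and classification\<close>

text \<open>Since \<open>pi0\<close> factors through \<open>fst\<close>, one pair of corresponding
  points of \<open>T\<close> determines both projections.\<close>

lemma proj_map_base:
  assumes "point_transformation T" "proj_map fst T z = Some z'"
  shows "proj_map pi0 T (to_base z) = Some (to_base z')"
proof -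
  note d = point_transformationD[OF assms(1)]
  obtain w w' where "T w = Some w'" "fst w = z" "fst w' = z'"
    using assms(2) proj_map_SomeE[OF d(5)] by blast
  then show ?thesis using proj_map_Some[OF d(3), of w w'] by (simp add: pi0_def)
qed

lemma arbs_open: "\<theta> \<in> arbs C \<Longrightarrow> open (dom \<theta>)"
  by (simp add: arbs_def)

lemma class_iso_dom:
  assumes "class_iso \<Psi> C C'" "\<theta> \<in> arbs C"
  shows "dom \<theta> \<subseteq> dom (proj_map fst \<Psi>)" "dom (push_arb \<Psi> \<theta>) = push_system \<Psi> (dom \<theta>)"
    "open (to_base ` dom \<theta>)" "to_base ` dom \<theta> \<subseteq> dom (proj_map pi0 \<Psi>)"
    "to_base ` dom (push_arb \<Psi> \<theta>) = (\<lambda>x. the (proj_map pi0 \<Psi> x)) ` to_base ` dom \<theta>"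
proof -
  note \<Psi> = class_isoD[OF assms(1)]
  note g = \<Psi>(3)[OF assms(2)]
  show F: "dom \<theta> \<subseteq> dom (proj_map fst \<Psi>)"
    unfolding dom_proj_map by (rule graph_subset_imp[OF g])
  show d: "dom (push_arb \<Psi> \<theta>) = push_system \<Psi> (dom \<theta>)" by (rule dom_push_arb[OF \<Psi>(2) g])
  show "open (to_base ` dom \<theta>)" by (rule open_to_base[OF arbs_open[OF assms(2)]])
  have b: "\<exists>z'. proj_map fst \<Psi> z = Some z' \<and> proj_map pi0 \<Psi> (to_base z) = Some (to_base z')"
    if "z \<in> dom \<theta>" for z
    using F that proj_map_base[OF \<Psi>(2)] by blast
  then show "to_base ` dom \<theta> \<subseteq> dom (proj_map pi0 \<Psi>)" by blast
  have "to_base (the (proj_map fst \<Psi> z)) = the (proj_map pi0 \<Psi> (to_base z))" if "z \<in> dom \<theta>" for z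
    using b[OF that] by auto
  then show "to_base ` dom (push_arb \<Psi> \<theta>) = (\<lambda>x. the (proj_map pi0 \<Psi> x)) ` to_base ` dom \<theta>"
    unfolding d push_system_def image_image by simp
qed

lemma lie_invariance_vector_fields:
  "lie_invariance_algebra C \<theta> \<subseteq> vector_fields (to_base ` dom \<theta>)"
  by (auto simp: lie_invariance_algebra_def)

lemma push_lie_invariance_subset:
  fixes C :: "('n::finite, 'm::finite, 'r::finite, 'k::finite, 'l::finite, 'q::finite) de_class"
  assumes "class_iso \<Psi> C C'" "\<theta> \<in> arbs C"
  shows "push_field (proj_map pi0 \<Psi>) ` lie_invariance_algebra C \<theta>
    \<subseteq> lie_invariance_algebra C' (push_arb \<Psi> \<theta>)"
proof
  note \<Psi> = class_isoD[OF assms(1)] and d = class_iso_dom[OF assms]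
  note p = point_transformationD[OF \<Psi>(2)]
  have o: "open (dom \<theta>)" by (rule arbs_open[OF assms(2)])
  have c: "contact_map CARD('r) (proj_map fst \<Psi>)" using \<Psi>(1) by (simp add: contact_transformation_def)
  fix Q' assume "Q' \<in> push_field (proj_map pi0 \<Psi>) ` lie_invariance_algebra C \<theta>"
  then obtain Q X where Q: "Q' = push_field (proj_map pi0 \<Psi>) Q" "Q \<in> vector_fields (to_base ` dom \<theta>)"
    "prolongs_field (dom \<theta>) Q X" "flow_invariant (dom \<theta>) X (de_system C \<theta>)"
    unfolding lie_invariance_algebra_def by blast
  have "Q' \<in> vector_fields (to_base ` dom (push_arb \<Psi> \<theta>))"
    unfolding Q(1) d(5) by (rule push_vector_field[OF p(4) d(3,4) Q(2)])
  moreover have "prolongs_field (dom (push_arb \<Psi> \<theta>)) Q' (push_field (proj_map fst \<Psi>) X)"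
    unfolding Q(1) d(2) push_system_def
    by (rule push_prolongs_field[OF p(6) c p(4) proj_map_base[OF \<Psi>(2)] o d(1) Q(3)])
  moreover have "flow_invariant (dom (push_arb \<Psi> \<theta>)) (push_field (proj_map fst \<Psi>) X)
      (de_system C' (push_arb \<Psi> \<theta>))"
    unfolding d(2) \<Psi>(6)[OF assms(2), symmetric] push_system_def
    by (rule push_flow_invariant[OF p(6) d(1) de_system_subset Q(4)])
  ultimately show "Q' \<in> lie_invariance_algebra C' (push_arb \<Psi> \<theta>)"
    unfolding lie_invariance_algebra_def by blast
qed

lemma push_field_class_iso_pinv:
  assumes "class_iso \<Psi> C C'" "\<theta> \<in> arbs C" "Q \<in> vector_fields (to_base ` dom \<theta>)"
  shows "push_field (proj_map pi0 (pinv \<Psi>)) (push_field (proj_map pi0 \<Psi>) Q) = Q"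
proof -
  note p = point_transformationD[OF class_isoD(2)[OF assms(1)]]
  show ?thesis
    unfolding proj_map_pinv[OF p(1,3,8)]
    by (rule push_field_pinv[OF p(4) class_iso_dom(4)[OF assms(1,2)]])
       (use assms(3) in \<open>auto simp: vector_fields_def\<close>)
qed

lemma push_lie_invariance:
  assumes "class_iso \<Psi> C C'" "\<theta> \<in> arbs C"
  shows "push_field (proj_map pi0 \<Psi>) ` lie_invariance_algebra C \<theta>
    = lie_invariance_algebra C' (push_arb \<Psi> \<theta>)"
proof
  note \<Psi> = class_isoD[OF assms(1)] and inv = class_iso_pinv[OF assms(1)]
  note \<theta>' = \<Psi>(4)[OF assms(2)]
  have \<theta>: "push_arb (pinv \<Psi>) (push_arb \<Psi> \<theta>) = \<theta>" by (rule push_arb_pinv[OF \<Psi>(2) \<Psi>(3)[OF assms(2)]])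
  show "lie_invariance_algebra C' (push_arb \<Psi> \<theta>) \<subseteq> push_field (proj_map pi0 \<Psi>) ` lie_invariance_algebra C \<theta>"
  proof
    fix Q assume Q: "Q \<in> lie_invariance_algebra C' (push_arb \<Psi> \<theta>)"
    then have "push_field (proj_map pi0 (pinv \<Psi>)) Q \<in> lie_invariance_algebra C \<theta>"
      using push_lie_invariance_subset[OF inv \<theta>'] \<theta> by auto
    moreover have "Q \<in> vector_fields (to_base ` dom (push_arb \<Psi> \<theta>))"
      using Q lie_invariance_vector_fields by blast
    from push_field_class_iso_pinv[OF inv \<theta>' this]
    have "push_field (proj_map pi0 \<Psi>) (push_field (proj_map pi0 (pinv \<Psi>)) Q) = Q"
      by (simp add: pinv_pinv[OF point_transformationD(1)[OF \<Psi>(2)]])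
    ultimately show "Q \<in> push_field (proj_map pi0 \<Psi>) ` lie_invariance_algebra C \<theta>"
      by (metis imageI)
  qed
qed (rule push_lie_invariance_subset[OF assms])

text \<open>Injectivity lets the push-forward commute with the intersection in
  \<open>kernel_algebra\<close> and preserve proper inclusions.\<close>

lemma inj_on_push_field:
  assumes "class_iso \<Psi> C C'" "\<theta> \<in> arbs C"
  shows "inj_on (push_field (proj_map pi0 \<Psi>)) (vector_fields (to_base ` dom \<theta>))"
  by (rule inj_on_inverseI) (rule push_field_class_iso_pinv[OF assms])

lemma push_kernel_algebra:
  assumes iso: "class_iso \<Psi> C C'" and D: "D \<in> dom ` arbs C"
  shows "push_field (proj_map pi0 \<Psi>) ` kernel_algebra C D = kernel_algebra C' (push_system \<Psi> D)"
proof -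
  note \<Psi> = class_isoD[OF iso]
  let ?S = "{\<theta> \<in> arbs C. dom \<theta> = D}"
  \<comment> \<open>A member of the index set is required for \<open>image_INT\<close>: an empty
    intersection would consist of all functions, and its image need not.\<close>
  obtain \<theta>\<^sub>0 where \<theta>\<^sub>0: "\<theta>\<^sub>0 \<in> ?S" using D by blast
  have "{\<theta>' \<in> arbs C'. dom \<theta>' = push_system \<Psi> D} = push_arb \<Psi> ` ?S"
  proof (intro set_eqI iffI)
    fix \<theta>' assume "\<theta>' \<in> {\<theta>' \<in> arbs C'. dom \<theta>' = push_system \<Psi> D}"
    then obtain \<theta> where \<theta>: "\<theta> \<in> arbs C" "\<theta>' = push_arb \<Psi> \<theta>" "dom \<theta>' = push_system \<Psi> D"
      using \<Psi>(5) by blast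
    then have eq: "push_system \<Psi> (dom \<theta>) = push_system \<Psi> D" using class_iso_dom(2)[OF iso] by simp
    have "dom \<theta> \<subseteq> fst ` dom \<Psi>" if "\<theta> \<in> arbs C" for \<theta>
      by (rule graph_subset_imp[OF \<Psi>(3)[OF that]])
    then have "dom \<theta> \<subseteq> fst ` dom \<Psi>" "D \<subseteq> fst ` dom \<Psi>" using \<theta>(1) D by blast+
    \<comment> \<open>On subsets of the projected domain of \<Psi>, \<open>push_system\<close> has a
      left inverse, so equal images come from equal domains.\<close>
    then have "dom \<theta> = D" using eq push_system_pinv[OF \<Psi>(2)] by metis
    then show "\<theta>' \<in> push_arb \<Psi> ` ?S" using \<theta> by blast
  qed (use \<Psi>(4) class_iso_dom(2)[OF iso] in auto)
  then have "kernel_algebra C' (push_system \<Psi> D) = (\<Inter>\<theta>\<in>?S. lie_invariance_algebra C' (push_arb \<Psi> \<theta>))"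
    by (simp add: kernel_algebra_def image_image)
  also have "\<dots> = (\<Inter>\<theta>\<in>?S. push_field (proj_map pi0 \<Psi>) ` lie_invariance_algebra C \<theta>)"
    by (intro INF_cong refl) (simp add: push_lie_invariance[OF iso])
  also have "\<dots> = push_field (proj_map pi0 \<Psi>) ` kernel_algebra C D"
    unfolding kernel_algebra_def
  proof (rule image_INT[symmetric])
    show "inj_on (push_field (proj_map pi0 \<Psi>)) (vector_fields (to_base ` D))"
      using inj_on_push_field[OF iso, of \<theta>\<^sub>0] \<theta>\<^sub>0 by simp
    show "\<forall>\<theta>\<in>?S. lie_invariance_algebra C \<theta> \<subseteq> vector_fields (to_base ` D)"
      using lie_invariance_vector_fields by blast
  qed (rule \<theta>\<^sub>0)
  finally show ?thesis by simp
qed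

text \<open>Both sides are the push-forward along the projection of \<Psi> after the conjugate of
  \<open>T\<close>, which agrees with \<open>T\<close> after \<Psi> on the graph of
  \<theta>.\<close>

lemma push_field_conjugate:
  assumes iso: "class_iso \<Psi> C C'" and T: "point_transformation T"
    and Q: "Q \<in> vector_fields (to_base ` dom \<theta>)" and \<theta>: "\<theta> \<in> arbs C"
    and g: "Map.graph \<theta> \<subseteq> dom (conjugate (pinv \<Psi>) T)"
  shows "push_field (proj_map pi0 T) (push_field (proj_map pi0 \<Psi>) Q)
    = push_field (proj_map pi0 \<Psi>) (push_field (proj_map pi0 (conjugate (pinv \<Psi>) T)) Q)"
proof -
  note \<Psi> = class_isoD[OF iso]
  let ?T = "conjugate (pinv \<Psi>) T"
  have T': "point_transformation ?T"
    by (rule point_transformation_conjugate[OF point_transformation_pinv[OF \<Psi>(2)] T])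
  note p = point_transformationD[OF \<Psi>(2)] and q = point_transformationD[OF T]
    and q' = point_transformationD[OF T']
    and h = point_transformationD[OF point_transformation_comp[OF \<Psi>(2) T']]
  have ex: "\<exists>w v y. proj_map pi0 \<Psi> x = Some w \<and> proj_map pi0 T w = Some y \<and>
      proj_map pi0 ?T x = Some v \<and> proj_map pi0 \<Psi> v = Some y \<and> proj_map pi0 (\<Psi> \<circ>\<^sub>m ?T) x = Some y"
    if x: "x \<in> to_base ` dom \<theta>" for x
  proof -
    \<comment> \<open>The base point is lifted to the graph of \<theta>, where the transformations
      themselves can be composed and not merely their projections.\<close>
    obtain z t where z: "x = to_base z" "\<theta> z = Some t" using x by blast
    then have "(z, t) \<in> dom ?T" using g by (auto simp: Map.graph_def)
    then obtain v where v: "?T (z, t) = Some v" by blast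
    then obtain u y where u: "\<Psi> (z, t) = Some u" "T u = Some y" "\<Psi> v = Some y"
      unfolding conjugate_Some[OF inj_pinv[OF p(1)]] pinv_eq_Some[OF p(1)] by blast
    then have "(\<Psi> \<circ>\<^sub>m ?T) (z, t) = Some y" using v by simp
    moreover have "pi0 (z, t) = x" by (simp add: pi0_def z)
    ultimately show ?thesis
      using proj_map_Some[OF p(3) u(1)] proj_map_Some[OF q(3) u(2)] proj_map_Some[OF q'(3) v]
        proj_map_Some[OF p(3) u(3)] proj_map_Some[OF h(3)] by blast
  qed
  have Q0: "Q x = 0" if "x \<notin> to_base ` dom \<theta>" for x
    using Q that unfolding vector_fields_def by blast
  note o = class_iso_dom(3)[OF iso \<theta>]
  have "push_field (proj_map pi0 T) (push_field (proj_map pi0 \<Psi>) Q) = push_field (proj_map pi0 (\<Psi> \<circ>\<^sub>m ?T)) Q"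
    using ex by (intro push_field_comp[OF p(4) q(4) h(4) o Q0]) blast+
  moreover have "push_field (proj_map pi0 \<Psi>) (push_field (proj_map pi0 ?T) Q) = push_field (proj_map pi0 (\<Psi> \<circ>\<^sub>m ?T)) Q"
    using ex by (intro push_field_comp[OF q'(4) p(4) h(4) o Q0]) blast+
  ultimately show ?thesis by simp
qed

section \<open>Images of uniform families and of classification lists\<close>

text \<open>The image family is determined on \<open>arbs C'\<close> only; going through
  \<open>pinv \<Psi>\<close> makes it a total function without choosing preimages.\<close>

definition push_family ::
  "(('n::finite, 'm::finite, 'r::finite, 'k::finite) ext \<rightharpoonup> ('n, 'm, 'r, 'k) ext) \<Rightarrow>
   (('n, 'm, 'r, 'k) arb \<Rightarrow> (('n, 'm) base \<Rightarrow> ('n, 'm) base) set) \<Rightarrow>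
   (('n, 'm, 'r, 'k) arb \<Rightarrow> (('n, 'm) base \<Rightarrow> ('n, 'm) base) set)" where
  "push_family \<Psi> g \<theta> = push_field (proj_map pi0 \<Psi>) ` g (push_arb (pinv \<Psi>) \<theta>)"

lemma push_family_push_arb:
  assumes "class_iso \<Psi> C C'" "\<theta> \<in> arbs C"
  shows "push_family \<Psi> g (push_arb \<Psi> \<theta>) = push_field (proj_map pi0 \<Psi>) ` g \<theta>"
  unfolding push_family_def
    push_arb_pinv[OF class_isoD(2)[OF assms(1)] class_isoD(3)[OF assms]] ..

lemma uniform_familyD:
  assumes "uniform_family C g" "\<theta> \<in> arbs C"
  shows "lie_subalgebra (to_base ` dom \<theta>) (g \<theta>) (lie_invariance_algebra C \<theta>)"
    "g \<theta> \<subseteq> lie_invariance_algebra C \<theta>"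
    "\<And>T. T \<in> equiv_group C \<Longrightarrow> acts_on T \<theta> \<Longrightarrow> push_field (proj_map pi0 T) ` g \<theta> = g (push_arb T \<theta>)"
  using assms by (auto simp: uniform_family_def lie_subalgebra_def)

text \<open>Conjugation by \<open>pinv \<Psi>\<close> takes the equivalence group of
  \<open>C'\<close> to that of \<open>C\<close>, where uniformity of \<open>g\<close> applies;
  \<open>push_field_conjugate\<close> carries the result back.\<close>

lemma uniform_push_family:
  assumes iso: "class_iso \<Psi> C C'" and g: "uniform_family C g"
  shows "uniform_family C' (push_family \<Psi> g)"
  unfolding uniform_family_def
proof (intro conjI ballI impI)
  note \<Psi> = class_isoD[OF iso] and inv = class_iso_pinv[OF iso]
  note p = point_transformationD[OF \<Psi>(2)]
  fix \<theta>' assume \<theta>': "\<theta>' \<in> arbs C'"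
  then obtain \<theta> where \<theta>: "\<theta> \<in> arbs C" "\<theta>' = push_arb \<Psi> \<theta>" using \<Psi>(5) by blast
  note d = class_iso_dom[OF iso \<theta>(1)] and u = uniform_familyD[OF g \<theta>(1)]
  show "lie_subalgebra (to_base ` dom \<theta>') (push_family \<Psi> g \<theta>') (lie_invariance_algebra C' \<theta>')"
    unfolding \<theta>(2) push_family_push_arb[OF iso \<theta>(1)] d(5)
    by (rule push_lie_subalgebra[OF p(4) d(3,4) lie_invariance_vector_fields
          push_lie_invariance_subset[OF iso \<theta>(1)] u(1)])
  fix T assume T: "T \<in> equiv_group C'" and a: "acts_on T \<theta>'"
  note t = equiv_groupD[OF T]
  let ?T = "conjugate (pinv \<Psi>) T"
  have \<theta>'': "push_arb (pinv \<Psi>) \<theta>' = \<theta>"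
    unfolding \<theta>(2) by (rule push_arb_pinv[OF \<Psi>(2) \<Psi>(3)[OF \<theta>(1)]])
  \<comment> \<open>\<open>acts_on\<close> constrains domains only; membership of \<open>T\<close>
    in the equivalence group strengthens it to definedness of the conjugate on the whole
    graph.\<close>
  have gr: "Map.graph \<theta> \<subseteq> dom ?T"
    using maps_class_conjugate(1)[OF inv t(2,3) \<theta>' a] by (simp add: \<theta>'')
  have "push_field (proj_map pi0 T) ` push_family \<Psi> g \<theta>'
      = (\<lambda>Q. push_field (proj_map pi0 T) (push_field (proj_map pi0 \<Psi>) Q)) ` g \<theta>"
    unfolding push_family_def \<theta>'' image_image ..
  also have "\<dots> = (\<lambda>Q. push_field (proj_map pi0 \<Psi>) (push_field (proj_map pi0 ?T) Q)) ` g \<theta>"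
  proof (rule image_cong[OF refl])
    fix Q assume "Q \<in> g \<theta>"
    then have "Q \<in> vector_fields (to_base ` dom \<theta>)" using u(2) lie_invariance_vector_fields by blast
    then show "push_field (proj_map pi0 T) (push_field (proj_map pi0 \<Psi>) Q)
        = push_field (proj_map pi0 \<Psi>) (push_field (proj_map pi0 ?T) Q)"
      by (rule push_field_conjugate[OF iso t(2) _ \<theta>(1) gr])
  qed
  also have "\<dots> = push_field (proj_map pi0 \<Psi>) ` push_field (proj_map pi0 ?T) ` g \<theta>"
    unfolding image_image ..
  also have "\<dots> = push_field (proj_map pi0 \<Psi>) ` g (push_arb ?T \<theta>)"
    using u(3)[OF equiv_group_conjugate[OF inv T]] graph_subset_imp[OF gr] by (simp add: acts_on_def)
  also have "push_arb ?T \<theta> = push_arb (pinv \<Psi>) (push_arb T \<theta>')"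
    using push_arb_conjugate[OF inv t(2) \<theta>'] by (simp add: \<theta>'')
  finally show "push_field (proj_map pi0 T) ` push_family \<Psi> g \<theta>' = push_family \<Psi> g (push_arb T \<theta>')"
    unfolding push_family_def .
qed

lemma push_family_psubset_iff:
  assumes iso: "class_iso \<Psi> C C'" and g: "uniform_family C g" and \<theta>: "\<theta> \<in> arbs C"
  shows "push_family \<Psi> g (push_arb \<Psi> \<theta>) \<subset> lie_invariance_algebra C' (push_arb \<Psi> \<theta>)
    \<longleftrightarrow> g \<theta> \<subset> lie_invariance_algebra C \<theta>"
proof -
  have "g \<theta> \<subseteq> vector_fields (to_base ` dom \<theta>)"
    using uniform_familyD(2)[OF g \<theta>] lie_invariance_vector_fields by blast
  then show ?thesis
    unfolding push_family_push_arb[OF iso \<theta>] push_lie_invariance[OF iso \<theta>, symmetric] psubset_eq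
    using inj_on_image_subset_iff[OF inj_on_push_field[OF iso \<theta>]]
      inj_on_image_eq_iff[OF inj_on_push_field[OF iso \<theta>]] lie_invariance_vector_fields by metis
qed

text \<open>Completeness of the image list moves an equivalence forward along \<Psi>, and
  inequivalence of its members moves one back.\<close>

lemma push_classification_list:
  assumes iso: "class_iso \<Psi> C C'" and g: "uniform_family C g" and \<Lambda>: "classification_list C g \<Lambda>"
  shows "classification_list C' (push_family \<Psi> g) (push_arb \<Psi> ` \<Lambda>)"
  unfolding classification_list_def
proof (intro conjI ballI impI subsetI)
  note \<Psi> = class_isoD[OF iso] and iff = push_family_psubset_iff[OF iso g]
  note L = \<Lambda>[unfolded classification_list_def]
  have \<Lambda>1: "\<theta> \<in> arbs C" "g \<theta> \<subset> lie_invariance_algebra C \<theta>" if "\<theta> \<in> \<Lambda>" for \<theta>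
    using subsetD[OF conjunct1[OF L] that] by simp_all
  have \<Lambda>2: "\<exists>\<theta>'\<in>\<Lambda>. equivalent_arbs C \<theta> \<theta>'"
    if "\<theta> \<in> arbs C" "g \<theta> \<subset> lie_invariance_algebra C \<theta>" for \<theta>
    using conjunct1[OF conjunct2[OF L]] that by simp
  have \<Lambda>3: "\<theta>\<^sub>1 = \<theta>\<^sub>2" if "\<theta>\<^sub>1 \<in> \<Lambda>" "\<theta>\<^sub>2 \<in> \<Lambda>" "equivalent_arbs C \<theta>\<^sub>1 \<theta>\<^sub>2" for \<theta>\<^sub>1 \<theta>\<^sub>2
    using conjunct2[OF conjunct2[OF L]] that by simp
  { fix \<theta>' assume "\<theta>' \<in> push_arb \<Psi> ` \<Lambda>"
    then obtain \<theta> where \<theta>: "\<theta> \<in> \<Lambda>" "\<theta>' = push_arb \<Psi> \<theta>" by blast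
    show "\<theta>' \<in> {\<theta> \<in> arbs C'. push_family \<Psi> g \<theta> \<subset> lie_invariance_algebra C' \<theta>}"
      unfolding \<theta>(2) using \<Psi>(4) iff \<Lambda>1[OF \<theta>(1)] by simp }
  { fix \<theta>' assume "\<theta>' \<in> arbs C'" and "push_family \<Psi> g \<theta>' \<subset> lie_invariance_algebra C' \<theta>'"
    moreover from this(1) obtain \<theta> where \<theta>: "\<theta> \<in> arbs C" "\<theta>' = push_arb \<Psi> \<theta>" using \<Psi>(5) by blast
    ultimately have "g \<theta> \<subset> lie_invariance_algebra C \<theta>" using iff[OF \<theta>(1)] by simp
    from \<Lambda>2[OF \<theta>(1) this] obtain \<theta>\<^sub>1 where "\<theta>\<^sub>1 \<in> \<Lambda>" "equivalent_arbs C \<theta> \<theta>\<^sub>1" by blast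
    then show "\<exists>\<theta>''\<in>push_arb \<Psi> ` \<Lambda>. equivalent_arbs C' \<theta>' \<theta>''"
      unfolding \<theta>(2) using equivalent_arbs_push[OF iso \<theta>(1)] by blast }
  fix \<theta>\<^sub>1' \<theta>\<^sub>2' assume "\<theta>\<^sub>1' \<in> push_arb \<Psi> ` \<Lambda>" "\<theta>\<^sub>2' \<in> push_arb \<Psi> ` \<Lambda>" and eq: "equivalent_arbs C' \<theta>\<^sub>1' \<theta>\<^sub>2'"
  then obtain \<theta>\<^sub>1 \<theta>\<^sub>2 where \<theta>: "\<theta>\<^sub>1 \<in> \<Lambda>" "\<theta>\<^sub>2 \<in> \<Lambda>" "\<theta>\<^sub>1' = push_arb \<Psi> \<theta>\<^sub>1" "\<theta>\<^sub>2' = push_arb \<Psi> \<theta>\<^sub>2" by blast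
  then have "equivalent_arbs C \<theta>\<^sub>1 \<theta>\<^sub>2"
    using eq equivalent_arbs_push_iff[OF iso] \<Lambda>1(1) by simp
  then show "\<theta>\<^sub>1' = \<theta>\<^sub>2'" using \<Lambda>3[OF \<theta>(1,2)] \<theta>(3,4) by simp
qed

theorem proposition7:
  fixes C :: "('n::finite, 'm::finite, 'r::finite, 'k::finite, 'l::finite, 'q::finite) de_class"
    and C' :: "('n, 'm, 'r, 'k, 'l, 's::finite) de_class"
  assumes "well_formed_class C" and "well_formed_class C'"
    and "similar_classes C C'"
  shows "equivalent_group_classifications C C'"
proof -
  obtain \<Psi> where \<Psi>: "similarity_transformation \<Psi> C C'"
    using assms(3) unfolding similar_classes_def by blast
  note iso = similarity_imp_class_iso[OF \<Psi>]
  show ?thesis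
    unfolding equivalent_group_classifications_def
  proof (intro exI[of _ \<Psi>] conjI ballI allI impI)
    fix g assume g: "uniform_family C g"
    show "\<exists>g'. (\<forall>\<theta>\<in>arbs C. g' (push_arb \<Psi> \<theta>) = push_field (proj_map pi0 \<Psi>) ` g \<theta>) \<and>
        uniform_family C' g' \<and>
        (\<forall>\<Lambda>. classification_list C g \<Lambda> \<longrightarrow> classification_list C' g' (push_arb \<Psi> ` \<Lambda>))"
      using push_family_push_arb[OF iso] uniform_push_family[OF iso g] push_classification_list[OF iso g]
      by (intro exI[of _ "push_family \<Psi> g"]) blast
  qed (simp_all add: \<Psi> equivalent_arbs_push_iff[OF iso] push_kernel_algebra[OF iso])
qed

end
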